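(* Let $(A,\mathcal{C})$ be a crossed module. Then the simplicial set $N(A,\mathcal{C})$ is a Kan complex. Moreover, for every object $t\in\mathcal{C}_0$: $\partial_t(A(t))$ is a normal subgroup of $\mathcal{C}(t,t)$ and $\pi_1(N(A,\mathcal{C}),t)\cong \mathcal{C}(t,t)/\partial_t(A(t))$ as groups; $\pi_2(N(A,\mathcal{C}),t)\cong\operatorname{Ker}(\partial_t)$ as groups; and $\pi_n(N(A,\mathcal{C}),t)$ is trivial for all $n\ge 3$.
   Context: Kan complexes and homotopy groups. For a simplicial set $X$ and $n\ge2$, $\bigwedge^n_lX$ ($0\le l\le n$) is the set of tuples $(x_0,\dots,\widehat{x_l},\dots,x_n)$ of elements of $X_{n-1}$ with $d_jx_k=d_{k-1}x_j$ for all $0\le j<k\le n$ with $j,k\ne l$; $\bigwedge^1_lX=X_0$. The map $b^n_l\colon X_n\to\bigwedge^n_lX$ is $x\mapsto(d_0x,\dots,\widehat{d_lx},\dots,d_nx)$. $X$ is a Kan complex if all $b^n_l$, $n\ge 1$, $0\le l\le n$, are surjective. For a Kan complex $X$, $x\in X_0$ (degeneracies of $x$ are also denoted $x$) and $n\ge1$, $\pi_n(X,x)$ is the set of $y\in X_n$ with all faces equal to $x$, modulo $y\sim z$ iff there is $w\in X_{n+1}$ with $(d_0w,\dots,d_{n+1}w)=(x,\dots,x,y,z)$; the product is $[y][z]=[d_nw]$ where $w\in X_{n+1}$ has $d_jw=x$ for $j<n-1$, $d_{n-1}w=y$, $d_{n+1}w=z$. Crossed monoids and modules. $\mathcal{C}$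 is a small category with object set $\mathcal{C}_0$ and morphism set $\mathcal{C}_1$; $\mathcal{C}(s,t)$ is the set of morphisms with source $s$ and target $t$, and $\alpha\beta$ means $\alpha$ after $\beta$. A crossed monoid $(A,\mathcal{C})$ over $\mathcal{C}$ is a contravariant functor $A$ from $\mathcal{C}$ to the category of monoids (for $\alpha\in\mathcal{C}(s,t)$ and $a\in A(t)$ write $a^\alpha:=A(\alpha)(a)\in A(s)$) together with monoid homomorphisms $\partial_t\colon A(t)\to\mathcal{C}(t,t)$, $t\in\mathcal{C}_0$, such that $\alpha\,\partial_s(a^\alpha)=\partial_t(a)\,\alpha$ and $ab=b\,a^{\partial_t b}$ for all $s,t\in\mathcal{C}_0$, $\alpha\in\mathcal{C}(s,t)$, $a,b\in A(t)$. The unit of $A(x)$ is $e_x$, the identity of $x$ is $1_x$; write $\partial$ for $\partial_t$. A crossed module is a crossed monoid $(A,\mathcal{C})$ such that $\mathcal{C}$ is a groupoid and every $A(t)$ is a group. Nerve. The simplicial set $N(A,\mathcal{C})$ is as follows. $N_0(A,\mathcal{C})=\mathcal{C}_0$. For $n\ge1$, $N_n(A,\mathcal{C})$ is the set of $n\times n$ upper triangular matrices $M=(m_{ij})_{1\le i\le j\le n}$ (entries below the diagonal are absent) for which there is a sequence $(x_0,\dots,x_n)$ of objects of $\mathcal{C}$ with $m_{jj}\in\mathcal{C}(x_j,x_{j-1})$ for $1\le j\le n$ and $m_{ij}\in A(x_i)$ for $1\le i<j\le n$. Thus $N_1(A,\mathcal{C})=\mathcal{C}_1$. Degeneracies: $s_0\colon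 N_0\to N_1$ is $p\mapsto 1_p$. For $n\ge1$, $M\in N_n$, $0\le j\le n$, $s_j(M)=M'\in N_{n+1}$ with: for $i\le j$: $m'_{ik}=m_{ik}$ if $k\le j$, $m'_{i,j+1}=e_{x_i}$, $m'_{ik}=m_{i,k-1}$ if $k>j+1$; $m'_{j+1,j+1}=1_{x_j}$ and $m'_{j+1,k}=e_{x_j}$ for $k>j+1$; for $i>j+1$: $m'_{ik}=m_{i-1,k-1}$. Faces: on $N_1$, $d_0$ is the source map and $d_1$ the target map. For $n\ge2$, $M\in N_n$, $d_j(M)=M'\in N_{n-1}$ with: for $j=0$: $m'_{ik}=m_{i+1,k+1}$; for $j=n$: $m'_{ik}=m_{ik}$; for $1\le j\le n-1$: if $i<j$ then $m'_{ik}=m_{ik}$ for $k<j$, $m'_{ij}=m_{ij}m_{i,j+1}$, $m'_{ik}=m_{i,k+1}$ for $k>j$; $m'_{jj}=m_{jj}\,\partial(m_{j,j+1})\,m_{j+1,j+1}$; $m'_{jk}=(m_{j,k+1})^{\eta_k}\,m_{j+1,k+1}$ for $k>j$, where $\eta_k=m_{j+1,j+1}\,\partial(m_{j+1,j+2}\cdots m_{j+1,k})$ (empty product being the unit, so $\eta_{j+1}=m_{j+1,j+1}$); and $m'_{ik}=m_{i+1,k+1}$ for $i>j$. *)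

theory Defs
  imports "HOL-Algebra.Elementary_Groups"
begin

section \<open>Simplicial sets, Kan complexes, homotopy groups\<close>

text \<open>For \<open>X\<close> a simplicial set, \<open>face X n j\<close> is \<open>d\<^sub>j\<close> from \<open>X\<^sub>n\<close> to \<open>X\<^sub>n\<^sub>-\<^sub>1\<close> (for \<open>n \<ge> 1\<close>,
  \<open>j \<le> n\<close>) and \<open>degen X n j\<close> is \<open>s\<^sub>j\<close> from \<open>X\<^sub>n\<close> to \<open>X\<^sub>n\<^sub>+\<^sub>1\<close> (for \<open>j \<le> n\<close>).\<close>

record 's sset =
  simplices :: "nat \<Rightarrow> 's set"
  face :: "nat \<Rightarrow> nat \<Rightarrow> 's \<Rightarrow> 's"
  degen :: "nat \<Rightarrow> nat \<Rightarrow> 's \<Rightarrow> 's"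

locale simplicial_set =
  fixes X :: "'s sset"
  assumes face_closed: "\<lbrakk>j \<le> Suc n; x \<in> simplices X (Suc n)\<rbrakk> \<Longrightarrow> face X (Suc n) j x \<in> simplices X n"
    and degen_closed: "\<lbrakk>j \<le> n; x \<in> simplices X n\<rbrakk> \<Longrightarrow> degen X n j x \<in> simplices X (Suc n)"
    and face_face: "\<lbrakk>i < j; j \<le> Suc (Suc n); x \<in> simplices X (Suc (Suc n))\<rbrakk> \<Longrightarrow>
      face X (Suc n) i (face X (Suc (Suc n)) j x) =
      face X (Suc n) (j - 1) (face X (Suc (Suc n)) i x)"
    and degen_degen: "\<lbrakk>i \<le> j; j \<le> n; x \<in> simplices X n\<rbrakk> \<Longrightarrow>
      degen X (Suc n) i (degen X n j x) = degen X (Suc n) (Suc j) (degen X n i x)"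
    and face_degen_lt: "\<lbrakk>i < j; j \<le> Suc n; x \<in> simplices X (Suc n)\<rbrakk> \<Longrightarrow>
      face X (Suc (Suc n)) i (degen X (Suc n) j x) = degen X n (j - 1) (face X (Suc n) i x)"
    and face_degen_eq: "\<lbrakk>j \<le> n; i = j \<or> i = Suc j; x \<in> simplices X n\<rbrakk> \<Longrightarrow>
      face X (Suc n) i (degen X n j x) = x"
    and face_degen_gt: "\<lbrakk>Suc j < i; i \<le> Suc (Suc n); x \<in> simplices X (Suc n)\<rbrakk> \<Longrightarrow>
      face X (Suc (Suc n)) i (degen X (Suc n) j x) = degen X n j (face X (Suc n) (i - 1) x)"

text \<open>A tuple with the \<open>l\<close>-th entry omitted is a function on \<open>{0..n} - {l}\<close>.  For \<open>n = 1\<close> the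
  compatibility condition is vacuous and the tuple is a single vertex, so that the set of
  horns is a copy of \<open>X\<^sub>0\<close>.\<close>

definition horn :: "'s sset \<Rightarrow> nat \<Rightarrow> nat \<Rightarrow> (nat \<Rightarrow> 's) set" where
  "horn X n l = {x \<in> {0..n} - {l} \<rightarrow>\<^sub>E simplices X (n - 1).
     \<forall>j k. j < k \<and> k \<le> n \<and> j \<noteq> l \<and> k \<noteq> l \<longrightarrow> face X (n - 1) j (x k) = face X (n - 1) (k - 1) (x j)}"

definition horn_map :: "'s sset \<Rightarrow> nat \<Rightarrow> nat \<Rightarrow> 's \<Rightarrow> (nat \<Rightarrow> 's)" where
  "horn_map X n l y = (\<lambda>k \<in> {0..n} - {l}. face X n k y)"

locale kan_complex = simplicial_set +
  assumes horn_map_surj: "\<lbrakk>1 \<le> n; l \<le> n\<rbrakk> \<Longrightarrow> horn_map X n l ` simplices X n = horn X n l"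

text \<open>The degeneracy of the vertex \<open>x\<close> in dimension \<open>n\<close>; it does not depend on which
  degeneracies are used.\<close>

primrec degen_vertex :: "'s sset \<Rightarrow> 's \<Rightarrow> nat \<Rightarrow> 's" where
  "degen_vertex X x 0 = x"
| "degen_vertex X x (Suc n) = degen X n 0 (degen_vertex X x n)"

definition spheres :: "'s sset \<Rightarrow> 's \<Rightarrow> nat \<Rightarrow> 's set" where
  "spheres X x n = {y \<in> simplices X n. \<forall>j\<le>n. face X n j y = degen_vertex X x (n - 1)}"

definition sphere_rel :: "'s sset \<Rightarrow> 's \<Rightarrow> nat \<Rightarrow> ('s \<times> 's) set" where
  "sphere_rel X x n = {(y, z). y \<in> spheres X x n \<and> z \<in> spheres X x n \<and>
     (\<exists>w \<in> simplices X (n + 1). (\<forall>j<n. face X (n + 1) j w = degen_vertex X x n) \<and>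
        face X (n + 1) n w = y \<and> face X (n + 1) (n + 1) w = z)}"

definition mult_fillers :: "'s sset \<Rightarrow> 's \<Rightarrow> nat \<Rightarrow> 's \<Rightarrow> 's \<Rightarrow> 's set" where
  "mult_fillers X x n y z = {w \<in> simplices X (n + 1).
     (\<forall>j<n - 1. face X (n + 1) j w = degen_vertex X x n) \<and>
     face X (n + 1) (n - 1) w = y \<and> face X (n + 1) (n + 1) w = z}"

text \<open>The product of two classes is the union of the classes \<open>[d\<^sub>n w]\<close> over all representatives
  and all fillers; it is a single class exactly because the product is independent of these
  choices.\<close>

definition homotopy_group :: "nat \<Rightarrow> 's sset \<Rightarrow> 's \<Rightarrow> 's set monoid" where
  "homotopy_group n X x =
     \<lparr>carrier = spheres X x n // sphere_rel X x n,
      mult = (\<lambda>P Q. \<Union>y\<in>P. \<Union>z\<in>Q. \<Union>w\<in>mult_fillers X x n y z. sphere_rel X x n `` {face X (n + 1) n w}),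
      one = sphere_rel X x n `` {degen_vertex X x n}\<rparr>"

section \<open>Crossed monoids and crossed modules\<close>

text \<open>\<open>comp C \<alpha> \<beta>\<close> is \<open>\<alpha>\<close> after \<open>\<beta>\<close>.\<close>

record ('o, 'm) cat =
  Obj :: "'o set"
  Arr :: "'m set"
  src :: "'m \<Rightarrow> 'o"
  tgt :: "'m \<Rightarrow> 'o"
  ident :: "'o \<Rightarrow> 'm"
  comp :: "'m \<Rightarrow> 'm \<Rightarrow> 'm"

definition Hom :: "('o, 'm) cat \<Rightarrow> 'o \<Rightarrow> 'o \<Rightarrow> 'm set" where
  "Hom C s t = {\<alpha> \<in> Arr C. src C \<alpha> = s \<and> tgt C \<alpha> = t}"

locale small_category =
  fixes C :: "('o, 'm) cat"
  assumes src_Obj: "\<alpha> \<in> Arr C \<Longrightarrow> src C \<alpha> \<in> Obj C"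
    and tgt_Obj: "\<alpha> \<in> Arr C \<Longrightarrow> tgt C \<alpha> \<in> Obj C"
    and ident_Hom: "t \<in> Obj C \<Longrightarrow> ident C t \<in> Hom C t t"
    and comp_Hom: "\<lbrakk>\<alpha> \<in> Hom C s t; \<beta> \<in> Hom C r s\<rbrakk> \<Longrightarrow> comp C \<alpha> \<beta> \<in> Hom C r t"
    and comp_ident_right: "\<alpha> \<in> Hom C s t \<Longrightarrow> comp C \<alpha> (ident C s) = \<alpha>"
    and comp_ident_left: "\<alpha> \<in> Hom C s t \<Longrightarrow> comp C (ident C t) \<alpha> = \<alpha>"
    and comp_assoc: "\<lbrakk>\<alpha> \<in> Hom C s t; \<beta> \<in> Hom C r s; \<gamma> \<in> Hom C q r\<rbrakk> \<Longrightarrow>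
      comp C (comp C \<alpha> \<beta>) \<gamma> = comp C \<alpha> (comp C \<beta> \<gamma>)"

locale small_groupoid = small_category +
  assumes arr_invertible: "\<alpha> \<in> Hom C s t \<Longrightarrow>
    \<exists>\<beta> \<in> Hom C t s. comp C \<beta> \<alpha> = ident C s \<and> comp C \<alpha> \<beta> = ident C t"

definition End :: "('o, 'm) cat \<Rightarrow> 'o \<Rightarrow> 'm monoid" where
  "End C t = \<lparr>carrier = Hom C t t, mult = comp C, one = ident C t\<rparr>"

text \<open>\<open>act \<alpha> a\<close> is \<open>a\<^sup>\<alpha>\<close>, and \<open>bd t\<close> is the boundary homomorphism \<open>\<partial>\<^sub>t\<close>.\<close>

locale crossed_monoid = small_category C
  for C :: "('o, 'm) cat" +
  fixes A :: "'o \<Rightarrow> 'a monoid" and act :: "'m \<Rightarrow> 'a \<Rightarrow> 'a" and bd :: "'o \<Rightarrow> 'a \<Rightarrow> 'm"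
  assumes monoid_A: "t \<in> Obj C \<Longrightarrow> monoid (A t)"
    and act_hom: "\<alpha> \<in> Hom C s t \<Longrightarrow> act \<alpha> \<in> hom (A t) (A s)"
    and act_one: "\<alpha> \<in> Hom C s t \<Longrightarrow> act \<alpha> \<one>\<^bsub>A t\<^esub> = \<one>\<^bsub>A s\<^esub>"
    and act_ident: "\<lbrakk>t \<in> Obj C; a \<in> carrier (A t)\<rbrakk> \<Longrightarrow> act (ident C t) a = a"
    and act_comp: "\<lbrakk>\<alpha> \<in> Hom C s t; \<beta> \<in> Hom C r s; a \<in> carrier (A t)\<rbrakk> \<Longrightarrow>
      act (comp C \<alpha> \<beta>) a = act \<beta> (act \<alpha> a)"
    and bd_hom: "t \<in> Obj C \<Longrightarrow> bd t \<in> hom (A t) (End C t)"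
    and bd_one: "t \<in> Obj C \<Longrightarrow> bd t \<one>\<^bsub>A t\<^esub> = ident C t"
    and bd_act: "\<lbrakk>\<alpha> \<in> Hom C s t; a \<in> carrier (A t)\<rbrakk> \<Longrightarrow>
      comp C \<alpha> (bd s (act \<alpha> a)) = comp C (bd t a) \<alpha>"
    and peiffer: "\<lbrakk>t \<in> Obj C; a \<in> carrier (A t); b \<in> carrier (A t)\<rbrakk> \<Longrightarrow>
      a \<otimes>\<^bsub>A t\<^esub> b = b \<otimes>\<^bsub>A t\<^esub> act (bd t b) a"

locale crossed_module = crossed_monoid + small_groupoid C +
  assumes group_A: "t \<in> Obj C \<Longrightarrow> group (A t)"

section \<open>The nerve\<close>

text \<open>An upper triangular matrix consists of its diagonal \<open>i \<mapsto> m\<^sub>i\<^sub>i\<close> (morphisms) and its entries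
  \<open>(i, k) \<mapsto> m\<^sub>i\<^sub>k\<close> for \<open>i < k\<close> (elements of the monoids \<open>A(x\<^sub>i)\<close>).  Rows and columns are numbered
  from 1; values at absent positions are \<open>undefined\<close>.\<close>

datatype ('o, 'm, 'a) nerve_simplex =
    Vertex 'o
  | Matrix "nat \<Rightarrow> 'm" "nat \<times> nat \<Rightarrow> 'a"

definition above_diag :: "nat \<Rightarrow> (nat \<times> nat) set" where
  "above_diag n = {(i, k). 1 \<le> i \<and> i < k \<and> k \<le> n}"

definition mk_matrix :: "nat \<Rightarrow> (nat \<Rightarrow> 'm) \<Rightarrow> (nat \<Rightarrow> nat \<Rightarrow> 'a) \<Rightarrow> ('o, 'm, 'a) nerve_simplex" where
  "mk_matrix n d u = Matrix (restrict d {1..n}) (restrict (\<lambda>(i, k). u i k) (above_diag n))"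

definition nerve_simplices :: "('o, 'm) cat \<Rightarrow> ('o \<Rightarrow> 'a monoid) \<Rightarrow> nat \<Rightarrow> ('o, 'm, 'a) nerve_simplex set" where
  "nerve_simplices C A n =
    (if n = 0 then Vertex ` Obj C
     else {Matrix d u | d u. d \<in> extensional {1..n} \<and> u \<in> extensional (above_diag n) \<and>
       (\<exists>x. (\<forall>i\<le>n. x i \<in> Obj C) \<and>
            (\<forall>j. 1 \<le> j \<and> j \<le> n \<longrightarrow> d j \<in> Hom C (x j) (x (j - 1))) \<and>
            (\<forall>i k. 1 \<le> i \<and> i < k \<and> k \<le> n \<longrightarrow> u (i, k) \<in> carrier (A (x i))))})"

text \<open>The object \<open>x\<^sub>i\<close> of a matrix with diagonal \<open>d\<close>.\<close>

definition vtx :: "('o, 'm) cat \<Rightarrow> (nat \<Rightarrow> 'm) \<Rightarrow> nat \<Rightarrow> 'o" where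
  "vtx C d i = (if i = 0 then tgt C (d 1) else src C (d i))"

primrec nerve_degen ::
  "('o, 'm) cat \<Rightarrow> ('o \<Rightarrow> 'a monoid) \<Rightarrow> nat \<Rightarrow> nat \<Rightarrow> ('o, 'm, 'a) nerve_simplex \<Rightarrow> ('o, 'm, 'a) nerve_simplex"
where
  "nerve_degen C A n j (Vertex p) = mk_matrix 1 (\<lambda>_. ident C p) (\<lambda>_ _. undefined)"
| "nerve_degen C A n j (Matrix d u) = mk_matrix (n + 1)
    (\<lambda>i. if i \<le> j then d i
         else if i = j + 1 then ident C (vtx C d j)
         else d (i - 1))
    (\<lambda>i k. if i \<le> j then
             (if k \<le> j then u (i, k)
              else if k = j + 1 then \<one>\<^bsub>A (vtx C d i)\<^esub>
              else u (i, k - 1))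
           else if i = j + 1 then \<one>\<^bsub>A (vtx C d j)\<^esub>
           else u (i - 1, k - 1))"

text \<open>\<open>row_prod C A d u i k\<close> is \<open>m\<^sub>i\<^sub>,\<^sub>i\<^sub>+\<^sub>1 \<cdots> m\<^sub>i\<^sub>k\<close>, in this order, in \<open>A(x\<^sub>i)\<close>; \<open>nerve_eta\<close> with
  arguments \<open>j\<close> and \<open>k\<close> is the morphism \<open>\<eta>\<^sub>k\<close> occurring in \<open>d\<^sub>j\<close>.\<close>

definition row_prod ::
  "('o, 'm) cat \<Rightarrow> ('o \<Rightarrow> 'a monoid) \<Rightarrow> (nat \<Rightarrow> 'm) \<Rightarrow> (nat \<times> nat \<Rightarrow> 'a) \<Rightarrow> nat \<Rightarrow> nat \<Rightarrow> 'a" where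
  "row_prod C A d u i k =
     foldr (\<lambda>l p. u (i, l) \<otimes>\<^bsub>A (vtx C d i)\<^esub> p) [i + 1..<k + 1] \<one>\<^bsub>A (vtx C d i)\<^esub>"

definition nerve_eta ::
  "('o, 'm) cat \<Rightarrow> ('o \<Rightarrow> 'a monoid) \<Rightarrow> ('o \<Rightarrow> 'a \<Rightarrow> 'm) \<Rightarrow>
   (nat \<Rightarrow> 'm) \<Rightarrow> (nat \<times> nat \<Rightarrow> 'a) \<Rightarrow> nat \<Rightarrow> nat \<Rightarrow> 'm" where
  "nerve_eta C A bd d u j k =
     comp C (d (j + 1)) (bd (vtx C d (j + 1)) (row_prod C A d u (j + 1) k))"

primrec nerve_face ::
  "('o, 'm) cat \<Rightarrow> ('o \<Rightarrow> 'a monoid) \<Rightarrow> ('m \<Rightarrow> 'a \<Rightarrow> 'a) \<Rightarrow> ('o \<Rightarrow> 'a \<Rightarrow> 'm) \<Rightarrow>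
   nat \<Rightarrow> nat \<Rightarrow> ('o, 'm, 'a) nerve_simplex \<Rightarrow> ('o, 'm, 'a) nerve_simplex"
where
  "nerve_face C A act bd n j (Vertex p) = undefined"
| "nerve_face C A act bd n j (Matrix d u) =
    (if n = 1 then Vertex (if j = 0 then src C (d 1) else tgt C (d 1))
     else if j = 0 then mk_matrix (n - 1) (\<lambda>i. d (i + 1)) (\<lambda>i k. u (i + 1, k + 1))
     else if j = n then mk_matrix (n - 1) d (\<lambda>i k. u (i, k))
     else mk_matrix (n - 1)
      (\<lambda>i. if i < j then d i
           else if i = j then comp C (d j) (comp C (bd (vtx C d j) (u (j, j + 1))) (d (j + 1)))
           else d (i + 1))
      (\<lambda>i k. if i < j then
               (if k < j then u (i, k)
                else if k = j then u (i, j) \<otimes>\<^bsub>A (vtx C d i)\<^esub> u (i, j + 1)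
                else u (i, k + 1))
             else if i = j then
               act (nerve_eta C A bd d u j k) (u (j, k + 1)) \<otimes>\<^bsub>A (vtx C d (j + 1))\<^esub> u (j + 1, k + 1)
             else u (i + 1, k + 1)))"

definition nerve ::
  "('o, 'm) cat \<Rightarrow> ('o \<Rightarrow> 'a monoid) \<Rightarrow> ('m \<Rightarrow> 'a \<Rightarrow> 'a) \<Rightarrow> ('o \<Rightarrow> 'a \<Rightarrow> 'm) \<Rightarrow>
   ('o, 'm, 'a) nerve_simplex sset" where
  "nerve C A act bd =
     \<lparr>simplices = nerve_simplices C A, face = nerve_face C A act bd, degen = nerve_degen C A\<rparr>"

end

theory Submission
  imports Defs
begin

text \<open>A crossed module is a strict 2-groupoid in disguise: the morphisms of \<open>C\<close> are its 1-cells, and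
  \<open>a \<in> A(t)\<close> is a 2-cell from \<open>\<alpha>\<beta>\<close> to \<open>\<alpha> \<partial>(a) \<beta>\<close>.  The nerve of a 2-groupoid has a familiar description:
  an \<open>n\<close>-simplex has vertices \<open>x\<^sub>i\<close>, edges \<open>f\<^sub>i\<^sub>j : x\<^sub>j \<rightarrow> x\<^sub>i\<close> for \<open>i \<le> j\<close> and a 2-cell
  \<open>a\<^sub>i\<^sub>j\<^sub>k \<in> A(x\<^sub>j)\<close> with \<open>f\<^sub>i\<^sub>k = f\<^sub>i\<^sub>j \<partial>(a\<^sub>i\<^sub>j\<^sub>k) f\<^sub>j\<^sub>k\<close> for each triangle, and every tetrahedron commutes:
  the two ways of pasting its four triangles agree.  In this description the simplicial operators merely
  reindex, whence the simplicial identities are identities between monotone maps of numbers.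

  The matrices are another set of coordinates on the same simplicial set.  The diagonal of the
  matrix is the spine \<open>f\<^sub>i\<^sub>-\<^sub>1\<^sub>,\<^sub>i\<close>, and its \<open>i\<close>-th row consists of the successive quotients of
  \<open>a\<^sub>i\<^sub>-\<^sub>1\<^sub>,\<^sub>i\<^sub>,\<^sub>k\<close> for \<open>k = i, i + 1, \<dots>\<close>, so that products along a row telescope (\<open>nerve_face_matrix_of\<close>,
  \<open>nerve_degen_matrix_of\<close>).  These data are free, since the
  commuting tetrahedra determine all other edges and triangles and impose no further condition
  (\<open>agree_if_spine\<close>, \<open>cocycle_cone\<close>).

  Horns are filled in the geometric description.  For \<open>n = 2\<close> an equation between morphisms is
  solved for one of them.  For \<open>n = 3\<close> only one triangle is missing; it is found from the
  tetrahedron equation, and its boundary is then correct because the boundary equations of the other three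
  triangles imply it (\<open>fill_tetrahedron\<close>).  For \<open>n \<ge> 4\<close> the horn contains all triangles,
  and its faces are glued (\<open>fill_labelled_horn\<close>); only for \<open>n = 4\<close> is there a tetrahedron in no face of the horn,
  and it commutes because the other four tetrahedra of a 4-simplex do (\<open>pentagon\<close>).

  Finally, 1-spheres at \<open>t\<close> are endomorphisms of \<open>t\<close>, two being homotopic when they differ by a
  boundary; 2-spheres are elements of the kernel of \<open>\<partial>\<close>, and a tetrahedron with two trivial faces
  forces the other two to be equal; in dimension at least 3 a sphere has only trivial triangles.  The product in
  \<open>\<pi>\<^sub>1\<close> is composition in the opposite order, so the isomorphism in \<open>pi_1\<close> involves inversion.\<close>

section \<open>Computing in a crossed module\<close>

context crossed_module
begin

abbreviation arrow_comp (infixr "\<cdot>" 75) where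
  "\<alpha> \<cdot> \<beta> \<equiv> comp C \<alpha> \<beta>"

lemma Hom_Obj:
  assumes "\<alpha> \<in> Hom C s t"
  shows "s \<in> Obj C" "t \<in> Obj C"
  using assms src_Obj tgt_Obj by (auto simp: Hom_def)

lemma Hom_src_tgt:
  assumes "\<alpha> \<in> Hom C s t"
  shows "src C \<alpha> = s" "tgt C \<alpha> = t"
  using assms by (auto simp: Hom_def)

lemma act_closed: "\<lbrakk>\<alpha> \<in> Hom C s t; a \<in> carrier (A t)\<rbrakk> \<Longrightarrow> act \<alpha> a \<in> carrier (A s)"
  using act_hom by (fastforce simp: hom_def)

lemma act_mult:
  "\<lbrakk>\<alpha> \<in> Hom C s t; a \<in> carrier (A t); b \<in> carrier (A t)\<rbrakk>
    \<Longrightarrow> act \<alpha> (a \<otimes>\<^bsub>A t\<^esub> b) = act \<alpha> a \<otimes>\<^bsub>A s\<^esub> act \<alpha> b"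
  using act_hom by (fastforce simp: hom_def)

lemma act_inv:
  assumes "\<alpha> \<in> Hom C s t" "a \<in> carrier (A t)"
  shows "act \<alpha> (inv\<^bsub>A t\<^esub> a) = inv\<^bsub>A s\<^esub> act \<alpha> a"
  using group_hom.hom_inv[of "A t" "A s" "act \<alpha>" a] assms group_A Hom_Obj act_hom
  by (simp add: group_hom_def group_hom_axioms_def)

lemma bd_closed: "\<lbrakk>t \<in> Obj C; a \<in> carrier (A t)\<rbrakk> \<Longrightarrow> bd t a \<in> Hom C t t"
  using bd_hom by (fastforce simp: hom_def End_def)

lemma bd_mult:
  "\<lbrakk>t \<in> Obj C; a \<in> carrier (A t); b \<in> carrier (A t)\<rbrakk> \<Longrightarrow> bd t (a \<otimes>\<^bsub>A t\<^esub> b) = bd t a \<cdot> bd t b"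
  using bd_hom by (fastforce simp: hom_def End_def)

lemma comp_cancel_left:
  assumes "\<alpha> \<in> Hom C s t" "\<beta> \<in> Hom C r s" "\<gamma> \<in> Hom C r s" "\<alpha> \<cdot> \<beta> = \<alpha> \<cdot> \<gamma>"
  shows "\<beta> = \<gamma>"
proof -
  obtain \<alpha>' where \<alpha>': "\<alpha>' \<in> Hom C t s" "\<alpha>' \<cdot> \<alpha> = ident C s"
    using arr_invertible assms(1) by blast
  have "\<delta> = \<alpha>' \<cdot> \<alpha> \<cdot> \<delta>" if "\<delta> \<in> Hom C r s" for \<delta>
    using comp_assoc[OF \<alpha>'(1) assms(1) that] comp_ident_left[OF that] \<alpha>'(2) by simp
  then show ?thesis
    using assms(2-4) by metis
qed

lemma comp_cancel_right:
  assumes "\<alpha> \<in> Hom C s t" "\<beta> \<in> Hom C t r" "\<gamma> \<in> Hom C t r" "\<beta> \<cdot> \<alpha> = \<gamma> \<cdot> \<alpha>"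
  shows "\<beta> = \<gamma>"
proof -
  obtain \<alpha>' where \<alpha>': "\<alpha>' \<in> Hom C t s" "\<alpha> \<cdot> \<alpha>' = ident C t"
    using arr_invertible assms(1) by blast
  have "\<delta> = (\<delta> \<cdot> \<alpha>) \<cdot> \<alpha>'" if "\<delta> \<in> Hom C t r" for \<delta>
    using comp_assoc[OF that assms(1) \<alpha>'(1)] comp_ident_right[OF that] \<alpha>'(2) by simp
  then show ?thesis
    using assms(2-4) by metis
qed

lemma act_surj:
  assumes "\<alpha> \<in> Hom C s t" "b \<in> carrier (A s)"
  obtains a where "a \<in> carrier (A t)" "act \<alpha> a = b"
proof -
  obtain \<alpha>' where \<alpha>': "\<alpha>' \<in> Hom C t s" "\<alpha>' \<cdot> \<alpha> = ident C s"
    using arr_invertible assms(1) by blast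
  have "act \<alpha> (act \<alpha>' b) = b"
    using act_comp[OF \<alpha>'(1) assms(1,2)] \<alpha>'(2) act_ident Hom_Obj(1)[OF assms(1)] assms(2) by simp
  with that show thesis
    using act_closed[OF \<alpha>'(1) assms(2)] by blast
qed

lemma act_inj:
  assumes "\<alpha> \<in> Hom C s t" "a \<in> carrier (A t)" "b \<in> carrier (A t)" "act \<alpha> a = act \<alpha> b"
  shows "a = b"
proof -
  obtain \<alpha>' where "\<alpha>' \<in> Hom C t s" "\<alpha> \<cdot> \<alpha>' = ident C t"
    using arr_invertible assms(1) by blast
  then show ?thesis
    using assms act_comp act_ident Hom_Obj by metis
qed

text \<open>The right factor \<open>\<beta>\<close> is there because composites are kept associated to the right: in that form
  the equation rewrites the inside of a longer composite.\<close>

lemma move_bd_across: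
  assumes "\<alpha> \<in> Hom C s t" "\<beta> \<in> Hom C r s" "a \<in> carrier (A t)"
  shows "bd t a \<cdot> \<alpha> \<cdot> \<beta> = \<alpha> \<cdot> bd s (act \<alpha> a) \<cdot> \<beta>"
proof -
  have T: "t \<in> Obj C" "s \<in> Obj C" "bd t a \<in> Hom C t t" "bd s (act \<alpha> a) \<in> Hom C s s"
    using assms Hom_Obj bd_closed act_closed by metis+
  have "bd t a \<cdot> \<alpha> \<cdot> \<beta> = (bd t a \<cdot> \<alpha>) \<cdot> \<beta>" using T assms comp_assoc by metis
  also have "\<dots> = (\<alpha> \<cdot> bd s (act \<alpha> a)) \<cdot> \<beta>" using assms bd_act by simp
  also have "\<dots> = \<alpha> \<cdot> bd s (act \<alpha> a) \<cdot> \<beta>" using T assms comp_assoc by metis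
  finally show ?thesis .
qed

text \<open>By the Peiffer identity, the action of \<open>\<partial>(a)\<close> is conjugation by \<open>a\<close>.  Hence the action is functorial
  along a triangle \<open>\<alpha> \<partial>(a) \<beta>\<close> only up to conjugation by its 2-cell.\<close>

lemma act_along_composite:
  assumes "\<alpha> \<in> Hom C s t" "\<beta> \<in> Hom C r s" "a \<in> carrier (A s)" "b \<in> carrier (A t)"
  shows "act \<beta> a \<otimes>\<^bsub>A r\<^esub> act (\<alpha> \<cdot> bd s a \<cdot> \<beta>) b = act \<beta> (act \<alpha> b) \<otimes>\<^bsub>A r\<^esub> act \<beta> a"
proof -
  have T: "s \<in> Obj C" "bd s a \<in> Hom C s s" "bd s a \<cdot> \<beta> \<in> Hom C r s" "act \<alpha> b \<in> carrier (A s)"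
    "act (bd s a) (act \<alpha> b) \<in> carrier (A s)"
    using assms Hom_Obj bd_closed comp_Hom act_closed by metis+
  have "act (\<alpha> \<cdot> bd s a \<cdot> \<beta>) b = act \<beta> (act (bd s a) (act \<alpha> b))"
    using assms T act_comp by metis
  then have "act \<beta> a \<otimes>\<^bsub>A r\<^esub> act (\<alpha> \<cdot> bd s a \<cdot> \<beta>) b
      = act \<beta> (a \<otimes>\<^bsub>A s\<^esub> act (bd s a) (act \<alpha> b))"
    using assms T act_mult by metis
  also have "\<dots> = act \<beta> (act \<alpha> b \<otimes>\<^bsub>A s\<^esub> a)"
    using T assms peiffer by metis
  also have "\<dots> = act \<beta> (act \<alpha> b) \<otimes>\<^bsub>A r\<^esub> act \<beta> a"
    using T assms act_mult by metis
  finally show ?thesis .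
qed

section \<open>Labelled simplices\<close>

end

text \<open>The data of a simplex are the entries with \<open>i \<le> j \<le> k\<close>.  With weak rather than strict inequalities a
  labelling can be pulled back along every monotone map, and degeneracies are no special case.\<close>

datatype ('o, 'm, 'a) labelling =
  Labelling (vert: "nat \<Rightarrow> 'o") (edge: "nat \<Rightarrow> nat \<Rightarrow> 'm") (tri: "nat \<Rightarrow> nat \<Rightarrow> nat \<Rightarrow> 'a")

definition pull :: "(nat \<Rightarrow> nat) \<Rightarrow> ('o, 'm, 'a) labelling \<Rightarrow> ('o, 'm, 'a) labelling" where
  "pull p F = Labelling (\<lambda>i. vert F (p i)) (\<lambda>i j. edge F (p i) (p j))
     (\<lambda>i j k. tri F (p i) (p j) (p k))"

lemma pull_simps [simp]:
  "vert (pull p F) i = vert F (p i)"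
  "edge (pull p F) i j = edge F (p i) (p j)"
  "tri (pull p F) i j k = tri F (p i) (p j) (p k)"
  by (simp_all add: pull_def)

context crossed_module
begin

text \<open>The simplices of the geometric nerve.  The last clause is the commuting tetrahedron: both sides, put between
  \<open>f\<^sub>i\<^sub>j f\<^sub>j\<^sub>k\<close> and \<open>f\<^sub>k\<^sub>l\<close>, are 2-cells to \<open>f\<^sub>i\<^sub>l\<close>, pasted through the
  edge \<open>f\<^sub>j\<^sub>l\<close> and through the edge \<open>f\<^sub>i\<^sub>k\<close>.\<close>

definition cocycle where
  "cocycle n F \<longleftrightarrow>
     (\<forall>i\<le>n. vert F i \<in> Obj C) \<and>
     (\<forall>i j. i \<le> j \<and> j \<le> n \<longrightarrow> edge F i j \<in> Hom C (vert F j) (vert F i)) \<and>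
     (\<forall>i j k. i \<le> j \<and> j \<le> k \<and> k \<le> n \<longrightarrow> tri F i j k \<in> carrier (A (vert F j))) \<and>
     (\<forall>i\<le>n. edge F i i = ident C (vert F i)) \<and>
     (\<forall>i j. i \<le> j \<and> j \<le> n \<longrightarrow> tri F i i j = \<one>\<^bsub>A (vert F i)\<^esub> \<and> tri F i j j = \<one>\<^bsub>A (vert F j)\<^esub>) \<and>
     (\<forall>i j k. i \<le> j \<and> j \<le> k \<and> k \<le> n \<longrightarrow>
        edge F i k = edge F i j \<cdot> bd (vert F j) (tri F i j k) \<cdot> edge F j k) \<and>
     (\<forall>i j k l. i \<le> j \<and> j \<le> k \<and> k \<le> l \<and> l \<le> n \<longrightarrow>
        act (edge F j k) (tri F i j l) \<otimes>\<^bsub>A (vert F k)\<^esub> tri F j k l =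
        act (edge F j k) (tri F i j k) \<otimes>\<^bsub>A (vert F k)\<^esub> tri F i k l)"

lemma cocycleD:
  assumes "cocycle n F"
  shows "i \<le> n \<Longrightarrow> vert F i \<in> Obj C"
    and "\<lbrakk>i \<le> j; j \<le> n\<rbrakk> \<Longrightarrow> edge F i j \<in> Hom C (vert F j) (vert F i)"
    and "\<lbrakk>i \<le> j; j \<le> k; k \<le> n\<rbrakk> \<Longrightarrow> tri F i j k \<in> carrier (A (vert F j))"
    and "i \<le> n \<Longrightarrow> edge F i i = ident C (vert F i)"
    and "\<lbrakk>i \<le> j; j \<le> n\<rbrakk> \<Longrightarrow> tri F i i j = \<one>\<^bsub>A (vert F i)\<^esub>"
    and "\<lbrakk>i \<le> j; j \<le> n\<rbrakk> \<Longrightarrow> tri F i j j = \<one>\<^bsub>A (vert F j)\<^esub>"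
    and "\<lbrakk>i \<le> j; j \<le> k; k \<le> n\<rbrakk> \<Longrightarrow>
        edge F i k = edge F i j \<cdot> bd (vert F j) (tri F i j k) \<cdot> edge F j k"
    and "\<lbrakk>i \<le> j; j \<le> k; k \<le> l; l \<le> n\<rbrakk> \<Longrightarrow>
        act (edge F j k) (tri F i j l) \<otimes>\<^bsub>A (vert F k)\<^esub> tri F j k l =
        act (edge F j k) (tri F i j k) \<otimes>\<^bsub>A (vert F k)\<^esub> tri F i k l"
proof -
  note c = assms[unfolded cocycle_def]
  note c2 = c[THEN conjunct2] note c3 = c2[THEN conjunct2] note c4 = c3[THEN conjunct2]
  note c5 = c4[THEN conjunct2] note c6 = c5[THEN conjunct2] note c7 = c6[THEN conjunct2]
  show "i \<le> n \<Longrightarrow> vert F i \<in> Obj C"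
    using c[THEN conjunct1] by blast
  show "\<lbrakk>i \<le> j; j \<le> n\<rbrakk> \<Longrightarrow> edge F i j \<in> Hom C (vert F j) (vert F i)"
    using c2[THEN conjunct1] by blast
  show "\<lbrakk>i \<le> j; j \<le> k; k \<le> n\<rbrakk> \<Longrightarrow> tri F i j k \<in> carrier (A (vert F j))"
    using c3[THEN conjunct1] by blast
  show "i \<le> n \<Longrightarrow> edge F i i = ident C (vert F i)"
    using c4[THEN conjunct1] by blast
  show "\<lbrakk>i \<le> j; j \<le> n\<rbrakk> \<Longrightarrow> tri F i i j = \<one>\<^bsub>A (vert F i)\<^esub>"
    "\<lbrakk>i \<le> j; j \<le> n\<rbrakk> \<Longrightarrow> tri F i j j = \<one>\<^bsub>A (vert F j)\<^esub>"
    using c5[THEN conjunct1] by blast+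
  show "\<lbrakk>i \<le> j; j \<le> k; k \<le> n\<rbrakk> \<Longrightarrow>
        edge F i k = edge F i j \<cdot> bd (vert F j) (tri F i j k) \<cdot> edge F j k"
    using c6[THEN conjunct1] by blast
  show "\<lbrakk>i \<le> j; j \<le> k; k \<le> l; l \<le> n\<rbrakk> \<Longrightarrow>
        act (edge F j k) (tri F i j l) \<otimes>\<^bsub>A (vert F k)\<^esub> tri F j k l =
        act (edge F j k) (tri F i j k) \<otimes>\<^bsub>A (vert F k)\<^esub> tri F i k l"
    using c7 by blast
qed

lemma cocycle_pull:
  assumes "cocycle n F" "mono p" "\<And>i. i \<le> m \<Longrightarrow> p i \<le> n"
  shows "cocycle m (pull p F)"
proof -
  have p: "i \<le> j \<Longrightarrow> p i \<le> p j" for i j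
    using assms(2) by (rule monoD)
  have "k \<le> m \<Longrightarrow> p k \<le> n" for k
    by (rule assms(3))
  then show ?thesis
    unfolding cocycle_def pull_simps
    by (intro conjI allI impI; (elim conjE)?; intro cocycleD[OF assms(1)]; simp add: p)
qed

end

text \<open>\<open>skip j\<close> and \<open>merge j\<close> are the monotone maps that induce \<open>d\<^sub>j\<close> and \<open>s\<^sub>j\<close>.\<close>

definition skip :: "nat \<Rightarrow> nat \<Rightarrow> nat" where
  "skip j i = (if i < j then i else Suc i)"

definition merge :: "nat \<Rightarrow> nat \<Rightarrow> nat" where
  "merge j i = (if i \<le> j then i else i - 1)"

definition agree :: "nat \<Rightarrow> ('o, 'm, 'a) labelling \<Rightarrow> ('o, 'm, 'a) labelling \<Rightarrow> bool" where
  "agree n F G \<longleftrightarrow>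
     (\<forall>i\<le>n. vert F i = vert G i) \<and>
     (\<forall>i j. i \<le> j \<and> j \<le> n \<longrightarrow> edge F i j = edge G i j) \<and>
     (\<forall>i j k. i \<le> j \<and> j \<le> k \<and> k \<le> n \<longrightarrow> tri F i j k = tri G i j k)"

lemma agreeD:
  assumes "agree n F G"
  shows "i \<le> n \<Longrightarrow> vert F i = vert G i"
    and "\<lbrakk>i \<le> j; j \<le> n\<rbrakk> \<Longrightarrow> edge F i j = edge G i j"
    and "\<lbrakk>i \<le> j; j \<le> k; k \<le> n\<rbrakk> \<Longrightarrow> tri F i j k = tri G i j k"
  using assms unfolding agree_def by blast+

context crossed_module
begin

text \<open>The quotients are chosen so that \<open>m\<^sub>i\<^sub>,\<^sub>i\<^sub>+\<^sub>1 \<cdots> m\<^sub>i\<^sub>k = a\<^sub>i\<^sub>-\<^sub>1\<^sub>,\<^sub>i\<^sub>,\<^sub>k\<close>; the column index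
  \<open>k - 1\<close> starts at \<open>i\<close>, where \<open>a\<^sub>i\<^sub>-\<^sub>1\<^sub>,\<^sub>i\<^sub>,\<^sub>i\<close> is the unit.\<close>

definition matrix_of where
  "matrix_of n F =
     (if n = 0 then Vertex (vert F 0)
      else mk_matrix n (\<lambda>i. edge F (i - 1) i)
        (\<lambda>i k. inv\<^bsub>A (vert F i)\<^esub> tri F (i - 1) i (k - 1) \<otimes>\<^bsub>A (vert F i)\<^esub> tri F (i - 1) i k))"

end

lemma mk_matrix_eq_iff:
  "mk_matrix n d u = mk_matrix n d' u' \<longleftrightarrow>
     (\<forall>i. 1 \<le> i \<and> i \<le> n \<longrightarrow> d i = d' i) \<and> (\<forall>i k. 1 \<le> i \<and> i < k \<and> k \<le> n \<longrightarrow> u i k = u' i k)"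
proof
  assume eq: "mk_matrix n d u = mk_matrix n d' u'"
  have "d i = d' i" if "1 \<le> i" "i \<le> n" for i
    using eq that unfolding mk_matrix_def nerve_simplex.inject
    by (metis atLeastAtMost_iff restrict_apply')
  moreover have "u i k = u' i k" if "1 \<le> i" "i < k" "k \<le> n" for i k
  proof -
    have "(i, k) \<in> above_diag n" using that by (simp add: above_diag_def)
    then show ?thesis
      using eq unfolding mk_matrix_def nerve_simplex.inject by (metis case_prod_conv restrict_apply')
  qed
  ultimately show "(\<forall>i. 1 \<le> i \<and> i \<le> n \<longrightarrow> d i = d' i) \<and>
      (\<forall>i k. 1 \<le> i \<and> i < k \<and> k \<le> n \<longrightarrow> u i k = u' i k)"
    by blast
next
  assume "(\<forall>i. 1 \<le> i \<and> i \<le> n \<longrightarrow> d i = d' i) \<and>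
      (\<forall>i k. 1 \<le> i \<and> i < k \<and> k \<le> n \<longrightarrow> u i k = u' i k)"
  then show "mk_matrix n d u = mk_matrix n d' u'"
    unfolding mk_matrix_def nerve_simplex.inject
    by (intro conjI restrict_ext) (auto simp: above_diag_def)
qed

section \<open>Faces and degeneracies as reindexing\<close>

lemma mk_matrix_eqI:
  assumes "\<And>i. \<lbrakk>1 \<le> i; i \<le> n\<rbrakk> \<Longrightarrow> d i = d' i"
    and "\<And>i k. \<lbrakk>1 \<le> i; i < k; k \<le> n\<rbrakk> \<Longrightarrow> u i k = u' i k"
  shows "mk_matrix n d u = mk_matrix n d' u'"
  using assms by (simp add: mk_matrix_eq_iff)

lemma (in group) cancel_inv_left [simp]:
  "\<lbrakk>x \<in> carrier G; y \<in> carrier G\<rbrakk> \<Longrightarrow> inv x \<otimes> (x \<otimes> y) = y"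
  "\<lbrakk>x \<in> carrier G; y \<in> carrier G\<rbrakk> \<Longrightarrow> x \<otimes> (inv x \<otimes> y) = y"
  by (simp_all add: m_assoc[symmetric])

lemma (in group) foldr_telescope:
  assumes "i \<le> k" "\<And>l. i \<le> l \<Longrightarrow> l \<le> k \<Longrightarrow> T l \<in> carrier G"
    and "\<And>l. i < l \<Longrightarrow> l \<le> k \<Longrightarrow> v l = inv T (l - 1) \<otimes> T l"
  shows "foldr (\<lambda>l p. v l \<otimes> p) [i + 1..<k + 1] \<one> = inv T i \<otimes> T k"
  using assms
proof (induction i rule: inc_induct)
  case base
  then show ?case by simp
next
  case (step i)
  have "foldr (\<lambda>l p. v l \<otimes> p) [i + 1..<k + 1] \<one>
      = v (i + 1) \<otimes> foldr (\<lambda>l p. v l \<otimes> p) [Suc i + 1..<k + 1] \<one>"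
    using step.hyps by (subst upt_conv_Cons) simp_all
  also have "\<dots> = (inv T i \<otimes> T (Suc i)) \<otimes> (inv T (Suc i) \<otimes> T k)"
    using step by simp
  finally show ?case
    using step.hyps step.prems(1) by (simp add: m_assoc)
qed

text \<open>The group-theoretic core of the face formula in the row of the merged vertex.  The equations for \<open>R\<close> and \<open>S\<close>
  will be tetrahedra with a common left factor \<open>c\<close>, which drops out of the quotient, and
  the one for \<open>e\<close> is a Peiffer identity.\<close>

lemma (in group) quotient_entry:
  assumes [simp]: "b \<in> carrier G" "b' \<in> carrier G" "c \<in> carrier G" "p \<in> carrier G" "q \<in> carrier G"
    "R \<in> carrier G" "S \<in> carrier G" "e \<in> carrier G"
    and R: "p \<otimes> b = c \<otimes> R" and S: "q \<otimes> b' = c \<otimes> S" and e: "inv p \<otimes> q \<otimes> b = b \<otimes> e"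
  shows "e \<otimes> (inv b \<otimes> b') = inv R \<otimes> S"
proof -
  have "R = inv c \<otimes> (p \<otimes> b)" "S = inv c \<otimes> (q \<otimes> b')" "e = inv b \<otimes> (inv p \<otimes> q \<otimes> b)"
    by (simp_all add: R S e)
  then show ?thesis
    by (simp add: inv_mult_group m_assoc)
qed

context crossed_module
begin

text \<open>Only the \<open>j\<close>-th row of an inner face is not a mere telescoping.  There the labels wanted are the quotients
  of \<open>a\<^sub>j\<^sub>-\<^sub>1\<^sub>,\<^sub>j\<^sub>+\<^sub>1\<^sub>,\<^sub>k\<close>, and the tetrahedra on \<open>j - 1, j, j + 1\<close> and one more vertex express them
  by the rows \<open>j\<close> and \<open>j + 1\<close> of the matrix.\<close>

lemma nerve_face_matrix_of:
  assumes F: "cocycle (Suc n) F" and j: "j \<le> Suc n"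
  shows "nerve_face C A act bd (Suc n) j (matrix_of (Suc n) F) = matrix_of n (pull (skip j) F)"
proof -
  note F = cocycleD[OF F]
  define D where "D = restrict (\<lambda>i. edge F (i - 1) i) {1..Suc n}"
  define U where "U = restrict (\<lambda>(i, k). inv\<^bsub>A (vert F i)\<^esub> tri F (i - 1) i (k - 1)
    \<otimes>\<^bsub>A (vert F i)\<^esub> tri F (i - 1) i k) (above_diag (Suc n))"
  have M: "matrix_of (Suc n) F = Matrix D U"
    by (simp add: matrix_of_def mk_matrix_def D_def U_def)
  have D: "D i = edge F (i - 1) i" if "1 \<le> i" "i \<le> Suc n" for i
    using that by (simp add: D_def)
  have U: "U (i, k) = inv\<^bsub>A (vert F i)\<^esub> tri F (i - 1) i (k - 1) \<otimes>\<^bsub>A (vert F i)\<^esub> tri F (i - 1) i k"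
    if "1 \<le> i" "i < k" "k \<le> Suc n" for i k
    using that by (simp add: U_def above_diag_def)
  have grp: "group (A (vert F i))" if "i \<le> Suc n" for i
    using that F(1) group_A by blast
  have V: "vtx C D i = vert F i" if "i \<le> Suc n" for i
    using that D[of i] D[of 1] Hom_src_tgt F(2)[of "i - 1" i] F(2)[of 0 1] by (auto simp: vtx_def)
  show ?thesis
  proof (cases "n = 0")
    case True
    have "src C (D 1) = vert F 1" "tgt C (D 1) = vert F 0"
      using D[of 1] F(2)[of 0 1] Hom_src_tgt True by auto
    then show ?thesis
      unfolding M using j True by (auto simp: matrix_of_def skip_def)
  next
    case False
    consider "j = 0" | "j = Suc n" | "0 < j" "j < Suc n" using j by linarith
    then show ?thesis
    proof cases
      case 1
      then show ?thesis
        unfolding M using False by (simp add: matrix_of_def mk_matrix_eq_iff D U skip_def)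
    next
      case 2
      then show ?thesis
        unfolding M using False by (auto simp: matrix_of_def mk_matrix_eq_iff D U skip_def)
    next
      case 3
      have diag: "D j \<cdot> bd (vtx C D j) (U (j, j + 1)) \<cdot> D (j + 1) = edge F (j - 1) (j + 1)"
      proof -
        interpret group "A (vert F j)" using 3 grp by simp
        have "U (j, j + 1) = tri F (j - 1) j (j + 1)"
          using 3 F(3)[of "j - 1" j "j + 1"] F(6)[of "j - 1" j] by (simp add: U)
        then show ?thesis
          using 3 F(7)[of "j - 1" j "j + 1"] by (simp add: V D)
      qed
      have merged: "U (i, j) \<otimes>\<^bsub>A (vtx C D i)\<^esub> U (i, j + 1)
          = inv\<^bsub>A (vert F i)\<^esub> tri F (i - 1) i (j - 1) \<otimes>\<^bsub>A (vert F i)\<^esub> tri F (i - 1) i (j + 1)"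
        if "1 \<le> i" "i < j" for i
      proof -
        interpret group "A (vert F i)" using 3 that grp by simp
        have "tri F (i - 1) i l \<in> carrier (A (vert F i))" if "l \<in> {j - 1, j, j + 1}" for l
          using 3 \<open>1 \<le> i\<close> \<open>i < j\<close> that by (intro F(3)) auto
        then show ?thesis
          using 3 that by (simp add: V U m_assoc)
      qed
      have row: "act (nerve_eta C A bd D U j k) (U (j, k + 1)) \<otimes>\<^bsub>A (vtx C D (j + 1))\<^esub> U (j + 1, k + 1)
          = inv\<^bsub>A (vert F (j + 1))\<^esub> tri F (j - 1) (j + 1) k \<otimes>\<^bsub>A (vert F (j + 1))\<^esub> tri F (j - 1) (j + 1) (k + 1)"
        if k: "j < k" "k \<le> n" for k
      proof -
        let ?G = "A (vert F (j + 1))"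
        have G: "group ?G" using 3 grp by simp
        interpret group "A (vert F j)" using 3 grp by simp
        define f where "f = edge F j (j + 1)"
        define b where "b = tri F j (j + 1) k"
        have f: "f \<in> Hom C (vert F (j + 1)) (vert F j)"
          unfolding f_def using 3 by (intro F(2)) auto
        have b: "b \<in> carrier (A (vert F (j + 1)))"
          unfolding b_def using k by (intro F(3)) auto
        have T: "tri F (j - 1) j l \<in> carrier (A (vert F j))" if "l \<in> {j + 1, k, k + 1}" for l
          using that k by (intro F(3)) auto
        have obj: "vert F (j + 1) \<in> Obj C" using 3 by (intro F(1)) simp
        have Vj: "vtx C D (j + 1) = vert F (j + 1)" using V 3 by simp
        have "row_prod C A D U (j + 1) k = inv\<^bsub>?G\<^esub> tri F j (j + 1) (j + 1) \<otimes>\<^bsub>?G\<^esub> tri F j (j + 1) k"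
          unfolding row_prod_def Vj
          using k F(3) U[of "j + 1"] 
          by (intro group.foldr_telescope[OF G]) auto
        then have rp: "row_prod C A D U (j + 1) k = b"
          using b k F(6)[of j "j + 1"] group.is_monoid[OF G] by (simp add: b_def monoid.inv_one monoid.l_one)
        have eta: "nerve_eta C A bd D U j k = f \<cdot> bd (vert F (j + 1)) b"
          unfolding nerve_eta_def rp using 3 by (simp add: V D f_def)
        define y where "y = inv\<^bsub>A (vert F j)\<^esub> tri F (j - 1) j k \<otimes>\<^bsub>A (vert F j)\<^esub> tri F (j - 1) j (k + 1)"
        have y: "y \<in> carrier (A (vert F j))" unfolding y_def using T by simp
        have Uy: "U (j, k + 1) = y" unfolding y_def using U[of j "k + 1"] 3 k by simp
        define e where "e = act (bd (vert F (j + 1)) b) (act f y)"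
        have fy: "act f y \<in> carrier (A (vert F (j + 1)))" using f y act_closed by blast
        have e: "e \<in> carrier (A (vert F (j + 1)))"
          unfolding e_def using fy b obj bd_closed act_closed by blast
        have ea: "act (nerve_eta C A bd D U j k) (U (j, k + 1)) = e"
          unfolding eta Uy e_def using act_comp[OF f bd_closed[OF obj b] y] .
        have "e \<otimes>\<^bsub>?G\<^esub> (inv\<^bsub>?G\<^esub> b \<otimes>\<^bsub>?G\<^esub> tri F j (j + 1) (k + 1))
            = inv\<^bsub>?G\<^esub> tri F (j - 1) (j + 1) k \<otimes>\<^bsub>?G\<^esub> tri F (j - 1) (j + 1) (k + 1)"
        proof (rule group.quotient_entry[OF G])
          show "act f (tri F (j - 1) j k) \<otimes>\<^bsub>?G\<^esub> b = act f (tri F (j - 1) j (j + 1)) \<otimes>\<^bsub>?G\<^esub> tri F (j - 1) (j + 1) k"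
            unfolding f_def b_def using k by (intro F(8)) auto
          show "act f (tri F (j - 1) j (k + 1)) \<otimes>\<^bsub>?G\<^esub> tri F j (j + 1) (k + 1)
              = act f (tri F (j - 1) j (j + 1)) \<otimes>\<^bsub>?G\<^esub> tri F (j - 1) (j + 1) (k + 1)"
            unfolding f_def using k by (intro F(8)) auto
          have "inv\<^bsub>?G\<^esub> act f (tri F (j - 1) j k) \<otimes>\<^bsub>?G\<^esub> act f (tri F (j - 1) j (k + 1)) = act f y"
            unfolding y_def using T f by (simp add: act_mult act_inv)
          then show "inv\<^bsub>?G\<^esub> act f (tri F (j - 1) j k) \<otimes>\<^bsub>?G\<^esub> act f (tri F (j - 1) j (k + 1)) \<otimes>\<^bsub>?G\<^esub> b = b \<otimes>\<^bsub>?G\<^esub> e"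
            unfolding e_def using peiffer[OF obj fy b] by simp
          show "tri F j (j + 1) (k + 1) \<in> carrier (A (vert F (j + 1)))"
            "tri F (j - 1) (j + 1) k \<in> carrier (A (vert F (j + 1)))"
            "tri F (j - 1) (j + 1) (k + 1) \<in> carrier (A (vert F (j + 1)))"
            using k by (auto intro!: F(3))
        qed (use b e act_closed[OF f T] in auto)
        moreover have "U (j + 1, k + 1) = inv\<^bsub>?G\<^esub> b \<otimes>\<^bsub>?G\<^esub> tri F j (j + 1) (k + 1)"
          using U[of "j + 1" "k + 1"] k by (simp add: b_def)
        ultimately show ?thesis
          using V[of "j + 1"] 3 by (simp add: ea[simplified])
      qed
      have ne: "(n = 0) = False" "(Suc n = 1) = False" "(j = 0) = False" "(j = Suc n) = False"
        using 3 False by simp_all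
      show ?thesis
        unfolding M unfolding nerve_face.simps matrix_of_def
      proof (simp only: ne if_False diff_Suc_1, rule mk_matrix_eqI, goal_cases)
        case (1 i)
        obtain i' j' where [simp]: "i = Suc i'" "j = Suc j'"
          using 1 3 by (cases i; cases j) auto
        consider "i < j" | "i = j" | "j < i" by linarith
        then show ?case
        proof cases
          case 2
          then show ?thesis using diag by (simp add: skip_def)
        qed (use 1 in \<open>simp_all add: D skip_def\<close>)
      next
        case (2 i k)
        obtain i' j' k' where [simp]: "i = Suc i'" "j = Suc j'" "k = Suc k'"
          using 2 3 by (cases i; cases j; cases k) auto
        consider "i < j" "k < j" | "i < j" "k = j" | "i < j" "j < k" | "i = j" | "j < i" by linarith
        then show ?case
        proof cases
          case a: 2
          then show ?thesis using merged[of i] 2 by (simp add: skip_def)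
        next
          case a: 4
          then show ?thesis using row[of k] 2 by (simp add: skip_def)
        qed (use 2 in \<open>simp_all add: U skip_def\<close>)
      qed
    qed
  qed
qed

lemma nerve_degen_matrix_of:
  assumes F: "cocycle n F" and j: "j \<le> n"
  shows "nerve_degen C A n j (matrix_of n F) = matrix_of (Suc n) (pull (merge j) F)"
proof (cases "n = 0")
  case True
  then show ?thesis
    using cocycleD(4)[OF F, of 0] j by (auto simp: matrix_of_def mk_matrix_eq_iff merge_def)
next
  case False
  note F = cocycleD[OF F]
  define D where "D = restrict (\<lambda>i. edge F (i - 1) i) {1..n}"
  define U where "U = restrict (\<lambda>(i, k). inv\<^bsub>A (vert F i)\<^esub> tri F (i - 1) i (k - 1)
    \<otimes>\<^bsub>A (vert F i)\<^esub> tri F (i - 1) i k) (above_diag n)"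
  have M: "matrix_of n F = Matrix D U"
    using False by (simp add: matrix_of_def mk_matrix_def D_def U_def)
  have D: "D i = edge F (i - 1) i" if "1 \<le> i" "i \<le> n" for i
    using that by (simp add: D_def)
  have U: "U (i, k) = inv\<^bsub>A (vert F i)\<^esub> tri F (i - 1) i (k - 1) \<otimes>\<^bsub>A (vert F i)\<^esub> tri F (i - 1) i k"
    if "1 \<le> i" "i < k" "k \<le> n" for i k
    using that by (simp add: U_def above_diag_def)
  have V: "vtx C D i = vert F i" if "i \<le> n" for i
    using that D[of i] D[of 1] Hom_src_tgt F(2)[of "i - 1" i] F(2)[of 0 1] False by (auto simp: vtx_def)
  have grp: "group (A (vert F i))" if "i \<le> n" for i
    using that F(1) group_A by blast
  have ll: "inv\<^bsub>A (vert F i)\<^esub> a \<otimes>\<^bsub>A (vert F i)\<^esub> a = \<one>\<^bsub>A (vert F i)\<^esub>"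
    if "i \<le> n" "a \<in> carrier (A (vert F i))" for i a
    using grp that by (simp add: group.l_inv)
  have l1: "inv\<^bsub>A (vert F i)\<^esub> \<one>\<^bsub>A (vert F i)\<^esub> \<otimes>\<^bsub>A (vert F i)\<^esub> \<one>\<^bsub>A (vert F i)\<^esub> = \<one>\<^bsub>A (vert F i)\<^esub>"
    if "i \<le> n" for i
    using ll[OF that] grp[OF that] group.is_monoid monoid.one_closed by blast
  show ?thesis
    unfolding M unfolding nerve_degen.simps matrix_of_def
    using j False F(3)
    by (auto simp: mk_matrix_eq_iff D U V F(4) F(5) merge_def l1 ll le_less_Suc_eq)
qed

section \<open>The spine determines a labelled simplex\<close>

lemma matrix_of_closed:
  assumes "cocycle n F"
  shows "matrix_of n F \<in> nerve_simplices C A n"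
proof (cases "n = 0")
  case True
  then show ?thesis
    using cocycleD(1)[OF assms, of 0] by (simp add: matrix_of_def nerve_simplices_def)
next
  case False
  note F = cocycleD[OF assms]
  have "inv\<^bsub>A (vert F i)\<^esub> tri F (i - 1) i (k - 1) \<otimes>\<^bsub>A (vert F i)\<^esub> tri F (i - 1) i k \<in> carrier (A (vert F i))"
    if "1 \<le> i" "i < k" "k \<le> n" for i k
  proof -
    interpret group "A (vert F i)" using F(1)[of i] that group_A by simp
    show ?thesis
      using F(3)[of "i - 1" i k] F(3)[of "i - 1" i "k - 1"] that by simp
  qed
  moreover have "edge F (i - 1) i \<in> Hom C (vert F i) (vert F (i - 1))" if "1 \<le> i" "i \<le> n" for i
    using F(2)[of "i - 1" i] that by simp
  ultimately show ?thesis
    using False F(1) unfolding matrix_of_def mk_matrix_def nerve_simplices_def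
    by (auto simp: above_diag_def intro!: exI[of _ "vert F"])
qed

lemma matrix_of_agree:
  assumes "agree n F G"
  shows "matrix_of n F = matrix_of n G"
  using agreeD[OF assms] unfolding matrix_of_def by (auto intro!: mk_matrix_eqI)

text \<open>Downward induction on the first vertex: \<open>f\<^sub>i\<^sub>j\<close> is a composite through \<open>i + 1\<close>, and the tetrahedron
  \<open>i, i + 1, j, k\<close> can be solved for \<open>a\<^sub>i\<^sub>j\<^sub>k\<close>.\<close>

lemma agree_if_spine:
  assumes F: "cocycle n F" and G: "cocycle n G"
    and v: "\<And>i. i \<le> n \<Longrightarrow> vert F i = vert G i"
    and e: "\<And>i. i < n \<Longrightarrow> edge F i (Suc i) = edge G i (Suc i)"
    and t: "\<And>i k. \<lbrakk>i < k; k \<le> n\<rbrakk> \<Longrightarrow> tri F i (Suc i) k = tri G i (Suc i) k"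
  shows "agree n F G"
proof -
  have edges: "edge F i j = edge G i j" if "i \<le> j" "j \<le> n" for i j
    using that
  proof (induction i rule: inc_induct)
    case base
    then show ?case using cocycleD(4)[OF F] cocycleD(4)[OF G] v by simp
  next
    case (step i)
    then show ?case
      using cocycleD(7)[OF F, of i "Suc i" j] cocycleD(7)[OF G, of i "Suc i" j]
        v[of "Suc i"] e[of i] t[of i j] by simp
  qed
  have "tri F i j k = tri G i j k" if "i \<le> j" "j \<le> k" "k \<le> n" for i j k
    using that(1)
  proof (induction i rule: inc_induct)
    case base
    then show ?case using cocycleD(5)[OF F, of j k] cocycleD(5)[OF G, of j k] v that by simp
  next
    case (step i)
    interpret group "A (vert F j)" using cocycleD(1)[OF F] that group_A by simp
    let ?a = "act (edge F (Suc i) j) (tri F i (Suc i) j)"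
    have "?a \<otimes>\<^bsub>A (vert F j)\<^esub> tri F i j k = ?a \<otimes>\<^bsub>A (vert F j)\<^esub> tri G i j k"
      using cocycleD(8)[OF F, of i "Suc i" j k] cocycleD(8)[OF G, of i "Suc i" j k]
        edges[of "Suc i" j] t[of i k] t[of i j] v[of j] step that by simp
    moreover have "?a \<in> carrier (A (vert F j))"
      using step.hyps that
      by (intro act_closed[OF cocycleD(2)[OF F]] cocycleD(3)[OF F]) auto
    moreover have "tri F i j k \<in> carrier (A (vert F j))" "tri G i j k \<in> carrier (A (vert F j))"
      using step.hyps that v[of j] cocycleD(3)[OF F, of i j k] cocycleD(3)[OF G, of i j k] by auto
    ultimately show ?case by simp
  qed
  with edges v show ?thesis unfolding agree_def by blast
qed

lemma matrix_of_eq_imp_agree: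
  assumes F: "cocycle n F" and G: "cocycle n G" and eq: "matrix_of n F = matrix_of n G"
  shows "agree n F G"
proof (cases "n = 0")
  case True
  then show ?thesis
    using eq by (intro agree_if_spine[OF F G]) (simp_all add: matrix_of_def)
next
  case False
  have e: "edge F i (Suc i) = edge G i (Suc i)" if "i < n" for i
    using eq that False by (auto simp: matrix_of_def mk_matrix_eq_iff dest: spec[of _ "Suc i"])
  have v: "vert F i = vert G i" if "i \<le> n" for i
  proof (cases i)
    case 0
    then show ?thesis
      using e[of 0] cocycleD(2)[OF F, of 0 1] cocycleD(2)[OF G, of 0 1] False by (auto simp: Hom_def)
  next
    case (Suc i')
    then show ?thesis
      using e[of i'] cocycleD(2)[OF F, of i' i] cocycleD(2)[OF G, of i' i] that by (auto simp: Hom_def)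
  qed
  have "tri F i (Suc i) k = tri G i (Suc i) k" if "i < k" "k \<le> n" for i k
    using Suc_leI[OF that(1)] that(2)
  proof (induction k rule: dec_induct)
    case base
    then show ?case
      using cocycleD(6)[OF F, of i "Suc i"] cocycleD(6)[OF G, of i "Suc i"] v by simp
  next
    case (step k)
    interpret group "A (vert F (Suc i))" using cocycleD(1)[OF F] step group_A by simp
    have T: "tri F i (Suc i) k \<in> carrier (A (vert F (Suc i)))"
      "tri F i (Suc i) (Suc k) \<in> carrier (A (vert F (Suc i)))"
      "tri G i (Suc i) (Suc k) \<in> carrier (A (vert F (Suc i)))"
      using step v[of "Suc i"] cocycleD(3)[OF F, of i "Suc i"] cocycleD(3)[OF G, of i "Suc i"] by auto
    have "inv\<^bsub>A (vert F (Suc i))\<^esub> tri F i (Suc i) k \<otimes>\<^bsub>A (vert F (Suc i))\<^esub> tri F i (Suc i) (Suc k) = inv\<^bsub>A (vert F (Suc i))\<^esub> tri G i (Suc i) k \<otimes>\<^bsub>A (vert F (Suc i))\<^esub> tri G i (Suc i) (Suc k)"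
      using eq step False v[of "Suc i"]
      by (auto simp: matrix_of_def mk_matrix_eq_iff dest!: spec2[of _ "Suc i" "Suc k"])
    then show ?case
      using step T by simp
  qed
  with e v show ?thesis by (intro agree_if_spine[OF F G])
qed

definition const_labelling where
  "const_labelling t = Labelling (\<lambda>_. t) (\<lambda>_ _. ident C t) (\<lambda>_ _ _. \<one>\<^bsub>A t\<^esub>)"

lemma const_labelling_simps [simp]:
  "vert (const_labelling t) i = t"
  "edge (const_labelling t) i j = ident C t"
  "tri (const_labelling t) i j k = \<one>\<^bsub>A t\<^esub>"
  "pull p (const_labelling t) = const_labelling t"
  by (simp_all add: const_labelling_def pull_def)

lemma cocycle_const:
  assumes "t \<in> Obj C"
  shows "cocycle n (const_labelling t)"
proof -
  interpret group "A t" using assms group_A by blast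
  have "ident C t \<cdot> ident C t = ident C t"
    using assms ident_Hom comp_ident_left by blast
  then show ?thesis
    using assms ident_Hom act_ident bd_one by (simp add: cocycle_def)
qed

text \<open>A new first vertex \<open>y\<close> is joined to a labelled simplex.  The new edge \<open>h\<close> to the old vertex \<open>0\<close> and the
  triangles \<open>b k\<close> on it are prescribed; the other new entries are what the triangles and tetrahedra
  that contain the edge \<open>h\<close> prescribe.\<close>

definition cone where
  "cone y h b G = Labelling
     (case_nat y (vert G))
     (\<lambda>i j. case i of
        0 \<Rightarrow> (case j of 0 \<Rightarrow> ident C y | Suc j' \<Rightarrow> h \<cdot> bd (vert G 0) (b j') \<cdot> edge G 0 j')
      | Suc i' \<Rightarrow> edge G i' (j - 1))
     (\<lambda>i j k. case i of
        0 \<Rightarrow> (case j of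
            0 \<Rightarrow> \<one>\<^bsub>A y\<^esub>
          | Suc j' \<Rightarrow> act (edge G 0 j') (inv\<^bsub>A (vert G 0)\<^esub> b j' \<otimes>\<^bsub>A (vert G 0)\<^esub> b (k - 1))
              \<otimes>\<^bsub>A (vert G j')\<^esub> tri G 0 j' (k - 1))
      | Suc i' \<Rightarrow> tri G i' (j - 1) (k - 1))"

lemma cone_simps [simp]:
  "vert (cone y h b G) 0 = y"
  "vert (cone y h b G) (Suc i) = vert G i"
  "edge (cone y h b G) 0 0 = ident C y"
  "edge (cone y h b G) 0 (Suc j) = h \<cdot> bd (vert G 0) (b j) \<cdot> edge G 0 j"
  "edge (cone y h b G) (Suc i) (Suc j) = edge G i j"
  "tri (cone y h b G) 0 0 k = \<one>\<^bsub>A y\<^esub>"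
  "tri (cone y h b G) 0 (Suc j) (Suc k) =
     act (edge G 0 j) (inv\<^bsub>A (vert G 0)\<^esub> b j \<otimes>\<^bsub>A (vert G 0)\<^esub> b k) \<otimes>\<^bsub>A (vert G j)\<^esub> tri G 0 j k"
  "tri (cone y h b G) (Suc i) (Suc j) (Suc k) = tri G i j k"
  by (simp_all add: cone_def)

text \<open>The tetrahedra at the new vertex commute because the factors \<open>b\<^sub>j\<inverse> b\<^sub>k\<close> telescope, once
  \<open>act_along_composite\<close> has brought them under the same action; what remains is a tetrahedron on the
  old vertices \<open>0, j, k, l\<close>.\<close>

lemma cocycle_cone:
  assumes G: "cocycle n G" and y: "y \<in> Obj C" and h: "h \<in> Hom C (vert G 0) y"
    and b: "\<And>k. k \<le> n \<Longrightarrow> b k \<in> carrier (A (vert G 0))" and b0: "b 0 = \<one>\<^bsub>A (vert G 0)\<^esub>"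
  shows "cocycle (Suc n) (cone y h b G)"
proof -
  note G = cocycleD[OF G]
  let ?F = "cone y h b G"
  let ?A = "\<lambda>i. A (vert G i)"
  let ?q = "\<lambda>j k. inv\<^bsub>?A 0\<^esub> b j \<otimes>\<^bsub>?A 0\<^esub> b k"
  have grp: "group (?A i)" if "i \<le> n" for i
    using that G(1) group_A by blast
  have q: "?q j k \<in> carrier (?A 0)" if "j \<le> n" "k \<le> n" for j k
    using that b grp[of 0] by (simp add: group.inv_closed monoid.m_closed group.is_monoid)
  have gq: "act (edge G 0 j) (?q j k) \<in> carrier (?A j)" if "j \<le> n" "k \<le> n" for j k
    using that q act_closed[OF G(2)[of 0 j]] by simp
  have tri0: "tri ?F 0 (Suc j) (Suc k) \<in> carrier (?A j)" if "j \<le> k" "k \<le> n" for j k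
    using that gq G(3) grp[of j] by (simp add: monoid.m_closed group.is_monoid)
  have edge0: "edge ?F 0 (Suc k) \<in> Hom C (vert G k) y" if "k \<le> n" for k
    using that b G(1,2) h comp_Hom bd_closed by (metis (no_types, lifting) cone_simps(4) le0)
  have comp0: "edge ?F 0 (Suc k)
      = edge ?F 0 (Suc j) \<cdot> bd (vert G j) (tri ?F 0 (Suc j) (Suc k)) \<cdot> edge G j k"
    if jk: "j \<le> k" "k \<le> n" for j k
  proof -
    interpret g0: group "?A 0" using grp by simp
    let ?x0 = "vert G 0" and ?xj = "vert G j"
    let ?g = "edge G 0 j" and ?c = "bd (vert G j) (tri G 0 j k)" and ?g' = "edge G j k"
    have obj: "?x0 \<in> Obj C" "?xj \<in> Obj C" using jk G(1) by auto
    have H: "?g \<in> Hom C ?xj ?x0" "?c \<in> Hom C ?xj ?xj" "?g' \<in> Hom C (vert G k) ?xj"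
      "bd ?x0 (b j) \<in> Hom C ?x0 ?x0" "bd ?x0 (b k) \<in> Hom C ?x0 ?x0" "bd ?x0 (?q j k) \<in> Hom C ?x0 ?x0"
      "bd ?xj (act ?g (?q j k)) \<in> Hom C ?xj ?xj"
      by (intro G(2) bd_closed obj b q gq G(3); use jk in simp)+
    note H' = comp_Hom[OF H(2,3)]
    have gk: "edge G 0 k = ?g \<cdot> ?c \<cdot> ?g'" by (rule G(7)) (use jk in simp_all)
    have b_eq: "bd ?x0 (b k) = bd ?x0 (b j) \<cdot> bd ?x0 (?q j k)"
    proof -
      have "b k = b j \<otimes>\<^bsub>?A 0\<^esub> ?q j k" using b[of j] b[of k] jk by simp
      then have "bd ?x0 (b k) = bd ?x0 (b j \<otimes>\<^bsub>?A 0\<^esub> ?q j k)" by (rule arg_cong)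
      also have "\<dots> = bd ?x0 (b j) \<cdot> bd ?x0 (?q j k)"
        by (rule bd_mult[OF obj(1)]; use b q jk in simp)
      finally show ?thesis .
    qed
    have "edge ?F 0 (Suc k) = h \<cdot> (bd ?x0 (b j) \<cdot> bd ?x0 (?q j k)) \<cdot> ?g \<cdot> ?c \<cdot> ?g'"
      by (simp add: gk b_eq)
    also have "\<dots> = h \<cdot> bd ?x0 (b j) \<cdot> bd ?x0 (?q j k) \<cdot> ?g \<cdot> ?c \<cdot> ?g'"
      using comp_assoc[OF H(4,6) comp_Hom[OF H(1) H']] by simp
    also have "\<dots> = h \<cdot> bd ?x0 (b j) \<cdot> ?g \<cdot> bd ?xj (act ?g (?q j k)) \<cdot> ?c \<cdot> ?g'"
      using move_bd_across[OF H(1) H', of "?q j k"] q jk by simp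
    also have "\<dots> = h \<cdot> bd ?x0 (b j) \<cdot> ?g \<cdot> (bd ?xj (act ?g (?q j k)) \<cdot> ?c) \<cdot> ?g'"
      using comp_assoc[OF H(7,2,3)] by simp
    also have "\<dots> = (h \<cdot> bd ?x0 (b j) \<cdot> ?g) \<cdot> (bd ?xj (act ?g (?q j k)) \<cdot> ?c) \<cdot> ?g'"
      using comp_assoc[OF h comp_Hom[OF H(4,1)] comp_Hom[OF comp_Hom[OF H(7,2)] H(3)]]
        comp_assoc[OF H(4,1) comp_Hom[OF comp_Hom[OF H(7,2)] H(3)]] by simp
    also have "bd ?xj (act ?g (?q j k)) \<cdot> ?c = bd ?xj (tri ?F 0 (Suc j) (Suc k))"
      using bd_mult[OF obj(2) gq G(3)] jk by simp
    finally show ?thesis by simp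
  qed
  have coc0: "act (edge G j k) (tri ?F 0 (Suc j) (Suc l)) \<otimes>\<^bsub>?A k\<^esub> tri G j k l =
      act (edge G j k) (tri ?F 0 (Suc j) (Suc k)) \<otimes>\<^bsub>?A k\<^esub> tri ?F 0 (Suc k) (Suc l)"
    if jkl: "j \<le> k" "k \<le> l" "l \<le> n" for j k l
  proof -
    interpret g0: group "?A 0" using grp by simp
    interpret group "?A k" using grp jkl by simp
    let ?g = "edge G 0 j" and ?g' = "edge G j k"
    have H: "?g \<in> Hom C (vert G j) (vert G 0)" "?g' \<in> Hom C (vert G k) (vert G j)"
      using jkl G(2)[of 0 j] G(2)[of j k] by auto
    \<comment> \<open>The action along the path through \<open>j\<close>; by \<open>flat\<close> it differs from that of \<open>f\<^sub>0\<^sub>k\<close> by conjugation with \<open>s\<close>.\<close>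
    define \<psi> where "\<psi> x = act ?g' (act ?g x)" for x
    define s where "s = act ?g' (tri G 0 j k)"
    have \<psi>: "\<psi> x \<in> carrier (?A k)" if "x \<in> carrier (?A 0)" for x
      unfolding \<psi>_def using that H act_closed by blast
    have s: "s \<in> carrier (?A k)" unfolding s_def using H(2) G(3)[of 0 j k] jkl act_closed by simp
    have t: "tri G j k l \<in> carrier (?A k)" "tri G 0 k l \<in> carrier (?A k)"
      "act ?g' (tri G 0 j l) \<in> carrier (?A k)"
      using jkl G(3)[of j k l] G(3)[of 0 k l] G(3)[of 0 j l] act_closed[OF H(2)] by auto
    have exp: "act ?g' (tri ?F 0 (Suc j) (Suc m)) = \<psi> (?q j m) \<otimes>\<^bsub>?A k\<^esub> act ?g' (tri G 0 j m)"
      if "j \<le> m" "m \<le> n" for m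
      unfolding \<psi>_def using act_mult[OF H(2) gq G(3)] that by simp
    have flat: "s \<otimes>\<^bsub>?A k\<^esub> act (edge G 0 k) x = \<psi> x \<otimes>\<^bsub>?A k\<^esub> s" if "x \<in> carrier (?A 0)" for x
      using act_along_composite[OF H, of "tri G 0 j k" x] G(3)[of 0 j k] G(7)[of 0 j k] that jkl
      by (simp add: \<psi>_def s_def)
    have "\<psi> (?q j k) \<otimes>\<^bsub>?A k\<^esub> \<psi> (?q k l) = \<psi> (?q j k \<otimes>\<^bsub>?A 0\<^esub> ?q k l)"
      unfolding \<psi>_def using q jkl by (simp add: act_mult[OF H(1)] act_mult[OF H(2)] act_closed[OF H(1)])
    then have \<psi>_q: "\<psi> (?q j k) \<otimes>\<^bsub>?A k\<^esub> \<psi> (?q k l) = \<psi> (?q j l)"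
      using b jkl by (simp add: g0.m_assoc)
    have "act ?g' (tri ?F 0 (Suc j) (Suc l)) \<otimes>\<^bsub>?A k\<^esub> tri G j k l
        = \<psi> (?q j l) \<otimes>\<^bsub>?A k\<^esub> (act ?g' (tri G 0 j l) \<otimes>\<^bsub>?A k\<^esub> tri G j k l)"
      using exp[of l] \<psi> q t jkl by (simp add: m_assoc)
    also have "\<dots> = \<psi> (?q j k) \<otimes>\<^bsub>?A k\<^esub> (\<psi> (?q k l) \<otimes>\<^bsub>?A k\<^esub> s) \<otimes>\<^bsub>?A k\<^esub> tri G 0 k l"
      using G(8)[of 0 j k l] \<psi>_q[symmetric] jkl \<psi> q s t by (simp add: m_assoc s_def)
    also have "\<dots> = \<psi> (?q j k) \<otimes>\<^bsub>?A k\<^esub> (s \<otimes>\<^bsub>?A k\<^esub> act (edge G 0 k) (?q k l)) \<otimes>\<^bsub>?A k\<^esub> tri G 0 k l"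
      using flat q jkl by simp
    also have "\<dots> = (\<psi> (?q j k) \<otimes>\<^bsub>?A k\<^esub> s) \<otimes>\<^bsub>?A k\<^esub> (act (edge G 0 k) (?q k l) \<otimes>\<^bsub>?A k\<^esub> tri G 0 k l)"
      using \<psi> q s t gq[of k l] jkl by (simp add: m_assoc)
    finally show ?thesis
      using exp[of k] jkl by (simp add: s_def)
  qed
  show ?thesis
    unfolding cocycle_def
  proof ((intro conjI allI impI; (elim conjE)?), goal_cases)
    case (1 i)
    then show ?case using y G(1) by (cases i) auto
  next
    case (2 i j)
    then show ?case using y edge0 G(2) ident_Hom by (cases i; cases j) (auto simp del: cone_simps(4))
  next
    case (3 i j k)
    then show ?case
      using tri0 G(3) monoid.one_closed[OF monoid_A[OF y]] by (cases i; cases j; cases k) (auto simp del: cone_simps(7))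
  next
    case (4 i)
    then show ?case using G(4) by (cases i) auto
  next
    case (5 i j)
    then show ?case
      using G(5) b0 b by (cases i; cases j) auto
  next
    case (6 i j)
    show ?case
    proof (cases i)
      case 0
      then show ?thesis
      proof (cases j)
        case (Suc j')
        then have j': "j' \<le> n" using 6 by simp
        interpret g0: group "?A 0" using grp by simp
        interpret group "?A j'" using grp j' by simp
        have "?q j' j' = \<one>\<^bsub>?A 0\<^esub>" using b j' by simp
        then show ?thesis
          using 0 Suc j' act_one[OF G(2)[of 0 j']] G(6)[of 0 j'] by simp
      qed (simp add: 0)
    next
      case (Suc i')
      then show ?thesis using 6 G(6) by (cases j) auto
    qed
  next
    case (7 i j k)
    consider "i = 0" "j = 0" | j' k' where "i = 0" "j = Suc j'" "k = Suc k'"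
      | i' j' k' where "i = Suc i'" "j = Suc j'" "k = Suc k'"
      using 7 by (cases i; cases j; cases k) auto
    then show ?case
    proof cases
      case 1
      have "edge ?F 0 k \<in> Hom C (vert ?F k) y"
        using 7 edge0 ident_Hom[OF y] by (cases k) (auto simp del: cone_simps(4))
      then show ?thesis
        using 1 y bd_one comp_ident_left by simp
    next
      case 2
      then show ?thesis using comp0[of j' k'] 7 by (simp del: cone_simps(4,7))
    next
      case 3
      then show ?thesis using G(7)[of i' j' k'] 7 by simp
    qed
  next
    case (8 i j k l)
    consider "i = 0" "j = 0" | j' k' l' where "i = 0" "j = Suc j'" "k = Suc k'" "l = Suc l'"
      | i' j' k' l' where "i = Suc i'" "j = Suc j'" "k = Suc k'" "l = Suc l'"
      using 8 by (cases i; cases j; cases k; cases l) auto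
    then show ?case
    proof cases
      case 2
      then show ?thesis using coc0[of j' k' l'] 8 by (simp del: cone_simps(4,7))
    next
      case 3
      then show ?thesis using G(8)[of i' j' k' l'] 8 by simp
    qed simp
  qed
qed

lemma cocycle_with_spine:
  assumes "\<And>i. i \<le> n \<Longrightarrow> x i \<in> Obj C" "\<And>i. i < n \<Longrightarrow> h i \<in> Hom C (x (Suc i)) (x i)"
    and "\<And>i k. \<lbrakk>i < k; k \<le> n\<rbrakk> \<Longrightarrow> b i k \<in> carrier (A (x (Suc i)))"
    and "\<And>i. i < n \<Longrightarrow> b i (Suc i) = \<one>\<^bsub>A (x (Suc i))\<^esub>"
  obtains F where "cocycle n F" "\<And>i. i \<le> n \<Longrightarrow> vert F i = x i"
    "\<And>i. i < n \<Longrightarrow> edge F i (Suc i) = h i"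
    "\<And>i k. \<lbrakk>i < k; k \<le> n\<rbrakk> \<Longrightarrow> tri F i (Suc i) k = b i k"
  using assms
proof (induction n arbitrary: x h b thesis)
  case 0
  show ?case
    using 0(2)[of 0] by (intro 0(1)[of "const_labelling (x 0)"] cocycle_const) auto
next
  case (Suc n)
  obtain G where G: "cocycle n G" "\<And>i. i \<le> n \<Longrightarrow> vert G i = x (Suc i)"
    "\<And>i. i < n \<Longrightarrow> edge G i (Suc i) = h (Suc i)"
    "\<And>i k. \<lbrakk>i < k; k \<le> n\<rbrakk> \<Longrightarrow> tri G i (Suc i) k = b (Suc i) (Suc k)"
  proof (rule Suc.IH[of "\<lambda>i. x (Suc i)" "\<lambda>i. h (Suc i)" "\<lambda>i k. b (Suc i) (Suc k)"], goal_cases)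
    case (1 F)
    show ?case by (rule 1(1)[OF 1(2-5)])
  qed (simp_all add: Suc.prems)
  let ?F = "cone (x 0) (h 0) (\<lambda>k. b 0 (Suc k)) G"
  have obj: "x 1 \<in> Obj C" and h0: "h 0 \<in> Hom C (x 1) (x 0)"
    using Suc.prems(2)[of 1] Suc.prems(3)[of 0] by auto
  interpret group "A (x (Suc 0))" using obj group_A by simp
  have b: "b 0 (Suc k) \<in> carrier (A (x 1))" if "k \<le> n" for k
    using Suc.prems(4)[of 0 "Suc k"] that by simp
  have b1: "b 0 (Suc 0) = \<one>\<^bsub>A (x 1)\<^esub>" using Suc.prems(5)[of 0] by simp
  show ?case
  proof (rule Suc.prems(1)[of ?F], goal_cases)
    case 1
    show ?case
      by (rule cocycle_cone[OF G(1)]) (use Suc.prems(2)[of 0] h0 b b1 G(2)[of 0] in simp_all)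
  next
    case (2 i)
    then show ?case using G(2) by (cases i) auto
  next
    case (3 i)
    show ?case
    proof (cases i)
      case 0
      then show ?thesis
        using cocycleD(4)[OF G(1), of 0] G(2)[of 0] b1 bd_one[OF obj] ident_Hom[OF obj] h0
          comp_ident_left comp_ident_right by auto
    next
      case (Suc i')
      then show ?thesis using 3 G(3) by simp
    qed
  next
    case (4 i k)
    show ?case
    proof (cases i)
      case 0
      then obtain k' where k': "k = Suc k'" "k' \<le> n" using 4 by (cases k) auto
      show ?thesis
        using 0 k' cocycleD(4)[OF G(1), of 0] cocycleD(5)[OF G(1), of 0 k'] G(2)[of 0]
          act_ident[OF obj] b[of k'] b1 by simp
    next
      case (Suc i')
      then show ?thesis using 4 G(4) by (cases k) auto
    qed
  qed
qed

text \<open>Every matrix arises: the triangles on the spine are the partial products of its rows.\<close>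

lemma nerve_simplex_matrix_of:
  assumes "M \<in> nerve_simplices C A n"
  obtains F where "cocycle n F" "matrix_of n F = M"
proof (cases "n = 0")
  case True
  then obtain t where "t \<in> Obj C" "M = Vertex t" using assms by (auto simp: nerve_simplices_def)
  then show ?thesis
    using True cocycle_const by (intro that[of "const_labelling t"]) (auto simp: matrix_of_def)
next
  case False
  then obtain d u x where M: "M = Matrix d u" and ext: "d \<in> extensional {1..n}" "u \<in> extensional (above_diag n)"
    and x: "\<And>i. i \<le> n \<Longrightarrow> x i \<in> Obj C"
    and d: "\<And>j. \<lbrakk>1 \<le> j; j \<le> n\<rbrakk> \<Longrightarrow> d j \<in> Hom C (x j) (x (j - 1))"
    and u: "\<And>i k. \<lbrakk>1 \<le> i; i < k; k \<le> n\<rbrakk> \<Longrightarrow> u (i, k) \<in> carrier (A (x i))"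
    using assms unfolding nerve_simplices_def by (auto simp del: One_nat_def) blast
  define b where "b i = rec_nat \<one>\<^bsub>A (x (Suc i))\<^esub>
    (\<lambda>k p. if k \<le> i then \<one>\<^bsub>A (x (Suc i))\<^esub> else p \<otimes>\<^bsub>A (x (Suc i))\<^esub> u (Suc i, Suc k))" for i
  have b_Suc: "b i (Suc k) = b i k \<otimes>\<^bsub>A (x (Suc i))\<^esub> u (Suc i, Suc k)" if "Suc i \<le> k" for i k
    using that by (simp add: b_def)
  have b: "b i k \<in> carrier (A (x (Suc i)))" if "i < n" "k \<le> n" for i k
  proof -
    interpret monoid "A (x (Suc i))" using x[of "Suc i"] monoid_A that by simp
    show ?thesis using that(2) by (induction k) (use u[of "Suc i"] in \<open>auto simp: b_def\<close>)
  qed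
  obtain F where F: "cocycle n F" "\<And>i. i \<le> n \<Longrightarrow> vert F i = x i"
    "\<And>i. i < n \<Longrightarrow> edge F i (Suc i) = d (Suc i)"
    "\<And>i k. \<lbrakk>i < k; k \<le> n\<rbrakk> \<Longrightarrow> tri F i (Suc i) k = b i k"
    by (rule cocycle_with_spine[of n x "\<lambda>i. d (Suc i)" b]) (use x d[of "Suc _"] b in \<open>auto simp: b_def\<close>)
  have "matrix_of n F = mk_matrix n d (\<lambda>i k. u (i, k))"
    unfolding matrix_of_def if_not_P[OF False]
  proof (rule mk_matrix_eqI)
    fix i assume i: "1 \<le> i" "i \<le> n"
    then show "edge F (i - 1) i = d i" using F(3)[of "i - 1"] by simp
  next
    fix i k assume ik: "1 \<le> i" "i < k" "k \<le> n"
    then obtain i' k' where [simp]: "i = Suc i'" "k = Suc k'" by (cases i; cases k) auto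
    interpret group "A (x (Suc i'))" using x group_A ik by simp
    show "inv\<^bsub>A (vert F i)\<^esub> tri F (i - 1) i (k - 1) \<otimes>\<^bsub>A (vert F i)\<^esub> tri F (i - 1) i k = u (i, k)"
      using ik F(2)[of i] F(4)[of i'] b_Suc[of i' k'] b[of i' k'] u[of i k] by simp
  qed
  moreover have "mk_matrix n d (\<lambda>i k. u (i, k)) = M"
    using ext M by (simp add: mk_matrix_def extensional_restrict)
  ultimately show ?thesis using that F(1) by simp
qed

end

section \<open>The nerve is a simplicial set\<close>

lemma mono_skip: "mono (skip j)"
  by (auto simp: mono_def skip_def)

lemma mono_merge: "mono (merge j)"
  by (auto simp: mono_def merge_def)

lemma pull_pull: "pull p (pull q F) = pull (\<lambda>i. q (p i)) F"
  by (simp add: pull_def)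

context crossed_module
begin

abbreviation "\<N> \<equiv> nerve C A act bd"

lemma nerve_simps [simp]:
  "simplices \<N> n = nerve_simplices C A n"
  "face \<N> n j M = nerve_face C A act bd n j M"
  "degen \<N> n j M = nerve_degen C A n j M"
  by (simp_all add: nerve_def)

lemma cocycle_face:
  assumes "cocycle (Suc n) F" "j \<le> Suc n"
  shows "cocycle n (pull (skip j) F)"
  by (rule cocycle_pull[OF assms(1) mono_skip]) (simp add: skip_def)

lemma cocycle_degen:
  assumes "cocycle n F" "j \<le> n"
  shows "cocycle (Suc n) (pull (merge j) F)"
  by (rule cocycle_pull[OF assms(1) mono_merge]) (use assms(2) in \<open>auto simp: merge_def\<close>)

lemma simplicial_set_nerve: "simplicial_set \<N>"
proof (unfold_locales, unfold nerve_simps, goal_cases)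
  case (1 j n x)
  then show ?case
    by (metis nerve_simplex_matrix_of nerve_face_matrix_of cocycle_face matrix_of_closed)
next
  case (2 j n x)
  then show ?case
    by (metis nerve_simplex_matrix_of nerve_degen_matrix_of cocycle_degen matrix_of_closed)
next
  case (3 i j n x)
  obtain F where F: "cocycle (Suc (Suc n)) F" "matrix_of (Suc (Suc n)) F = x"
    using nerve_simplex_matrix_of 3(3) by blast
  have "(\<lambda>k. skip j (skip i k)) = (\<lambda>k. skip i (skip (j - 1) k))"
    by (intro ext) (use 3 in \<open>auto simp: skip_def\<close>)
  then show ?case
    using 3 F by (auto simp: nerve_face_matrix_of cocycle_face pull_pull)
next
  case (4 i j n x)
  obtain F where F: "cocycle n F" "matrix_of n F = x"
    using nerve_simplex_matrix_of 4(3) by blast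
  have "(\<lambda>k. merge j (merge i k)) = (\<lambda>k. merge i (merge (Suc j) k))"
    using 4 by (auto simp: merge_def)
  then show ?case
    using 4 F by (auto simp: nerve_degen_matrix_of cocycle_degen pull_pull)
next
  case (5 i j n x)
  obtain F where F: "cocycle (Suc n) F" "matrix_of (Suc n) F = x"
    using nerve_simplex_matrix_of 5(3) by blast
  have "(\<lambda>k. merge j (skip i k)) = (\<lambda>k. skip i (merge (j - 1) k))"
    by (intro ext) (use 5 in \<open>auto simp: merge_def skip_def\<close>)
  then show ?case
    using 5 F by (auto simp: nerve_degen_matrix_of nerve_face_matrix_of cocycle_degen cocycle_face pull_pull)
next
  case (6 j n i x)
  obtain F where F: "cocycle n F" "matrix_of n F = x"
    using nerve_simplex_matrix_of 6(3) by blast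
  have "merge j (skip i k) = k" for k
    using 6 by (auto simp: merge_def skip_def)
  then have "pull (skip i) (pull (merge j) F) = F"
    by (simp add: pull_def)
  then show ?case
    using 6 F by (auto simp: nerve_degen_matrix_of nerve_face_matrix_of cocycle_degen)
next
  case (7 j i n x)
  obtain F where F: "cocycle (Suc n) F" "matrix_of (Suc n) F = x"
    using nerve_simplex_matrix_of 7(3) by blast
  have "(\<lambda>k. merge j (skip i k)) = (\<lambda>k. skip (i - 1) (merge j k))"
    by (intro ext) (use 7 in \<open>auto simp: merge_def skip_def\<close>)
  then show ?case
    using 7 F by (auto simp: nerve_degen_matrix_of nerve_face_matrix_of cocycle_degen cocycle_face pull_pull)
qed

end

section \<open>Tetrahedra and the pentagon\<close>

text \<open>The five products \<open>rtw\<close>, \<open>pvw\<close>, \<open>puy\<close>, \<open>qsy\<close> and \<open>rsx\<close> are the corners of a pentagon whose sides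
  are the five equations; each side follows from the other four by going round and cancelling.\<close>

lemma (in group) pentagon_cancel:
  assumes [simp]: "p \<in> carrier G" "q \<in> carrier G" "r \<in> carrier G" "s \<in> carrier G" "t \<in> carrier G"
    "u \<in> carrier G" "v \<in> carrier G" "w \<in> carrier G" "x \<in> carrier G" "y \<in> carrier G"
  shows "\<lbrakk>r \<otimes> t = p \<otimes> v; r \<otimes> (s \<otimes> x) = q \<otimes> (s \<otimes> y); v \<otimes> w = u \<otimes> y; t \<otimes> w = s \<otimes> x\<rbrakk> \<Longrightarrow> q \<otimes> s = p \<otimes> u"
    and "\<lbrakk>q \<otimes> s = p \<otimes> u; r \<otimes> (s \<otimes> x) = q \<otimes> (s \<otimes> y); v \<otimes> w = u \<otimes> y; t \<otimes> w = s \<otimes> x\<rbrakk> \<Longrightarrow> r \<otimes> t = p \<otimes> v"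
    and "\<lbrakk>q \<otimes> s = p \<otimes> u; r \<otimes> t = p \<otimes> v; v \<otimes> w = u \<otimes> y; t \<otimes> w = s \<otimes> x\<rbrakk> \<Longrightarrow> r \<otimes> (s \<otimes> x) = q \<otimes> (s \<otimes> y)"
    and "\<lbrakk>q \<otimes> s = p \<otimes> u; r \<otimes> t = p \<otimes> v; r \<otimes> (s \<otimes> x) = q \<otimes> (s \<otimes> y); t \<otimes> w = s \<otimes> x\<rbrakk> \<Longrightarrow> v \<otimes> w = u \<otimes> y"
    and "\<lbrakk>q \<otimes> s = p \<otimes> u; r \<otimes> t = p \<otimes> v; r \<otimes> (s \<otimes> x) = q \<otimes> (s \<otimes> y); v \<otimes> w = u \<otimes> y\<rbrakk> \<Longrightarrow> t \<otimes> w = s \<otimes> x"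
proof -
  have cl: "a \<otimes> b = c \<otimes> d \<Longrightarrow> e \<in> carrier G \<Longrightarrow> a \<in> carrier G \<Longrightarrow> b \<in> carrier G \<Longrightarrow> c \<in> carrier G \<Longrightarrow> d \<in> carrier G
      \<Longrightarrow> a \<otimes> (b \<otimes> e) = c \<otimes> (d \<otimes> e)" for a b c d e
    by (simp add: m_assoc[symmetric])
  {
    assume a: "r \<otimes> t = p \<otimes> v" "r \<otimes> (s \<otimes> x) = q \<otimes> (s \<otimes> y)" "v \<otimes> w = u \<otimes> y" "t \<otimes> w = s \<otimes> x"
    have "(q \<otimes> s) \<otimes> y = (p \<otimes> u) \<otimes> y"
      using a cl[OF a(1), of w] by (simp add: m_assoc)
    then show "q \<otimes> s = p \<otimes> u" by (simp del: m_assoc)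
  next
    assume a: "q \<otimes> s = p \<otimes> u" "r \<otimes> (s \<otimes> x) = q \<otimes> (s \<otimes> y)" "v \<otimes> w = u \<otimes> y" "t \<otimes> w = s \<otimes> x"
    have "(r \<otimes> t) \<otimes> w = (p \<otimes> v) \<otimes> w"
      using a cl[OF a(1), of y] by (simp add: m_assoc)
    then show "r \<otimes> t = p \<otimes> v" by simp
  next
    assume a: "q \<otimes> s = p \<otimes> u" "r \<otimes> t = p \<otimes> v" "v \<otimes> w = u \<otimes> y" "t \<otimes> w = s \<otimes> x"
    show "r \<otimes> (s \<otimes> x) = q \<otimes> (s \<otimes> y)"
      using cl[OF a(1), of y] cl[OF a(2), of w] a(3,4) by simp
  next
    assume a: "q \<otimes> s = p \<otimes> u" "r \<otimes> t = p \<otimes> v" "r \<otimes> (s \<otimes> x) = q \<otimes> (s \<otimes> y)" "t \<otimes> w = s \<otimes> x"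
    have "p \<otimes> (v \<otimes> w) = p \<otimes> (u \<otimes> y)"
      using cl[OF a(1), of y] cl[OF a(2), of w] a(3,4) by simp
    then show "v \<otimes> w = u \<otimes> y" by simp
  next
    assume a: "q \<otimes> s = p \<otimes> u" "r \<otimes> t = p \<otimes> v" "r \<otimes> (s \<otimes> x) = q \<otimes> (s \<otimes> y)" "v \<otimes> w = u \<otimes> y"
    have "r \<otimes> (t \<otimes> w) = r \<otimes> (s \<otimes> x)"
      using cl[OF a(1), of y] cl[OF a(2), of w] a(3,4) by simp
    then show "t \<otimes> w = s \<otimes> x" by simp
  }
qed

context crossed_module
begin

abbreviation tetrahedron where
  "tetrahedron F i j k l \<equiv>
     act (edge F j k) (tri F i j l) \<otimes>\<^bsub>A (vert F k)\<^esub> tri F j k l =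
     act (edge F j k) (tri F i j k) \<otimes>\<^bsub>A (vert F k)\<^esub> tri F i k l"

abbreviation triangle where
  "triangle F i j k \<equiv> tri F i j k \<in> carrier (A (vert F j)) \<and>
     edge F i k = edge F i j \<cdot> bd (vert F j) (tri F i j k) \<cdot> edge F j k"

text \<open>Degenerate triangles and tetrahedra take care of themselves once the labels are normalised.\<close>

lemma cocycleI:
  assumes v: "\<And>i. i \<le> n \<Longrightarrow> vert F i \<in> Obj C"
    and e: "\<And>i j. \<lbrakk>i < j; j \<le> n\<rbrakk> \<Longrightarrow> edge F i j \<in> Hom C (vert F j) (vert F i)"
    and e1: "\<And>i. i \<le> n \<Longrightarrow> edge F i i = ident C (vert F i)"
    and t1: "\<And>i j. \<lbrakk>i \<le> j; j \<le> n\<rbrakk> \<Longrightarrow> tri F i i j = \<one>\<^bsub>A (vert F i)\<^esub>"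
      "\<And>i j. \<lbrakk>i \<le> j; j \<le> n\<rbrakk> \<Longrightarrow> tri F i j j = \<one>\<^bsub>A (vert F j)\<^esub>"
    and t: "\<And>i j k. \<lbrakk>i < j; j < k; k \<le> n\<rbrakk> \<Longrightarrow> triangle F i j k"
    and T: "\<And>i j k l. \<lbrakk>i < j; j < k; k < l; l \<le> n\<rbrakk> \<Longrightarrow> tetrahedron F i j k l"
  shows "cocycle n F"
proof -
  have e': "edge F i j \<in> Hom C (vert F j) (vert F i)" if "i \<le> j" "j \<le> n" for i j
    using that e e1 v ident_Hom by (cases "i = j") auto
  have one: "\<one>\<^bsub>A (vert F i)\<^esub> \<in> carrier (A (vert F i))" if "i \<le> n" for i
    using that v monoid_A monoid.one_closed by blast
  have t': "triangle F i j k" if ijk: "i \<le> j" "j \<le> k" "k \<le> n" for i j k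
  proof -
    consider "i = j" | "j = k" | "i < j" "j < k"
      using ijk by linarith
    then show ?thesis
    proof cases
      case 1
      then show ?thesis
        using that t1(1)[of i k] one[of i] e1[of i] bd_one[OF v[of i]] comp_ident_left[OF e'[of i k]] by simp
    next
      case 2
      then show ?thesis
        using that t1(2)[of i k] one[of k] e1[of k] bd_one[OF v[of k]] comp_ident_right[OF e'[of i k]]
          comp_ident_left[OF ident_Hom[OF v[of k]]] by simp
    next
      case 3
      then show ?thesis using t that by simp
    qed
  qed
  have T': "tetrahedron F i j k l" if ijkl: "i \<le> j" "j \<le> k" "k \<le> l" "l \<le> n" for i j k l
  proof -
    interpret monoid "A (vert F k)" using v that monoid_A by simp
    consider "i = j" | "j = k" | "k = l" | "i < j" "j < k" "k < l"
      using ijkl by linarith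
    then show ?thesis
    proof cases
      case 1
      then show ?thesis using that t1 by simp
    next
      case 2
      have "tri F i k l \<in> carrier (A (vert F k))" using t'[of i k l] that 2 by simp
      then show ?thesis
        using 2 that e1[of k] act_ident[OF v[of k]] t1(1)[of k l] t1(2)[of i k] one[of k] by simp
    next
      case 3
      then show ?thesis using that t1 by simp
    next
      case 4
      then show ?thesis using T that by simp
    qed
  qed
  show ?thesis
    unfolding cocycle_def
    by ((intro conjI allI impI; (elim conjE)?);
      rule v e' e1 t1 t'[THEN conjunct1] t'[THEN conjunct2] T'; assumption)
qed

text \<open>Transported to the group of the vertex \<open>d\<close>, the five tetrahedra of a 4-simplex become the five sides
  of the pentagon in \<open>pentagon_cancel\<close>.  The group acts injectively, as the morphisms are invertible, so
  nothing is lost.  The tetrahedron \<open>a, b, d, e\<close> involves the action of the edge from \<open>b\<close> to \<open>d\<close>,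
  which is that of the path through \<open>c\<close> conjugated by \<open>s\<close>; this is why \<open>s\<close> occurs on both of its sides.\<close>

lemma pentagon:
  assumes H: "edge F b c \<in> Hom C (vert F c) (vert F b)" "edge F c d \<in> Hom C (vert F d) (vert F c)"
    and t: "triangle F b c d"
    and A1: "tri F a b c \<in> carrier (A (vert F b))" "tri F a b d \<in> carrier (A (vert F b))"
      "tri F a b e \<in> carrier (A (vert F b))"
    and A2: "tri F a c d \<in> carrier (A (vert F c))" "tri F a c e \<in> carrier (A (vert F c))"
      "tri F b c e \<in> carrier (A (vert F c))"
    and A3: "tri F a d e \<in> carrier (A (vert F d))" "tri F b d e \<in> carrier (A (vert F d))"
      "tri F c d e \<in> carrier (A (vert F d))"
  shows "\<lbrakk>tetrahedron F a b c e; tetrahedron F a b d e; tetrahedron F a c d e; tetrahedron F b c d e\<rbrakk>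
      \<Longrightarrow> tetrahedron F a b c d"
    and "\<lbrakk>tetrahedron F a b c d; tetrahedron F a b d e; tetrahedron F a c d e; tetrahedron F b c d e\<rbrakk>
      \<Longrightarrow> tetrahedron F a b c e"
    and "\<lbrakk>tetrahedron F a b c d; tetrahedron F a b c e; tetrahedron F a c d e; tetrahedron F b c d e\<rbrakk>
      \<Longrightarrow> tetrahedron F a b d e"
    and "\<lbrakk>tetrahedron F a b c d; tetrahedron F a b c e; tetrahedron F a b d e; tetrahedron F b c d e\<rbrakk>
      \<Longrightarrow> tetrahedron F a c d e"
    and "\<lbrakk>tetrahedron F a b c d; tetrahedron F a b c e; tetrahedron F a b d e; tetrahedron F a c d e\<rbrakk>
      \<Longrightarrow> tetrahedron F b c d e"
proof -
  let ?G = "A (vert F d)"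
  let ?\<alpha> = "edge F b c" and ?\<beta> = "edge F c d"
  have obj: "vert F c \<in> Obj C" "vert F d \<in> Obj C" using H Hom_Obj by auto
  interpret c: group "A (vert F c)" using obj group_A by blast
  interpret group ?G using obj group_A by blast
  define p where "p = act ?\<beta> (act ?\<alpha> (tri F a b c))"
  define q where "q = act ?\<beta> (act ?\<alpha> (tri F a b d))"
  define r where "r = act ?\<beta> (act ?\<alpha> (tri F a b e))"
  define s where "s = act ?\<beta> (tri F b c d)"
  define t' where "t' = act ?\<beta> (tri F b c e)"
  define u where "u = act ?\<beta> (tri F a c d)"
  define v where "v = act ?\<beta> (tri F a c e)"
  note defs = p_def q_def r_def s_def t'_def u_def v_def
  note ac = act_closed[OF H(1)] act_closed[OF H(2)]
  have closed: "p \<in> carrier ?G" "q \<in> carrier ?G" "r \<in> carrier ?G" "s \<in> carrier ?G" "t' \<in> carrier ?G"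
    "u \<in> carrier ?G" "v \<in> carrier ?G"
    unfolding defs using ac A1 A2 t by simp_all
  have abc: "tetrahedron F a b c m \<longleftrightarrow>
      act ?\<beta> (act ?\<alpha> (tri F a b m)) \<otimes>\<^bsub>?G\<^esub> act ?\<beta> (tri F b c m) = p \<otimes>\<^bsub>?G\<^esub> act ?\<beta> (tri F a c m)"
    if m: "tri F a b m \<in> carrier (A (vert F b))" "tri F a c m \<in> carrier (A (vert F c))"
      "tri F b c m \<in> carrier (A (vert F c))" for m
  proof
    show "tetrahedron F a b c m \<Longrightarrow>
      act ?\<beta> (act ?\<alpha> (tri F a b m)) \<otimes>\<^bsub>?G\<^esub> act ?\<beta> (tri F b c m) = p \<otimes>\<^bsub>?G\<^esub> act ?\<beta> (tri F a c m)"
      using m ac A1 by (simp add: p_def act_mult[OF H(2), symmetric])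
    show "act ?\<beta> (act ?\<alpha> (tri F a b m)) \<otimes>\<^bsub>?G\<^esub> act ?\<beta> (tri F b c m) = p \<otimes>\<^bsub>?G\<^esub> act ?\<beta> (tri F a c m)
      \<Longrightarrow> tetrahedron F a b c m"
      by (rule act_inj[OF H(2)]) (use m ac A1 in \<open>simp_all add: p_def act_mult[OF H(2)]\<close>)
  qed
  have flat: "s \<otimes>\<^bsub>?G\<^esub> act (edge F b d) z = act ?\<beta> (act ?\<alpha> z) \<otimes>\<^bsub>?G\<^esub> s"
    "act (edge F b d) z \<in> carrier ?G" if "z \<in> carrier (A (vert F b))" for z
    using act_along_composite[OF H, of "tri F b c d" z] that t
      act_closed[OF comp_Hom[OF H(1) comp_Hom[OF bd_closed[OF obj(1)] H(2)]], of "tri F b c d" z]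
    by (simp_all add: s_def)
  have abd: "tetrahedron F a b d e \<longleftrightarrow>
      r \<otimes>\<^bsub>?G\<^esub> (s \<otimes>\<^bsub>?G\<^esub> tri F b d e) = q \<otimes>\<^bsub>?G\<^esub> (s \<otimes>\<^bsub>?G\<^esub> tri F a d e)"
  proof -
    have "s \<otimes>\<^bsub>?G\<^esub> (act (edge F b d) z \<otimes>\<^bsub>?G\<^esub> w) = act ?\<beta> (act ?\<alpha> z) \<otimes>\<^bsub>?G\<^esub> (s \<otimes>\<^bsub>?G\<^esub> w)"
      if "z \<in> carrier (A (vert F b))" "w \<in> carrier ?G" for z w
      using flat[of z] that closed ac by (simp add: m_assoc[symmetric])
    note this[OF A1(3) A3(2)] this[OF A1(2) A3(1)]
    then show ?thesis
      unfolding q_def[symmetric] r_def[symmetric] 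
      using closed flat(2)[OF A1(2)] flat(2)[OF A1(3)] A3
      by (metis Units_eq Units_l_cancel m_closed)
  qed
  note iffs = abc[OF A1(2) A2(1) conjunct1[OF t], folded q_def s_def u_def]
    abc[OF A1(3) A2(2,3), folded r_def t'_def v_def] abd
  note pc = pentagon_cancel[OF closed A3(3,2,1)]
  show "\<lbrakk>tetrahedron F a b c e; tetrahedron F a b d e; tetrahedron F a c d e; tetrahedron F b c d e\<rbrakk>
      \<Longrightarrow> tetrahedron F a b c d"
    unfolding iffs using pc(1) by (simp add: v_def u_def s_def t'_def)
  show "\<lbrakk>tetrahedron F a b c d; tetrahedron F a b d e; tetrahedron F a c d e; tetrahedron F b c d e\<rbrakk>
      \<Longrightarrow> tetrahedron F a b c e"
    unfolding iffs using pc(2) by (simp add: v_def u_def s_def t'_def)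
  show "\<lbrakk>tetrahedron F a b c d; tetrahedron F a b c e; tetrahedron F a c d e; tetrahedron F b c d e\<rbrakk>
      \<Longrightarrow> tetrahedron F a b d e"
    unfolding iffs using pc(3) by (simp add: v_def u_def s_def t'_def)
  show "\<lbrakk>tetrahedron F a b c d; tetrahedron F a b c e; tetrahedron F a b d e; tetrahedron F b c d e\<rbrakk>
      \<Longrightarrow> tetrahedron F a c d e"
    unfolding iffs using pc(4) by (simp add: v_def u_def s_def t'_def)
  show "\<lbrakk>tetrahedron F a b c d; tetrahedron F a b c e; tetrahedron F a b d e; tetrahedron F a c d e\<rbrakk>
      \<Longrightarrow> tetrahedron F b c d e"
    unfolding iffs using pc(5) by (simp add: v_def u_def s_def t'_def)
qed

end

section \<open>Filling horns of dimension at least three\<close>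

text \<open>A left inverse of \<open>skip k\<close>: it renumbers the vertices other than \<open>k\<close> as vertices of the \<open>k\<close>-th face.\<close>

definition unskip :: "nat \<Rightarrow> nat \<Rightarrow> nat" where
  "unskip k v = (if v < k then v else v - 1)"

lemma unskip_skip: "unskip k (skip k v) = v"
  by (simp add: unskip_def skip_def)

lemma unskip_mono: "i \<le> j \<Longrightarrow> unskip k i \<le> unskip k j"
  by (auto simp: unskip_def)

lemma unskip_le: "\<lbrakk>v \<noteq> k; v \<le> n; k \<le> n\<rbrakk> \<Longrightarrow> unskip k v \<le> n - 1"
  by (auto simp: unskip_def)

lemma skip_unskip_twice:
  assumes "j < k" "v \<noteq> j" "v \<noteq> k"
  shows "skip j (unskip j (unskip k v)) = unskip k v"
    and "skip (k - 1) (unskip j (unskip k v)) = unskip j v"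
  using assms by (auto simp: skip_def unskip_def)

lemma ex_avoiding:
  assumes "finite S" "card S \<le> n"
  obtains p :: nat where "p \<le> n" "p \<notin> S"
proof -
  have "\<not> {..n} \<subseteq> S"
    using assms card_mono[of S "{..n}"] by auto
  then show ?thesis using that by auto
qed

context crossed_module
begin

abbreviation edges_compose where
  "edges_compose F a b c \<equiv> edge F a c = edge F a b \<cdot> bd (vert F b) (tri F a b c) \<cdot> edge F b c"

text \<open>Composing three edges with the 2-cells of two triangles leads from \<open>f\<^sub>a\<^sub>b f\<^sub>b\<^sub>c f\<^sub>c\<^sub>d\<close>
  to \<open>f\<^sub>a\<^sub>d\<close> in two ways, which agree when the tetrahedron commutes (\<open>paths\<close>).  Each boundary equation then
  follows from the other three, by cancelling invertible morphisms where necessary.\<close>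

lemma tetrahedron_edges:
  assumes H: "edge F a b \<in> Hom C (vert F b) (vert F a)" "edge F b c \<in> Hom C (vert F c) (vert F b)"
      "edge F c d \<in> Hom C (vert F d) (vert F c)" "edge F a c \<in> Hom C (vert F c) (vert F a)"
      "edge F b d \<in> Hom C (vert F d) (vert F b)"
    and A: "tri F a b c \<in> carrier (A (vert F b))" "tri F a b d \<in> carrier (A (vert F b))"
      "tri F a c d \<in> carrier (A (vert F c))" "tri F b c d \<in> carrier (A (vert F c))"
    and T: "tetrahedron F a b c d"
  shows "\<lbrakk>edges_compose F a b d; edges_compose F a c d; edges_compose F b c d\<rbrakk> \<Longrightarrow> edges_compose F a b c"
    and "\<lbrakk>edges_compose F a b c; edges_compose F a c d; edges_compose F b c d\<rbrakk> \<Longrightarrow> edges_compose F a b d"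
    and "\<lbrakk>edges_compose F a b c; edges_compose F a b d; edges_compose F b c d\<rbrakk> \<Longrightarrow> edges_compose F a c d"
    and "\<lbrakk>edges_compose F a b c; edges_compose F a b d; edges_compose F a c d\<rbrakk> \<Longrightarrow> edges_compose F b c d"
proof -
  let ?xb = "vert F b" and ?xc = "vert F c"
  let ?ab = "edge F a b" and ?bc = "edge F b c" and ?cd = "edge F c d"
  have obj: "?xb \<in> Obj C" "?xc \<in> Obj C" using H Hom_Obj by auto
  note B = bd_closed[OF obj(1) A(1)] bd_closed[OF obj(1) A(2)] bd_closed[OF obj(2) A(3)] bd_closed[OF obj(2) A(4)]
  have slide: "bd ?xb x \<cdot> ?bc \<cdot> bd ?xc y \<cdot> ?cd = ?bc \<cdot> bd ?xc (act ?bc x \<otimes>\<^bsub>A ?xc\<^esub> y) \<cdot> ?cd"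
    if "x \<in> carrier (A ?xb)" "y \<in> carrier (A ?xc)" for x y
  proof -
    have y: "bd ?xc y \<in> Hom C ?xc ?xc" and x: "bd ?xc (act ?bc x) \<in> Hom C ?xc ?xc"
      using that obj bd_closed act_closed[OF H(2)] by auto
    have "bd ?xb x \<cdot> ?bc \<cdot> bd ?xc y \<cdot> ?cd = ?bc \<cdot> bd ?xc (act ?bc x) \<cdot> bd ?xc y \<cdot> ?cd"
      by (rule move_bd_across[OF H(2) comp_Hom[OF y H(3)] that(1)])
    then show ?thesis
      using comp_assoc[OF x y H(3)] bd_mult[OF obj(2) act_closed[OF H(2) that(1)] that(2)] by simp
  qed
  have paths: "?ab \<cdot> bd ?xb (tri F a b d) \<cdot> ?bc \<cdot> bd ?xc (tri F b c d) \<cdot> ?cd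
      = (?ab \<cdot> bd ?xb (tri F a b c) \<cdot> ?bc) \<cdot> bd ?xc (tri F a c d) \<cdot> ?cd"
  proof -
    have "bd ?xb (tri F a b d) \<cdot> ?bc \<cdot> bd ?xc (tri F b c d) \<cdot> ?cd
        = bd ?xb (tri F a b c) \<cdot> ?bc \<cdot> bd ?xc (tri F a c d) \<cdot> ?cd"
      using slide[OF A(2,4)] slide[OF A(1,3)] T by simp
    then show ?thesis
      using comp_assoc[OF H(1) comp_Hom[OF B(1) H(2)] comp_Hom[OF B(3) H(3)]]
        comp_assoc[OF B(1) H(2) comp_Hom[OF B(3) H(3)]] by simp
  qed
  show "\<lbrakk>edges_compose F a b c; edges_compose F a c d; edges_compose F b c d\<rbrakk> \<Longrightarrow> edges_compose F a b d"
    and "\<lbrakk>edges_compose F a b c; edges_compose F a b d; edges_compose F b c d\<rbrakk> \<Longrightarrow> edges_compose F a c d"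
    using paths by simp_all
  {
    assume E: "edges_compose F a b d" "edges_compose F a c d" "edges_compose F b c d"
    have "edge F a c \<cdot> (bd ?xc (tri F a c d) \<cdot> ?cd) = (?ab \<cdot> bd ?xb (tri F a b c) \<cdot> ?bc) \<cdot> bd ?xc (tri F a c d) \<cdot> ?cd"
      using paths E(1)[unfolded E(3)] E(2) by simp
    then show "edges_compose F a b c"
      by (rule comp_cancel_right[OF comp_Hom[OF B(3) H(3)] H(4) comp_Hom[OF H(1) comp_Hom[OF B(1) H(2)]]])
  next
    assume E: "edges_compose F a b c" "edges_compose F a b d" "edges_compose F a c d"
    have "?ab \<cdot> bd ?xb (tri F a b d) \<cdot> edge F b d
        = ?ab \<cdot> bd ?xb (tri F a b d) \<cdot> ?bc \<cdot> bd ?xc (tri F b c d) \<cdot> ?cd"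
      using paths E(3)[unfolded E(1)] E(2) by simp
    note cancel = comp_cancel_left[OF H(1) _ _ this]
    note P = comp_Hom[OF H(2) comp_Hom[OF B(4) H(3)]]
    show "edges_compose F b c d"
      by (rule comp_cancel_left[OF B(2) H(5) P cancel[OF comp_Hom[OF B(2) H(5)] comp_Hom[OF B(2) P]]])
  }
qed

text \<open>Of the labels, only the triangle opposite \<open>l\<close> is changed.  For \<open>l \<le> 1\<close> its label occurs
  without an action in the tetrahedron equation; for \<open>l \<ge> 2\<close> the solution uses
  that a morphism acts surjectively.\<close>

lemma fill_tetrahedron:
  assumes l: "l \<le> 3"
    and H: "\<And>i j. \<lbrakk>i < j; j \<le> 3\<rbrakk> \<Longrightarrow> edge F i j \<in> Hom C (vert F j) (vert F i)"
    and t: "\<And>i j k. \<lbrakk>i < j; j < k; k \<le> 3; l \<in> {i, j, k}\<rbrakk> \<Longrightarrow> triangle F i j k"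
  obtains F' where "vert F' = vert F" "edge F' = edge F"
    "\<And>i j k. \<lbrakk>l \<in> {i, j, k} \<or> i = j \<or> j = k\<rbrakk> \<Longrightarrow> tri F' i j k = tri F i j k"
    "\<And>i j k. \<lbrakk>i < j; j < k; k \<le> 3\<rbrakk> \<Longrightarrow> triangle F' i j k"
    "tetrahedron F' 0 1 2 3"
proof -
  note result = that
  define R where "R s = Labelling (vert F) (edge F)
    (\<lambda>i j k. if l \<in> {i, j, k} \<or> i = j \<or> j = k then tri F i j k else s)" for s
  have R: "vert (R s) = vert F" "edge (R s) = edge F"
    "tri (R s) i j k = (if l \<in> {i, j, k} \<or> i = j \<or> j = k then tri F i j k else s)" for s i j k
    by (simp_all add: R_def)
  let ?f = "edge F 1 2"
  have f: "?f \<in> Hom C (vert F 2) (vert F 1)" by (rule H) auto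
  have grp: "group (A (vert F 2))" "group (A (vert F 1))" using f Hom_Obj group_A by blast+
  interpret group "A (vert F 2)" by (rule grp)
  let ?G = "A (vert F 2)"
  note ac = act_closed[OF f]
  have edges: "edge F 0 1 \<in> Hom C (vert F 1) (vert F 0)" "edge F 1 2 \<in> Hom C (vert F 2) (vert F 1)"
    "edge F 2 3 \<in> Hom C (vert F 3) (vert F 2)" "edge F 0 2 \<in> Hom C (vert F 2) (vert F 0)"
    "edge F 1 3 \<in> Hom C (vert F 3) (vert F 1)"
    by (rule H; simp)+
  have finish: thesis
    if T: "tetrahedron (R s) 0 1 2 3"
      and tris: "tri (R s) 0 1 2 \<in> carrier (A (vert F 1))" "tri (R s) 0 1 3 \<in> carrier (A (vert F 1))"
        "tri (R s) 0 2 3 \<in> carrier (A (vert F 2))" "tri (R s) 1 2 3 \<in> carrier (A (vert F 2))" for s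
  proof -
    have old: "triangle (R s) i j k" if "i < j" "j < k" "k \<le> 3" "l \<in> {i, j, k}" for i j k
      using t that by (simp add: R)
    note te = tetrahedron_edges[of "R s" 0 1 2 3, unfolded R(1,2), OF edges tris T[unfolded R(1,2)], folded R(1,2)[of s]]
    have "edges_compose (R s) 0 1 2 \<and> edges_compose (R s) 0 1 3 \<and> edges_compose (R s) 0 2 3 \<and> edges_compose (R s) 1 2 3"
    proof -
      consider "l = 0" | "l = 1" | "l = 2" | "l = 3" using l by linarith
      then show ?thesis
      proof cases
        case 1
        have "edges_compose (R s) 0 1 2" "edges_compose (R s) 0 1 3" "edges_compose (R s) 0 2 3"
          by (rule old[THEN conjunct2]; simp add: 1)+
        then show ?thesis using te(4) by blast
      next
        case 2
        have "edges_compose (R s) 0 1 2" "edges_compose (R s) 0 1 3" "edges_compose (R s) 1 2 3"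
          by (rule old[THEN conjunct2]; simp add: 2)+
        then show ?thesis using te(3) by blast
      next
        case 3
        have "edges_compose (R s) 0 1 2" "edges_compose (R s) 0 2 3" "edges_compose (R s) 1 2 3"
          by (rule old[THEN conjunct2]; simp add: 3)+
        then show ?thesis using te(2) by blast
      next
        case 4
        have "edges_compose (R s) 0 1 3" "edges_compose (R s) 0 2 3" "edges_compose (R s) 1 2 3"
          by (rule old[THEN conjunct2]; simp add: 4)+
        then show ?thesis using te(1) by blast
      qed
    qed
    then have "triangle (R s) 0 1 2" "triangle (R s) 0 1 3" "triangle (R s) 0 2 3" "triangle (R s) 1 2 3"
      using tris unfolding R(1) by blast+
    moreover have "(i, j, k) \<in> {(0, 1, 2), (0, 1, 3), (0, 2, 3), (1, 2, 3)}"
      if "i < j" "j < k" "k \<le> 3" for i j k :: nat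
      using that by auto
    ultimately have "triangle (R s) i j k" if "i < j" "j < k" "k \<le> 3" for i j k
      using that by blast
    then show thesis
      by (intro result[of "R s"] T) (auto simp: R)
  qed
  consider "l = 0" | "l = 1" | "l = 2" | "l = 3" using l by linarith
  then show thesis
  proof cases
    case 1
    have a: "tri F 0 1 2 \<in> carrier (A (vert F 1))" "tri F 0 1 3 \<in> carrier (A (vert F 1))"
      "tri F 0 2 3 \<in> carrier ?G"
      by (rule t[THEN conjunct1]; simp add: 1)+
    show thesis
      by (rule finish[of "inv\<^bsub>?G\<^esub> act ?f (tri F 0 1 3) \<otimes>\<^bsub>?G\<^esub> (act ?f (tri F 0 1 2) \<otimes>\<^bsub>?G\<^esub> tri F 0 2 3)"])
        (use a ac in \<open>simp_all add: R 1\<close>)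
  next
    case 2
    have a: "tri F 0 1 2 \<in> carrier (A (vert F 1))" "tri F 0 1 3 \<in> carrier (A (vert F 1))"
      "tri F 1 2 3 \<in> carrier ?G"
      by (rule t[THEN conjunct1]; simp add: 2)+
    show thesis
      by (rule finish[of "inv\<^bsub>?G\<^esub> act ?f (tri F 0 1 2) \<otimes>\<^bsub>?G\<^esub> (act ?f (tri F 0 1 3) \<otimes>\<^bsub>?G\<^esub> tri F 1 2 3)"])
        (use a ac in \<open>simp_all add: R 2\<close>)
  next
    case 3
    have a: "tri F 0 1 2 \<in> carrier (A (vert F 1))" "tri F 0 2 3 \<in> carrier ?G"
      "tri F 1 2 3 \<in> carrier ?G"
      by (rule t[THEN conjunct1]; simp add: 3)+
    then obtain s where s: "s \<in> carrier (A (vert F 1))"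
      "act ?f s = (act ?f (tri F 0 1 2) \<otimes>\<^bsub>?G\<^esub> tri F 0 2 3) \<otimes>\<^bsub>?G\<^esub> inv\<^bsub>?G\<^esub> tri F 1 2 3"
      using act_surj[OF f, of "(act ?f (tri F 0 1 2) \<otimes>\<^bsub>?G\<^esub> tri F 0 2 3) \<otimes>\<^bsub>?G\<^esub> inv\<^bsub>?G\<^esub> tri F 1 2 3"] ac by auto
    show thesis
      by (rule finish[of s]) (use a s ac in \<open>simp_all add: R 3 m_assoc\<close>)
  next
    case 4
    have a: "tri F 0 1 3 \<in> carrier (A (vert F 1))" "tri F 0 2 3 \<in> carrier ?G"
      "tri F 1 2 3 \<in> carrier ?G"
      by (rule t[THEN conjunct1]; simp add: 4)+
    then obtain s where s: "s \<in> carrier (A (vert F 1))"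
      "act ?f s = (act ?f (tri F 0 1 3) \<otimes>\<^bsub>?G\<^esub> tri F 1 2 3) \<otimes>\<^bsub>?G\<^esub> inv\<^bsub>?G\<^esub> tri F 0 2 3"
      using act_surj[OF f, of "(act ?f (tri F 0 1 3) \<otimes>\<^bsub>?G\<^esub> tri F 1 2 3) \<otimes>\<^bsub>?G\<^esub> inv\<^bsub>?G\<^esub> tri F 0 2 3"] ac by auto
    show thesis
      by (rule finish[of s]) (use a s ac in \<open>simp_all add: R 4 m_assoc\<close>)
  qed
qed

text \<open>All labels of the filler are read off from the faces of the horn: a set \<open>S\<close> of vertices lies in the
  \<open>p\<close>-th face when \<open>p \<notin> S\<close>, and the face conditions make the choice of \<open>p\<close> irrelevant.
  The simplices in no face of the horn are those that contain all vertices but possibly \<open>l\<close>.\<close>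

lemma fill_labelled_horn:
  assumes n: "3 \<le> n" and l: "l \<le> n"
    and G: "\<And>k. \<lbrakk>k \<le> n; k \<noteq> l\<rbrakk> \<Longrightarrow> cocycle (n - 1) (G k)"
    and compat: "\<And>j k. \<lbrakk>j < k; k \<le> n; j \<noteq> l; k \<noteq> l\<rbrakk> \<Longrightarrow>
      agree (n - 2) (pull (skip j) (G k)) (pull (skip (k - 1)) (G j))"
  obtains F where "cocycle n F" "\<And>k. \<lbrakk>k \<le> n; k \<noteq> l\<rbrakk> \<Longrightarrow> agree (n - 1) (pull (skip k) F) (G k)"
proof -
  define P where "P k = pull (unskip k) (G k)" for k
  \<comment> \<open>\<open>P k\<close> is the \<open>k\<close>-th face, labelled by vertices of the big simplex; \<open>w j k\<close> renumbers the vertices of the face of codimension 2 opposite \<open>j\<close> and \<open>k\<close>.\<close>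
  define w where "w j k v = unskip j (unskip k v)" for j k v
  have lt_compat: "\<lbrakk>a \<le> n; a \<notin> {j, k}\<rbrakk> \<Longrightarrow> vert (P j) a = vert (P k) a"
    "\<lbrakk>a \<le> b; b \<le> n; a \<notin> {j, k}; b \<notin> {j, k}\<rbrakk> \<Longrightarrow> edge (P j) a b = edge (P k) a b"
    "\<lbrakk>a \<le> b; b \<le> c; c \<le> n; a \<notin> {j, k}; b \<notin> {j, k}; c \<notin> {j, k}\<rbrakk> \<Longrightarrow> tri (P j) a b c = tri (P k) a b c"
    if jk: "j < k" "k \<le> n" "j \<noteq> l" "k \<noteq> l" for j k a b c
  proof -
    have w: "unskip k v = skip j (w j k v)" "unskip j v = skip (k - 1) (w j k v)" if "v \<notin> {j, k}" for v
      using skip_unskip_twice[of j k v] jk that by (auto simp: w_def)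
    have w_le: "w j k v \<le> n - 2" if "v \<notin> {j, k}" "v \<le> n" for v
      using that jk by (auto simp: w_def unskip_def)
    have w_mono: "w j k v \<le> w j k v'" if "v \<le> v'" for v v'
      unfolding w_def by (intro unskip_mono that)
    note ag = agreeD[OF compat[OF jk], unfolded pull_simps, symmetric]
    show "vert (P j) a = vert (P k) a" if a: "a \<le> n" "a \<notin> {j, k}"
      unfolding P_def pull_simps w[OF a(2)] by (rule ag(1)[OF w_le[OF a(2,1)]])
    show "edge (P j) a b = edge (P k) a b" if a: "a \<le> b" "b \<le> n" "a \<notin> {j, k}" "b \<notin> {j, k}"
      unfolding P_def pull_simps w[OF a(3)] w[OF a(4)]
      by (rule ag(2)[OF w_mono[OF a(1)] w_le[OF a(4,2)]])
    show "tri (P j) a b c = tri (P k) a b c"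
      if a: "a \<le> b" "b \<le> c" "c \<le> n" "a \<notin> {j, k}" "b \<notin> {j, k}" "c \<notin> {j, k}"
      unfolding P_def pull_simps w[OF a(4)] w[OF a(5)] w[OF a(6)]
      by (rule ag(3)[OF w_mono[OF a(1)] w_mono[OF a(2)] w_le[OF a(6,3)]])
  qed
  define valid where "valid S p \<longleftrightarrow> p \<le> n \<and> p \<noteq> l \<and> p \<notin> S" for S p
  have all_compat: "\<lbrakk>a \<in> S; a \<le> n\<rbrakk> \<Longrightarrow> vert (P j) a = vert (P k) a"
    "\<lbrakk>a \<le> b; b \<le> n; a \<in> S; b \<in> S\<rbrakk> \<Longrightarrow> edge (P j) a b = edge (P k) a b"
    "\<lbrakk>a \<le> b; b \<le> c; c \<le> n; a \<in> S; b \<in> S; c \<in> S\<rbrakk> \<Longrightarrow> tri (P j) a b c = tri (P k) a b c"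
    if jk: "valid S j" "valid S k" for S j k a b c
  proof -
    have *: "j \<le> n" "j \<noteq> l" "k \<le> n" "k \<noteq> l" "\<And>x. x \<in> S \<Longrightarrow> x \<notin> {j, k}" "\<And>x. x \<in> S \<Longrightarrow> x \<notin> {k, j}"
      using jk by (auto simp: valid_def)
    show "vert (P j) a = vert (P k) a" if "a \<in> S" "a \<le> n"
      using lt_compat(1)[OF _ *(3,2,4) that(2) *(5)[OF that(1)]]
        lt_compat(1)[OF _ *(1,4,2) that(2) *(6)[OF that(1)]] by (metis linorder_neq_iff)
    show "edge (P j) a b = edge (P k) a b" if "a \<le> b" "b \<le> n" "a \<in> S" "b \<in> S"
      using lt_compat(2)[OF _ *(3,2,4) that(1,2) *(5)[OF that(3)] *(5)[OF that(4)]]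
        lt_compat(2)[OF _ *(1,4,2) that(1,2) *(6)[OF that(3)] *(6)[OF that(4)]] by (metis linorder_neq_iff)
    show "tri (P j) a b c = tri (P k) a b c" if "a \<le> b" "b \<le> c" "c \<le> n" "a \<in> S" "b \<in> S" "c \<in> S"
      using lt_compat(3)[OF _ *(3,2,4) that(1-3) *(5)[OF that(4)] *(5)[OF that(5)] *(5)[OF that(6)]]
        lt_compat(3)[OF _ *(1,4,2) that(1-3) *(6)[OF that(4)] *(6)[OF that(5)] *(6)[OF that(6)]]
      by (metis linorder_neq_iff)
  qed
  define pick where "pick S = (SOME p. valid S p)" for S
  define F where "F = Labelling (\<lambda>a. vert (P (pick {a})) a) (\<lambda>a b. edge (P (pick {a, b})) a b)
    (\<lambda>a b c. tri (P (pick {a, b, c})) a b c)"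
  have pick: "valid S (pick S)" if "valid S p" for S p
    unfolding pick_def using that by (rule someI)
  have Fv: "vert F a = vert (P p) a" if p: "valid {a} p" "a \<le> n" for a p
    unfolding F_def labelling.sel
    by (rule all_compat(1)[OF pick[OF p(1)] p(1)]) (use that in simp_all)
  have Fe: "edge F a b = edge (P p) a b" if p: "valid {a, b} p" "a \<le> b" "b \<le> n" for a b p
    unfolding F_def labelling.sel
    by (rule all_compat(2)[OF pick[OF p(1)] p(1)]) (use that in simp_all)
  have Ft: "tri F a b c = tri (P p) a b c" if p: "valid {a, b, c} p" "a \<le> b" "b \<le> c" "c \<le> n" for a b c p
    unfolding F_def labelling.sel
    by (rule all_compat(3)[OF pick[OF p(1)] p(1)]) (use that in simp_all)
  have us: "unskip p a \<le> n - 1" if "valid S p" "a \<in> S" "a \<le> n" for S p a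
    using that unskip_le[of a p n] by (auto simp: valid_def)
  have GP: "cocycle (n - 1) (G p)" if "valid S p" for S p
    using that G by (simp add: valid_def)
  have ex: "\<exists>p. valid S p" if "finite S" "card (insert l S) \<le> n" for S
    using ex_avoiding[of "insert l S" n] that by (auto simp: valid_def)
  have card_le: "card (insert l {a}) \<le> n" "card (insert l {a, b}) \<le> n" for a b
    using n card_insert_le_m1 by (simp_all add: card_insert_if)
  have v: "vert F a \<in> Obj C" "edge F a a = ident C (vert F a)" if "a \<le> n" for a
  proof -
    obtain p where p: "valid {a} p" using ex[OF _ card_le(1)[of a]] by auto
    then have p': "valid {a, a} p" by simp
    show "vert F a \<in> Obj C" "edge F a a = ident C (vert F a)"
      unfolding Fv[OF p that] Fe[OF p' order_refl that] P_def pull_simps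
      using cocycleD(1,4)[OF GP[OF p]] us[OF p _ that] by auto
  qed
  have e: "edge F a b \<in> Hom C (vert F b) (vert F a)"
    and t1: "tri F a a b = \<one>\<^bsub>A (vert F a)\<^esub>" "tri F a b b = \<one>\<^bsub>A (vert F b)\<^esub>" if "a \<le> b" "b \<le> n" for a b
  proof -
    obtain p where p: "valid {a, b} p" using ex[OF _ card_le(2)[of a b]] by auto
    then have p': "valid {a} p" "valid {b} p" "valid {a, a, b} p" "valid {a, b, b} p" by (auto simp: valid_def)
    have le: "a \<le> n" using that by simp
    note eqs = Fv[OF p'(1) le] Fv[OF p'(2) that(2)] Fe[OF p that] Ft[OF p'(3) order_refl that] Ft[OF p'(4) that(1) order_refl that(2)]
    show "edge F a b \<in> Hom C (vert F b) (vert F a)" "tri F a a b = \<one>\<^bsub>A (vert F a)\<^esub>"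
      "tri F a b b = \<one>\<^bsub>A (vert F b)\<^esub>"
      unfolding eqs P_def pull_simps
      using cocycleD(2,5,6)[OF GP[OF p], of "unskip p a" "unskip p b"] us[OF p, of b] that unskip_mono[of a b p]
      by auto
  qed
  have t: "triangle F a b c" if p: "valid {a, b, c} p" and "a \<le> b" "b \<le> c" "c \<le> n" for a b c p
  proof -
    have p': "valid {b} p" "valid {a, b} p" "valid {b, c} p" "valid {a, c} p"
      using p by (auto simp: valid_def)
    have le: "b \<le> n" "a \<le> c" using that by auto
    note eqs = Fv[OF p'(1) le(1)] Fe[OF p'(2) that(2) le(1)] Fe[OF p'(3) that(3,4)] Fe[OF p'(4) le(2) that(4)] Ft[OF p that(2-4)]
    show ?thesis
      unfolding eqs P_def pull_simps
      using cocycleD(3,7)[OF GP[OF p], of "unskip p a" "unskip p b" "unskip p c"] us[OF p, of c] that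
        unskip_mono[of a b p] unskip_mono[of b c p]
      by blast
  qed
  have T: "tetrahedron F a b c d" if p: "valid {a, b, c, d} p" and "a \<le> b" "b \<le> c" "c \<le> d" "d \<le> n" for a b c d p
  proof -
    have p': "valid {c} p" "valid {b, c} p" "valid {a, b, d} p" "valid {b, c, d} p" "valid {a, b, c} p" "valid {a, c, d} p"
      using p by (auto simp: valid_def)
    have le: "c \<le> n" "b \<le> d" "a \<le> c" using that by auto
    note eqs = Fv[OF p'(1) le(1)] Fe[OF p'(2) that(3) le(1)] Ft[OF p'(3) that(2) le(2) that(5)]
      Ft[OF p'(4) that(3-5)] Ft[OF p'(5) that(2,3) le(1)] Ft[OF p'(6) le(3) that(4,5)]
    show ?thesis
      unfolding eqs P_def pull_simps
      using us[OF p, of d] that unskip_mono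
      by (intro cocycleD(8)[OF GP[OF p]]) auto
  qed
  have faces: "agree (n - 1) (pull (skip k) F') (G k)"
    if k: "k \<le> n" "k \<noteq> l" and F': "vert F' = vert F" "edge F' = edge F"
      "\<And>a b c. \<lbrakk>valid {a, b, c} k; a \<le> b; b \<le> c; c \<le> n\<rbrakk> \<Longrightarrow> tri F' a b c = tri F a b c" for k F'
  proof -
    have sk: "skip k a \<le> n" "skip k a \<noteq> k" if "a \<le> n - 1" for a
      using that n by (auto simp: skip_def)
    have sm: "skip k a \<le> skip k b" if "a \<le> b" for a b
      using that by (auto simp: skip_def)
    have "vert F (skip k a) = vert (G k) a" if "a \<le> n - 1" for a
      using Fv[of "skip k a" k] k sk[OF that] by (simp add: valid_def P_def unskip_skip)
    moreover have "edge F (skip k a) (skip k b) = edge (G k) a b" if "a \<le> b" "b \<le> n - 1" for a b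
      using Fe[of "skip k a" "skip k b" k] k sk[of a] sk[of b] sm[of a b] that
      by (simp add: valid_def P_def unskip_skip)
    moreover have "tri F' (skip k a) (skip k b) (skip k c) = tri (G k) a b c"
      if "a \<le> b" "b \<le> c" "c \<le> n - 1" for a b c
      using Ft[of "skip k a" "skip k b" "skip k c" k] F'(3)[of "skip k a" "skip k b" "skip k c"] k
        sk[of a] sk[of b] sk[of c] sm[of a b] sm[of b c] that
      by (simp add: valid_def P_def unskip_skip)
    ultimately show ?thesis
      unfolding agree_def pull_simps F' by blast
  qed
  show thesis
  proof (cases "n = 3")
    case True
    have old: "triangle F i j k" if "i < j" "j < k" "k \<le> 3" "l \<in> {i, j, k}" for i j k
    proof -
      have "card (insert l {i, j, k}) \<le> 3" using that by (simp add: insert_absorb card_insert_if)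
      then obtain p where "valid {i, j, k} p" using ex[of "{i, j, k}"] True by auto
      then show ?thesis using t that True by auto
    qed
    obtain F' where F': "vert F' = vert F" "edge F' = edge F"
      "\<And>i j k. \<lbrakk>l \<in> {i, j, k} \<or> i = j \<or> j = k\<rbrakk> \<Longrightarrow> tri F' i j k = tri F i j k"
      "\<And>i j k. \<lbrakk>i < j; j < k; k \<le> 3\<rbrakk> \<Longrightarrow> triangle F' i j k"
      "tetrahedron F' 0 1 2 3"
      by (rule fill_tetrahedron[of l F]) (use l True e old in auto)
    have "cocycle n F'"
    proof (rule cocycleI)
      show "tetrahedron F' i j k m" if "i < j" "j < k" "k < m" "m \<le> n" for i j k m
      proof -
        have "i = 0" "j = 1" "k = 2" "m = 3" using that True by auto
        then show ?thesis using F'(5) by simp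
      qed
    qed (use F' True v e t1 in auto)
    moreover have "agree (n - 1) (pull (skip k) F') (G k)" if "k \<le> n" "k \<noteq> l" for k
    proof (rule faces[OF that F'(1,2)])
      fix a b c assume a: "valid {a, b, c} k" "a \<le> b" "b \<le> c" "c \<le> n"
      have "l \<in> {a, b, c} \<or> a = b \<or> b = c"
      proof (rule ccontr)
        assume "\<not> ?thesis"
        then have "card {k, l, a, b, c} = 5" using a that by (auto simp: valid_def)
        moreover have "card {k, l, a, b, c} \<le> card {..3::nat}"
          using a that l True by (intro card_mono) auto
        ultimately show False by simp
      qed
      then show "tri F' a b c = tri F a b c" by (rule F'(3))
    qed
    ultimately show ?thesis using that by blast
  next
    case False
    then have n4: "4 \<le> n" using n by simp
    have tt: "triangle F i j k" if "i < j" "j < k" "k \<le> n" for i j k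
    proof -
      have "card (insert l {i, j, k}) \<le> n" using n4 by (simp add: card_insert_if)
      then obtain p where "valid {i, j, k} p" using ex[of "{i, j, k}"] by auto
      then show ?thesis using t that by auto
    qed
    have "tetrahedron F i j k m" if ijkm: "i < j" "j < k" "k < m" "m \<le> n" for i j k m
    proof (cases "\<exists>p. valid {i, j, k, m} p")
      case True
      then show ?thesis using T that by auto
    next
      case False
      then have c: "\<not> card (insert l {i, j, k, m}) \<le> n" using ex[of "{i, j, k, m}"] by auto
      \<comment> \<open>Now \<open>l\<close> and the four vertices are all five vertices of a 4-simplex.\<close>
      then have n: "n = 4" and lS: "l \<notin> {i, j, k, m}"
        using n4 ijkm by (auto simp: card_insert_if split: if_splits)
      have T': "tetrahedron F a b c d"
        if "{a, b, c, d} = {..4} - {p}" "p \<le> 4" "p \<noteq> l" "a < b" "b < c" "c < d" for a b c d p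
      proof (rule T[of a b c d p])
        show "valid {a, b, c, d} p" using that n by (simp add: valid_def)
        show "d \<le> n" using that(1) n by blast
      qed (use that in auto)
      have S: "{0, 1, 2, 3} = {..4} - {4::nat}" "{0, 1, 2, 4} = {..4} - {3::nat}"
        "{0, 1, 3, 4} = {..4} - {2::nat}" "{0, 2, 3, 4} = {..4} - {1::nat}" "{1, 2, 3, 4} = {..4} - {0::nat}"
        by auto
      have E: "edge F 1 2 \<in> Hom C (vert F 2) (vert F 1)" "edge F 2 3 \<in> Hom C (vert F 3) (vert F 2)"
        using e n by auto
      have "triangle F 1 2 3" by (rule tt) (use n in auto)
      note pent = pentagon[OF E this, of 0 4]
      have A: "tri F 0 1 2 \<in> carrier (A (vert F 1))" "tri F 0 1 3 \<in> carrier (A (vert F 1))"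
        "tri F 0 1 4 \<in> carrier (A (vert F 1))" "tri F 0 2 3 \<in> carrier (A (vert F 2))"
        "tri F 0 2 4 \<in> carrier (A (vert F 2))" "tri F 1 2 4 \<in> carrier (A (vert F 2))"
        "tri F 0 3 4 \<in> carrier (A (vert F 3))" "tri F 1 3 4 \<in> carrier (A (vert F 3))"
        "tri F 2 3 4 \<in> carrier (A (vert F 3))"
        by (rule tt[THEN conjunct1]; use n in simp)+
      note pent = pent[OF A]
      have "l \<le> 4" using l n by simp
      then consider "l = 0" "i = 1" "j = 2" "k = 3" "m = 4" | "l = 1" "i = 0" "j = 2" "k = 3" "m = 4"
        | "l = 2" "i = 0" "j = 1" "k = 3" "m = 4" | "l = 3" "i = 0" "j = 1" "k = 2" "m = 4"
        | "l = 4" "i = 0" "j = 1" "k = 2" "m = 3"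
        using ijkm lS n by force
      then show ?thesis
      proof cases
        case 1
        show ?thesis unfolding 1 by (rule pent(5); rule T'[OF S(1)] T'[OF S(2)] T'[OF S(3)] T'[OF S(4)]; simp add: 1)
      next
        case 2
        show ?thesis unfolding 2 by (rule pent(4); rule T'[OF S(1)] T'[OF S(2)] T'[OF S(3)] T'[OF S(5)]; simp add: 2)
      next
        case 3
        show ?thesis unfolding 3 by (rule pent(3); rule T'[OF S(1)] T'[OF S(2)] T'[OF S(4)] T'[OF S(5)]; simp add: 3)
      next
        case 4
        show ?thesis unfolding 4 by (rule pent(2); rule T'[OF S(1)] T'[OF S(3)] T'[OF S(4)] T'[OF S(5)]; simp add: 4)
      next
        case 5
        show ?thesis unfolding 5 by (rule pent(1); rule T'[OF S(2)] T'[OF S(3)] T'[OF S(4)] T'[OF S(5)]; simp add: 5)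
      qed
    qed
    then have "cocycle n F"
      using v e t1 tt by (intro cocycleI) auto
    moreover have "agree (n - 1) (pull (skip k) F) (G k)" if "k \<le> n" "k \<noteq> l" for k
      by (rule faces[OF that]) auto
    ultimately show ?thesis using that by blast
  qed
qed

end

section \<open>The Kan condition\<close>

lemma (in simplicial_set) horn_map_in_horn:
  assumes "1 \<le> n" "l \<le> n" "y \<in> simplices X n"
  shows "horn_map X n l y \<in> horn X n l"
proof -
  obtain m where n: "n = Suc m" using assms(1) by (cases n) auto
  have "face X m j (face X n k y) = face X m (k - 1) (face X n j y)"
    if "j < k" "k \<le> n" "j \<noteq> l" "k \<noteq> l" for j k
  proof (cases m)
    case 0
    then show ?thesis using that assms(2) n by auto
  next
    case (Suc m')
    then show ?thesis using face_face[of j k m' y] that assms(3) n by simp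
  qed
  then show ?thesis
    using face_closed[of _ m y] assms n by (auto simp: horn_def horn_map_def)
qed

context crossed_module
begin

lemma matrix_of_1: "matrix_of 1 F = mk_matrix 1 (\<lambda>_. edge F 0 1) (\<lambda>_ _. undefined)"
  by (auto simp: matrix_of_def intro!: mk_matrix_eqI dest: le_antisym)

lemma ex_cocycle_2:
  assumes f: "f \<in> Hom C x1 x0" and g: "g \<in> Hom C x2 x1" and a: "a \<in> carrier (A x1)"
  obtains F where "cocycle 2 F" "edge F 0 1 = f" "edge F 1 2 = g" "tri F 0 1 2 = a"
    "edge F 0 2 = f \<cdot> bd x1 a \<cdot> g"
proof -
  note obj = Hom_Obj[OF f] Hom_Obj[OF g]
  have one: "\<one>\<^bsub>A x1\<^esub> \<in> carrier (A x1)" "\<one>\<^bsub>A x2\<^esub> \<in> carrier (A x2)"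
    using obj monoid_A monoid.one_closed by blast+
  let ?x = "(\<lambda>_. x2)(0 := x0, 1 := x1)"
  obtain F where F: "cocycle 2 F" "\<And>i. i \<le> 2 \<Longrightarrow> vert F i = ?x i"
    "\<And>i. i < 2 \<Longrightarrow> edge F i (Suc i) = (if i = 0 then f else g)"
    "\<And>i k. \<lbrakk>i < k; k \<le> 2\<rbrakk> \<Longrightarrow> tri F i (Suc i) k = (if i = 0 \<and> k = 2 then a else \<one>\<^bsub>A (?x (Suc i))\<^esub>)"
    by (rule cocycle_with_spine[of 2 ?x "\<lambda>i. if i = 0 then f else g"
          "\<lambda>i k. if i = 0 \<and> k = 2 then a else \<one>\<^bsub>A (?x (Suc i))\<^esub>"])
      (use f g a obj one in \<open>auto simp: less_Suc_eq numeral_2_eq_2\<close>)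
  show thesis
  proof (rule that[OF F(1)])
    show "edge F 0 1 = f" "edge F 1 2 = g" "tri F 0 1 2 = a"
      using F(3)[of 0] F(3)[of 1] F(4)[of 0 2] by (simp_all add: numeral_2_eq_2)
    then show "edge F 0 2 = f \<cdot> bd x1 a \<cdot> g"
      using cocycleD(7)[OF F(1), of 0 1 2] F(2)[of 1] by simp
  qed
qed

lemma horn_1_filler:
  assumes "M \<in> nerve_simplices C A 0"
  obtains F where "cocycle 1 F" "\<And>k. k \<le> 1 \<Longrightarrow> matrix_of 0 (pull (skip k) F) = M"
proof -
  obtain t where t: "t \<in> Obj C" "M = Vertex t"
    using assms by (auto simp: nerve_simplices_def)
  show thesis
    by (rule that[OF cocycle_const[OF t(1)]]) (simp add: matrix_of_def t(2))
qed

lemma ex_divide_left: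
  assumes "f \<in> Hom C s t" "h \<in> Hom C r t"
  obtains g where "g \<in> Hom C r s" "f \<cdot> g = h"
proof -
  obtain f' where f': "f' \<in> Hom C t s" "f \<cdot> f' = ident C t"
    using arr_invertible[OF assms(1)] by blast
  have "f \<cdot> f' \<cdot> h = h"
    using comp_assoc[OF assms(1) f'(1) assms(2)] comp_ident_left[OF assms(2)] f'(2) by simp
  then show thesis using that comp_Hom[OF f'(1) assms(2)] by blast
qed

lemma ex_divide_right:
  assumes "g \<in> Hom C r s" "h \<in> Hom C r t"
  obtains f where "f \<in> Hom C s t" "f \<cdot> g = h"
proof -
  obtain g' where g': "g' \<in> Hom C s r" "g' \<cdot> g = ident C r"
    using arr_invertible[OF assms(1)] by blast
  have "(h \<cdot> g') \<cdot> g = h"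
    using comp_assoc[OF assms(2) g'(1) assms(1)] comp_ident_right[OF assms(2)] g'(2) by simp
  then show thesis using that comp_Hom[OF assms(2) g'(1)] by blast
qed

lemma horn_2_filler:
  assumes l: "l \<le> 2" and G: "\<And>k. \<lbrakk>k \<le> 2; k \<noteq> l\<rbrakk> \<Longrightarrow> cocycle 1 (G k)"
    and compat: "\<And>j k. \<lbrakk>j < k; k \<le> 2; j \<noteq> l; k \<noteq> l\<rbrakk> \<Longrightarrow>
      agree 0 (pull (skip j) (G k)) (pull (skip (k - 1)) (G j))"
  obtains F where "cocycle 2 F" "\<And>k. \<lbrakk>k \<le> 2; k \<noteq> l\<rbrakk> \<Longrightarrow> matrix_of 1 (pull (skip k) F) = matrix_of 1 (G k)"
proof -
  define e where "e k = edge (G k) 0 1" for k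
  have e: "e k \<in> Hom C (vert (G k) 1) (vert (G k) 0)" if "k \<le> 2" "k \<noteq> l" for k
    unfolding e_def using cocycleD(2)[OF G[OF that], of 0 1] by simp
  have v: "vert (G k) (skip j 0) = vert (G j) (skip (k - 1) 0)" if "j < k" "k \<le> 2" "j \<noteq> l" "k \<noteq> l" for j k
    using agreeD(1)[OF compat[OF that], of 0] by simp
  have "\<exists>f g x0 x1 x2. f \<in> Hom C x1 x0 \<and> g \<in> Hom C x2 x1 \<and>
      (l \<noteq> 0 \<longrightarrow> g = e 0) \<and> (l \<noteq> 1 \<longrightarrow> f \<cdot> g = e 1) \<and> (l \<noteq> 2 \<longrightarrow> f = e 2)"
  proof -
    consider "l = 0" | "l = 1" | "l = 2" using l by linarith
    then show ?thesis
    proof cases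
      case 1
      then have "e 2 \<in> Hom C (vert (G 2) 1) (vert (G 1) 0)" "e 1 \<in> Hom C (vert (G 1) 1) (vert (G 1) 0)"
        using e[of 1] e[of 2] v[of 1 2] by (simp_all add: skip_def)
      with ex_divide_left[OF this] 1 show ?thesis by (metis zero_neq_one)
    next
      case 2
      then have "e 2 \<in> Hom C (vert (G 0) 0) (vert (G 2) 0)" "e 0 \<in> Hom C (vert (G 0) 1) (vert (G 0) 0)"
        using e[of 0] e[of 2] v[of 0 2] by (simp_all add: skip_def)
      with 2 show ?thesis by blast
    next
      case 3
      then have "e 0 \<in> Hom C (vert (G 0) 1) (vert (G 0) 0)" "e 1 \<in> Hom C (vert (G 0) 1) (vert (G 1) 0)"
        using e[of 0] e[of 1] v[of 0 1] by (simp_all add: skip_def)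
      with ex_divide_right[OF this] 3 show ?thesis by metis
    qed
  qed
  then obtain f g x0 x1 x2 where fg: "f \<in> Hom C x1 x0" "g \<in> Hom C x2 x1"
    "l \<noteq> 0 \<longrightarrow> g = e 0" "l \<noteq> 1 \<longrightarrow> f \<cdot> g = e 1" "l \<noteq> 2 \<longrightarrow> f = e 2"
    by blast
  have x1: "x1 \<in> Obj C" using fg Hom_Obj by blast
  obtain F where F: "cocycle 2 F" "edge F 0 1 = f" "edge F 1 2 = g"
    "edge F 0 2 = f \<cdot> bd x1 \<one>\<^bsub>A x1\<^esub> \<cdot> g"
    by (rule ex_cocycle_2[OF fg(1,2) monoid.one_closed[OF monoid_A[OF x1]]])
  have F02: "edge F 0 2 = f \<cdot> g"
    using F(4) bd_one[OF x1] comp_ident_left[OF fg(2)] by simp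
  show thesis
  proof (rule that[OF F(1)])
    fix k assume k: "k \<le> 2" "k \<noteq> l"
    consider "k = 0" | "k = 1" | "k = 2" using k by linarith
    then have "edge F (skip k 0) (skip k 1) = e k"
      using k fg F F02 by cases (auto simp: skip_def numeral_2_eq_2)
    then show "matrix_of 1 (pull (skip k) F) = matrix_of 1 (G k)"
      by (simp only: matrix_of_1 pull_simps e_def)
  qed
qed

lemma horn_filler:
  assumes n: "1 \<le> n" and l: "l \<le> n" and x: "x \<in> horn \<N> n l"
  shows "x \<in> horn_map \<N> n l ` simplices \<N> n"
proof -
  have xk: "x k \<in> nerve_simplices C A (n - 1)" if "k \<le> n" "k \<noteq> l" for k
    using x that by (auto simp: horn_def)
  have "\<forall>k. \<exists>F. k \<le> n \<longrightarrow> k \<noteq> l \<longrightarrow> cocycle (n - 1) F \<and> matrix_of (n - 1) F = x k"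
    using xk nerve_simplex_matrix_of by metis
  then obtain G where G: "\<And>k. \<lbrakk>k \<le> n; k \<noteq> l\<rbrakk> \<Longrightarrow> cocycle (n - 1) (G k)"
    "\<And>k. \<lbrakk>k \<le> n; k \<noteq> l\<rbrakk> \<Longrightarrow> matrix_of (n - 1) (G k) = x k"
    by metis
  have compat: "agree (n - 2) (pull (skip j) (G k)) (pull (skip (k - 1)) (G j))"
    if "2 \<le> n" and jk: "j < k" "k \<le> n" "j \<noteq> l" "k \<noteq> l" for j k
  proof (rule matrix_of_eq_imp_agree)
    obtain m where m: "n = Suc (Suc m)" using \<open>2 \<le> n\<close> by (metis add_2_eq_Suc le_Suc_ex)
    have c: "cocycle (Suc m) (G k)" "cocycle (Suc m) (G j)" using G(1)[of j] G(1)[of k] jk m by auto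
    then show "cocycle (n - 2) (pull (skip j) (G k))" "cocycle (n - 2) (pull (skip (k - 1)) (G j))"
      using cocycle_face[of m "G k" j] cocycle_face[of m "G j" "k - 1"] jk m by auto
    have "nerve_face C A act bd (Suc m) j (x k) = nerve_face C A act bd (Suc m) (k - 1) (x j)"
      using x jk m by (auto simp: horn_def)
    then show "matrix_of (n - 2) (pull (skip j) (G k)) = matrix_of (n - 2) (pull (skip (k - 1)) (G j))"
      using nerve_face_matrix_of[OF c(1), of j] nerve_face_matrix_of[OF c(2), of "k - 1"]
        G(2)[of j] G(2)[of k] jk m by simp
  qed
  obtain F where F: "cocycle n F"
    "\<And>k. \<lbrakk>k \<le> n; k \<noteq> l\<rbrakk> \<Longrightarrow> matrix_of (n - 1) (pull (skip k) F) = x k"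
  proof -
    consider "n = 1" | "n = 2" | "3 \<le> n" using n by linarith
    then show thesis
    proof cases
      case 1
      have "x (1 - l) \<in> nerve_simplices C A 0"
        using xk[of "1 - l"] l 1 by (cases l) auto
      then obtain F where "cocycle 1 F" "\<And>k. k \<le> 1 \<Longrightarrow> matrix_of 0 (pull (skip k) F) = x (1 - l)"
        by (rule horn_1_filler) blast
      moreover have "k = 1 - l" if "k \<le> 1" "k \<noteq> l" for k using that l 1 by auto
      ultimately show ?thesis using that 1 by auto
    next
      case 2
      then obtain F where "cocycle 2 F" "\<And>k. \<lbrakk>k \<le> 2; k \<noteq> l\<rbrakk> \<Longrightarrow> matrix_of 1 (pull (skip k) F) = matrix_of 1 (G k)"
        using horn_2_filler[of l G] l G(1) compat by auto
      then show ?thesis using that G(2) 2 by simp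
    next
      case 3
      then obtain F where "cocycle n F" "\<And>k. \<lbrakk>k \<le> n; k \<noteq> l\<rbrakk> \<Longrightarrow> agree (n - 1) (pull (skip k) F) (G k)"
        using fill_labelled_horn[OF 3 l, of G] G(1) compat by auto
      then show ?thesis using that G(2) matrix_of_agree by metis
    qed
  qed
  obtain m where m: "n = Suc m" using n by (cases n) auto
  have "horn_map \<N> n l (matrix_of n F) = x"
  proof
    fix k
    show "horn_map \<N> n l (matrix_of n F) k = x k"
    proof (cases "k \<le> n \<and> k \<noteq> l")
      case True
      then show ?thesis
        using F nerve_face_matrix_of[of m F k] m by (simp add: horn_map_def)
    next
      case False
      then show ?thesis
        using x by (auto simp: horn_map_def horn_def PiE_def extensional_def)
    qed
  qed
  then show ?thesis
    using matrix_of_closed[OF F(1)] by (metis image_eqI nerve_simps(1))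
qed

theorem kan_complex_nerve: "kan_complex \<N>"
proof (intro kan_complex.intro kan_complex_axioms.intro simplicial_set_nerve)
  fix n l :: nat assume "1 \<le> n" "l \<le> n"
  then show "horn_map \<N> n l ` simplices \<N> n = horn \<N> n l"
    using horn_filler simplicial_set.horn_map_in_horn[OF simplicial_set_nerve] by auto
qed

section \<open>Homotopy groups\<close>

lemma group_End:
  assumes "t \<in> Obj C"
  shows "group (End C t)"
proof (rule groupI)
  fix x assume "x \<in> carrier (End C t)"
  then show "\<exists>y\<in>carrier (End C t). y \<otimes>\<^bsub>End C t\<^esub> x = \<one>\<^bsub>End C t\<^esub>"
    using arr_invertible[of x t t] by (auto simp: End_def)
qed (use assms in \<open>auto simp: End_def intro: comp_Hom ident_Hom comp_assoc comp_ident_left\<close>)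

lemma group_hom_bd:
  assumes "t \<in> Obj C"
  shows "group_hom (A t) (End C t) (bd t)"
  using assms group_A group_End bd_hom by (simp add: group_hom_def group_hom_axioms_def)

text \<open>Conjugating \<open>\<partial>(a)\<close> with \<open>x\<close> gives \<open>\<partial>(a\<^sup>y)\<close> for the inverse \<open>y\<close> of \<open>x\<close>.\<close>

lemma normal_image_bd:
  assumes t: "t \<in> Obj C"
  shows "bd t ` carrier (A t) \<lhd> End C t"
proof -
  interpret E: group "End C t" by (rule group_End[OF t])
  interpret group_hom "A t" "End C t" "bd t" by (rule group_hom_bd[OF t])
  have "x \<otimes>\<^bsub>End C t\<^esub> bd t a \<otimes>\<^bsub>End C t\<^esub> inv\<^bsub>End C t\<^esub> x \<in> bd t ` carrier (A t)"
    if x: "x \<in> carrier (End C t)" and a: "a \<in> carrier (A t)" for x a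
  proof -
    let ?y = "inv\<^bsub>End C t\<^esub> x"
    have y: "?y \<in> Hom C t t" using E.inv_closed[OF x] by (simp add: End_def)
    let ?b = "act ?y a"
    have b: "?b \<in> carrier (A t)" using act_closed[OF y a] .
    have "?y \<otimes>\<^bsub>End C t\<^esub> bd t ?b = bd t a \<otimes>\<^bsub>End C t\<^esub> ?y"
      using bd_act[OF y a] by (simp add: End_def)
    then have "x \<otimes>\<^bsub>End C t\<^esub> (?y \<otimes>\<^bsub>End C t\<^esub> bd t ?b) = x \<otimes>\<^bsub>End C t\<^esub> (bd t a \<otimes>\<^bsub>End C t\<^esub> ?y)" by simp
    then have "bd t ?b = x \<otimes>\<^bsub>End C t\<^esub> bd t a \<otimes>\<^bsub>End C t\<^esub> ?y"
      using x a b by (simp add: E.m_assoc)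
    then show ?thesis using b by (metis image_eqI)
  qed
  then show ?thesis
    using E.normal_inv_iff img_is_subgroup by auto
qed

end

text \<open>The group axioms of \<open>H\<close> are a conclusion here: the homotopy groups are merely sets with a
  multiplication until they have been compared with a known group.\<close>

lemma group_transfer:
  assumes Q: "group Q" and g: "bij_betw g (carrier Q) (carrier H)"
    and mult: "\<And>x y. \<lbrakk>x \<in> carrier Q; y \<in> carrier Q\<rbrakk> \<Longrightarrow> g x \<otimes>\<^bsub>H\<^esub> g y = g (x \<otimes>\<^bsub>Q\<^esub> y)"
    and one: "\<one>\<^bsub>H\<^esub> = g \<one>\<^bsub>Q\<^esub>"
  shows "group H" "H \<cong> Q"
proof -
  interpret Q: group Q by (rule Q)
  have H: "carrier H = g ` carrier Q" using g by (simp add: bij_betw_def)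
  show "group H"
  proof (rule groupI)
    fix x assume "x \<in> carrier H"
    then obtain a where "a \<in> carrier Q" "x = g a" using H by auto
    then show "\<exists>y\<in>carrier H. y \<otimes>\<^bsub>H\<^esub> x = \<one>\<^bsub>H\<^esub>"
      using H by (intro bexI[of _ "g (inv\<^bsub>Q\<^esub> a)"]) (auto simp: mult one)
  qed (auto simp: H mult one Q.m_assoc)
  then have "g \<in> iso Q H"
    using g mult H by (auto simp: iso_def hom_def)
  then show "H \<cong> Q"
    using group.iso_sym[OF Q] by (auto simp: is_iso_def)
qed

lemma opposite_group_transfer:
  assumes Q: "group Q" and g: "bij_betw g (carrier Q) (carrier H)"
    and mult: "\<And>x y. \<lbrakk>x \<in> carrier Q; y \<in> carrier Q\<rbrakk> \<Longrightarrow> g x \<otimes>\<^bsub>H\<^esub> g y = g (y \<otimes>\<^bsub>Q\<^esub> x)"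
    and one: "\<one>\<^bsub>H\<^esub> = g \<one>\<^bsub>Q\<^esub>"
  shows "group H" "H \<cong> Q"
proof -
  interpret Q: group Q by (rule Q)
  have inv: "bij_betw (\<lambda>x. inv\<^bsub>Q\<^esub> x) (carrier Q) (carrier Q)"
    by (rule bij_betwI[of _ _ _ "\<lambda>x. inv\<^bsub>Q\<^esub> x"]) auto
  have "bij_betw (\<lambda>x. g (inv\<^bsub>Q\<^esub> x)) (carrier Q) (carrier H)"
    using bij_betw_trans[OF inv g] by (simp add: o_def)
  then show "group H" "H \<cong> Q"
    using group_transfer[OF Q, of "\<lambda>x. g (inv\<^bsub>Q\<^esub> x)" H] by (simp_all add: mult one Q.inv_mult_group)
qed

context crossed_module
begin

lemma degen_vertex_nerve:
  assumes "t \<in> Obj C"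
  shows "degen_vertex \<N> (Vertex t) n = matrix_of n (const_labelling t)"
proof (induction n)
  case 0
  then show ?case by (simp add: matrix_of_def)
next
  case (Suc n)
  then show ?case using nerve_degen_matrix_of[OF cocycle_const[OF assms], of 0 n] by simp
qed

definition loop :: "'b \<Rightarrow> ('a, 'b, 'c) nerve_simplex" where
  "loop \<alpha> = mk_matrix 1 (\<lambda>_. \<alpha>) (\<lambda>_ _. undefined)"

lemma loop_eq_iff [simp]: "loop \<alpha> = loop \<beta> \<longleftrightarrow> \<alpha> = \<beta>"
  by (auto simp: loop_def mk_matrix_eq_iff)

lemma inj_loop: "inj loop"
  by (rule injI) simp

lemma matrix_of_1_loop: "matrix_of 1 F = loop (edge F 0 1)"
  unfolding loop_def by (rule matrix_of_1)

lemma const_1_loop: "matrix_of 1 (const_labelling t) = loop (ident C t)"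
  unfolding matrix_of_1_loop by simp

lemma faces_2:
  assumes "cocycle 2 F"
  shows "nerve_face C A act bd 2 0 (matrix_of 2 F) = loop (edge F 1 2)"
    and "nerve_face C A act bd 2 1 (matrix_of 2 F) = loop (edge F 0 2)"
    and "nerve_face C A act bd 2 2 (matrix_of 2 F) = loop (edge F 0 1)"
  using nerve_face_matrix_of[of 1 F 0] nerve_face_matrix_of[of 1 F 1] nerve_face_matrix_of[of 1 F 2] assms
    matrix_of_1_loop[of "pull (skip 0) F"] matrix_of_1_loop[of "pull (skip 1) F"] matrix_of_1_loop[of "pull (skip 2) F"]
  by (simp_all add: numeral_2_eq_2 skip_def)

lemma spheres_1:
  assumes t: "t \<in> Obj C"
  shows "spheres \<N> (Vertex t) 1 = loop ` Hom C t t"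
proof (intro equalityI subsetI)
  fix y assume y: "y \<in> spheres \<N> (Vertex t) 1"
  then obtain F where F: "cocycle 1 F" "matrix_of 1 F = y"
    using nerve_simplex_matrix_of[of y 1] by (auto simp: spheres_def)
  have "vert F (skip j 0) = t" if "j \<le> 1" for j
    using y nerve_face_matrix_of[of 0 F j] F that by (auto simp: spheres_def matrix_of_def)
  from this[of 0] this[of 1] have "edge F 0 1 \<in> Hom C t t"
    using cocycleD(2)[OF F(1), of 0 1] by (simp add: skip_def)
  then show "y \<in> loop ` Hom C t t"
    using F(2) matrix_of_1_loop by blast
next
  fix y assume "y \<in> loop ` Hom C t t"
  then obtain \<alpha> where \<alpha>: "\<alpha> \<in> Hom C t t" "y = loop \<alpha>" by blast
  then have "y \<in> nerve_simplices C A 1"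
    using t by (auto simp: loop_def mk_matrix_def nerve_simplices_def above_diag_def)
  moreover have "nerve_face C A act bd 1 j y = Vertex t" for j
    using \<alpha> by (auto simp: loop_def mk_matrix_def Hom_def)
  ultimately show "y \<in> spheres \<N> (Vertex t) 1"
    by (simp add: spheres_def)
qed

text \<open>Both the homotopy relation on 1-spheres (\<open>\<alpha>\<close> an identity) and their product are instances of this description
  of triangles with prescribed outer faces.\<close>

lemma triangle_faces_iff:
  assumes "\<alpha> \<in> Hom C t t" "\<beta> \<in> Hom C t t"
  shows "(\<exists>w\<in>nerve_simplices C A 2. nerve_face C A act bd 2 0 w = loop \<alpha> \<and>
      nerve_face C A act bd 2 1 w = y \<and> nerve_face C A act bd 2 2 w = loop \<beta>) \<longleftrightarrow>
    (\<exists>a\<in>carrier (A t). y = loop (\<beta> \<cdot> bd t a \<cdot> \<alpha>))"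
proof
  assume "\<exists>w\<in>nerve_simplices C A 2. nerve_face C A act bd 2 0 w = loop \<alpha> \<and>
      nerve_face C A act bd 2 1 w = y \<and> nerve_face C A act bd 2 2 w = loop \<beta>"
  then obtain F where F: "cocycle 2 F" "edge F 1 2 = \<alpha>" "edge F 0 1 = \<beta>" "y = loop (edge F 0 2)"
    using nerve_simplex_matrix_of faces_2 by (metis loop_eq_iff)
  have "vert F 1 = t"
    using cocycleD(2)[OF F(1), of 0 1] F(3) assms(2) by (auto simp: Hom_def)
  then show "\<exists>a\<in>carrier (A t). y = loop (\<beta> \<cdot> bd t a \<cdot> \<alpha>)"
    using F cocycleD(3,7)[OF F(1), of 0 1 2] by auto
next
  assume "\<exists>a\<in>carrier (A t). y = loop (\<beta> \<cdot> bd t a \<cdot> \<alpha>)"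
  then obtain a where a: "a \<in> carrier (A t)" "y = loop (\<beta> \<cdot> bd t a \<cdot> \<alpha>)" by blast
  obtain F where "cocycle 2 F" "edge F 0 1 = \<beta>" "edge F 1 2 = \<alpha>" "edge F 0 2 = \<beta> \<cdot> bd t a \<cdot> \<alpha>"
    using ex_cocycle_2[OF assms(2,1) a(1)] by metis
  then show "\<exists>w\<in>nerve_simplices C A 2. nerve_face C A act bd 2 0 w = loop \<alpha> \<and>
      nerve_face C A act bd 2 1 w = y \<and> nerve_face C A act bd 2 2 w = loop \<beta>"
    using faces_2 matrix_of_closed a(2) by (intro bexI[of _ "matrix_of 2 F"]) auto
qed

text \<open>The class of a loop \<open>\<alpha>\<close> is its coset.  The middle face of a triangle with outer faces \<open>\<alpha>\<close> and \<open>\<beta>\<close> is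
  \<open>\<beta> \<partial>(a) \<alpha>\<close>, so cosets multiply in the opposite order, and the union that defines the product in
  the homotopy group is a union of copies of one coset.\<close>

theorem pi_1:
  fixes t
  assumes t: "t \<in> Obj C"
  defines "Q \<equiv> End C t Mod (bd t ` carrier (A t))"
  shows "group (homotopy_group 1 \<N> (Vertex t))" "homotopy_group 1 \<N> (Vertex t) \<cong> Q"
proof -
  let ?E = "End C t" and ?K = "bd t ` carrier (A t)" and ?R = "sphere_rel \<N> (Vertex t) 1"
  interpret normal ?K ?E by (rule normal_image_bd[OF t])
  have E: "carrier ?E = Hom C t t" "\<alpha> \<otimes>\<^bsub>?E\<^esub> \<beta> = \<alpha> \<cdot> \<beta>" "\<one>\<^bsub>?E\<^esub> = ident C t" for \<alpha> \<beta>
    by (simp_all add: End_def)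
  have id: "ident C t \<in> Hom C t t" by (rule ident_Hom[OF t])
  have rel: "?R = {(loop \<alpha>, loop \<beta>) |\<alpha> \<beta>. \<alpha> \<in> Hom C t t \<and> \<beta> \<in> Hom C t t \<and> (\<exists>a\<in>carrier (A t). \<alpha> = \<beta> \<cdot> bd t a)}"
  proof -
    have key: "(\<exists>w\<in>nerve_simplices C A 2. nerve_face C A act bd 2 0 w = loop (ident C t) \<and>
        nerve_face C A act bd 2 1 w = loop \<alpha> \<and> nerve_face C A act bd 2 2 w = loop \<beta>)
        \<longleftrightarrow> (\<exists>a\<in>carrier (A t). \<alpha> = \<beta> \<cdot> bd t a)" if "\<beta> \<in> Hom C t t" for \<alpha> \<beta>
      using triangle_faces_iff[OF id that, of "loop \<alpha>"] comp_ident_right[OF bd_closed[OF t]] by simp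
    have "?R = {(loop \<alpha>, loop \<beta>) |\<alpha> \<beta>. \<alpha> \<in> Hom C t t \<and> \<beta> \<in> Hom C t t \<and>
        (\<exists>w\<in>nerve_simplices C A 2. nerve_face C A act bd 2 0 w = loop (ident C t) \<and>
          nerve_face C A act bd 2 1 w = loop \<alpha> \<and> nerve_face C A act bd 2 2 w = loop \<beta>)}"
      unfolding sphere_rel_def spheres_1[OF t] degen_vertex_nerve[OF t] const_1_loop one_add_one nerve_simps
      by (auto simp del: One_nat_def)
    then show ?thesis using key by (simp cong: conj_cong del: One_nat_def)
  qed
  have coset: "?R `` {loop \<alpha>} = loop ` (?K #>\<^bsub>?E\<^esub> \<alpha>)" if \<alpha>: "\<alpha> \<in> Hom C t t" for \<alpha>
  proof -
    have "(\<exists>a\<in>carrier (A t). \<alpha> = \<beta> \<cdot> bd t a) \<longleftrightarrow> \<beta> \<in> ?K #>\<^bsub>?E\<^esub> \<alpha>" if \<beta>: "\<beta> \<in> Hom C t t" for \<beta>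
    proof -
      have "(\<exists>a\<in>carrier (A t). \<alpha> = \<beta> \<cdot> bd t a) \<longleftrightarrow> \<alpha> \<in> \<beta> <#\<^bsub>?E\<^esub> ?K"
        by (auto simp: l_coset_def E)
      also have "\<dots> \<longleftrightarrow> \<alpha> \<in> ?K #>\<^bsub>?E\<^esub> \<beta>"
        using coset_eq \<beta> E(1) by simp
      also have "\<dots> \<longleftrightarrow> \<beta> \<in> ?K #>\<^bsub>?E\<^esub> \<alpha>"
        using repr_independence[OF _ _ subgroup_axioms] rcos_self[OF _ subgroup_axioms] \<alpha> \<beta> E(1) by metis
      finally show ?thesis .
    qed
    moreover have "?K #>\<^bsub>?E\<^esub> \<alpha> \<subseteq> Hom C t t"
      using r_coset_subset_G[OF subset] \<alpha> E(1) by simp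
    ultimately have "?K #>\<^bsub>?E\<^esub> \<alpha> = {\<beta> \<in> Hom C t t. \<exists>a\<in>carrier (A t). \<alpha> = \<beta> \<cdot> bd t a}"
      by blast
    moreover have "?R `` {loop \<alpha>} = loop ` {\<beta> \<in> Hom C t t. \<exists>a\<in>carrier (A t). \<alpha> = \<beta> \<cdot> bd t a}"
      unfolding rel using \<alpha> by (auto intro!: imageI)
    ultimately show ?thesis by simp
  qed
  have fillers: "(\<lambda>w. nerve_face C A act bd 2 1 w) ` mult_fillers \<N> (Vertex t) 1 (loop \<alpha>) (loop \<beta>)
      = {loop (\<beta> \<cdot> bd t a \<cdot> \<alpha>) |a. a \<in> carrier (A t)}" if "\<alpha> \<in> Hom C t t" "\<beta> \<in> Hom C t t" for \<alpha> \<beta>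
  proof -
    have "y \<in> (\<lambda>w. nerve_face C A act bd 2 1 w) ` mult_fillers \<N> (Vertex t) 1 (loop \<alpha>) (loop \<beta>)
      \<longleftrightarrow> (\<exists>w\<in>nerve_simplices C A 2. nerve_face C A act bd 2 0 w = loop \<alpha> \<and>
      nerve_face C A act bd 2 1 w = y \<and> nerve_face C A act bd 2 2 w = loop \<beta>)" for y
      by (auto simp: mult_fillers_def numeral_2_eq_2)
    then show ?thesis
      unfolding triangle_faces_iff[OF that] by blast
  qed
  have Q: "carrier Q = rcosets\<^bsub>?E\<^esub> ?K" "X \<otimes>\<^bsub>Q\<^esub> Y = X <#>\<^bsub>?E\<^esub> Y" "\<one>\<^bsub>Q\<^esub> = ?K" for X Y
    by (simp_all add: Q_def FactGroup_def)
  let ?H = "homotopy_group 1 \<N> (Vertex t)"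
  have car: "carrier ?H = (\<lambda>X. loop ` X) ` carrier Q"
    using coset by (auto simp: homotopy_group_def spheres_1[OF t] quotient_def Q RCOSETS_def E simp del: One_nat_def)
  have inj: "inj_on (\<lambda>X. loop ` X) (carrier Q)"
    by (rule inj_onI) (simp add: inj_image_eq_iff[OF inj_loop])
  have mult: "(loop ` X) \<otimes>\<^bsub>?H\<^esub> (loop ` Y) = loop ` (Y \<otimes>\<^bsub>Q\<^esub> X)" if X: "X \<in> carrier Q" and Y: "Y \<in> carrier Q" for X Y
  proof -
    obtain \<alpha> \<beta> where \<alpha>: "\<alpha> \<in> Hom C t t" "X = ?K #>\<^bsub>?E\<^esub> \<alpha>" and \<beta>: "\<beta> \<in> Hom C t t" "Y = ?K #>\<^bsub>?E\<^esub> \<beta>"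
      using X Y by (auto simp: Q RCOSETS_def E)
    have YX: "Y \<otimes>\<^bsub>Q\<^esub> X = ?K #>\<^bsub>?E\<^esub> (\<beta> \<cdot> \<alpha>)"
      using rcos_sum[of \<beta> \<alpha>] \<alpha> \<beta> by (simp add: Q E)
    have sub: "X \<subseteq> Hom C t t" "Y \<subseteq> Hom C t t"
      using r_coset_subset_G[OF subset] \<alpha> \<beta> E(1) by simp_all
    have const: "?R `` {loop (\<beta>' \<cdot> bd t a \<cdot> \<alpha>')} = loop ` (Y \<otimes>\<^bsub>Q\<^esub> X)"
      if in_XY: "\<alpha>' \<in> X" "\<beta>' \<in> Y" and a: "a \<in> carrier (A t)" for \<alpha>' \<beta>' a
    proof -
      have a': "bd t a \<in> Hom C t t" and \<alpha>': "\<alpha>' \<in> Hom C t t" and \<beta>': "\<beta>' \<in> Hom C t t"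
        using bd_closed[OF t a] in_XY sub by auto
      have "?K #>\<^bsub>?E\<^esub> (bd t a) = ?K"
        using coset_join2[OF _ subgroup_axioms] a a' E(1) by simp
      then have "?K #>\<^bsub>?E\<^esub> (\<beta>' \<cdot> bd t a) = ?K #>\<^bsub>?E\<^esub> \<beta>'"
        using rcos_sum[of \<beta>' "bd t a"] rcos_sum[of \<beta>' "ident C t"] coset_mult_one subset a' \<beta>' id
          comp_ident_right[OF \<beta>'] by (simp add: E)
      then have "?K #>\<^bsub>?E\<^esub> ((\<beta>' \<cdot> bd t a) \<cdot> \<alpha>') = ?K #>\<^bsub>?E\<^esub> (\<beta>' \<cdot> \<alpha>')"
        using rcos_sum[of "\<beta>' \<cdot> bd t a" \<alpha>'] rcos_sum[of \<beta>' \<alpha>'] comp_Hom[OF \<beta>' a'] \<alpha>' \<beta>' by (simp add: E)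
      moreover have "?K #>\<^bsub>?E\<^esub> \<alpha>' = X" "?K #>\<^bsub>?E\<^esub> \<beta>' = Y"
        using repr_independence[OF _ _ subgroup_axioms] in_XY \<alpha> \<beta> E(1) by simp_all
      ultimately have "?K #>\<^bsub>?E\<^esub> (\<beta>' \<cdot> bd t a \<cdot> \<alpha>') = Y \<otimes>\<^bsub>Q\<^esub> X"
        using rcos_sum[of \<beta>' \<alpha>'] \<alpha>' \<beta>' comp_assoc[OF \<beta>' a' \<alpha>'] by (simp add: Q E)
      then show ?thesis
        using coset comp_Hom[OF \<beta>' comp_Hom[OF a' \<alpha>']] by simp
    qed
    have "(loop ` X) \<otimes>\<^bsub>?H\<^esub> (loop ` Y) = (\<Union>\<alpha>'\<in>X. \<Union>\<beta>'\<in>Y.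
        \<Union>y\<in>(\<lambda>w. nerve_face C A act bd 2 1 w) ` mult_fillers \<N> (Vertex t) 1 (loop \<alpha>') (loop \<beta>'). ?R `` {y})"
      by (simp add: homotopy_group_def numeral_2_eq_2)
    also have "\<dots> = (\<Union>\<alpha>'\<in>X. \<Union>\<beta>'\<in>Y. \<Union>a\<in>carrier (A t). ?R `` {loop (\<beta>' \<cdot> bd t a \<cdot> \<alpha>')})"
      using sub fillers by (intro SUP_cong refl) (auto simp: subset_iff)
    also have "\<dots> = (\<Union>\<alpha>'\<in>X. \<Union>\<beta>'\<in>Y. \<Union>a\<in>carrier (A t). loop ` (Y \<otimes>\<^bsub>Q\<^esub> X))"
      using const by (intro SUP_cong refl) simp
    also have "\<dots> = loop ` (Y \<otimes>\<^bsub>Q\<^esub> X)"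
    proof -
      have "X \<noteq> {}" "Y \<noteq> {}" "carrier (A t) \<noteq> {}"
        using rcos_self[OF _ subgroup_axioms] \<alpha> \<beta> E(1) monoid.one_closed[OF monoid_A[OF t]] by auto
      then show ?thesis by simp
    qed
    finally show ?thesis .
  qed
  have one: "\<one>\<^bsub>?H\<^esub> = loop ` \<one>\<^bsub>Q\<^esub>"
    using coset[OF id] coset_mult_one[OF subset] E(3)
    by (simp add: homotopy_group_def degen_vertex_nerve[OF t] const_1_loop Q del: degen_vertex.simps One_nat_def)
  have gQ: "group Q" unfolding Q_def by (rule factorgroup_is_group)
  have bij: "bij_betw (\<lambda>X. loop ` X) (carrier Q) (carrier ?H)"
    using car inj by (simp add: bij_betw_def)
  show "group ?H" "?H \<cong> Q"
    using opposite_group_transfer[OF gQ bij mult one] by simp_all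
qed

definition bubble :: "'a \<Rightarrow> 'c \<Rightarrow> ('a, 'b, 'c) nerve_simplex" where
  "bubble t a = mk_matrix 2 (\<lambda>_. ident C t) (\<lambda>_ _. a)"

lemma bubble_eq_iff [simp]: "bubble t a = bubble t b \<longleftrightarrow> a = b"
proof
  assume "bubble t a = bubble t b"
  then have "\<forall>i k. 1 \<le> i \<and> i < k \<and> k \<le> (2::nat) \<longrightarrow> a = b"
    unfolding bubble_def mk_matrix_eq_iff by (rule conjunct2)
  from this[rule_format, of 1 2] show "a = b" by simp
qed simp

lemma matrix_of_2_eq_bubble_iff:
  assumes F: "cocycle 2 F"
  shows "matrix_of 2 F = bubble t a \<longleftrightarrow>
    edge F 0 1 = ident C t \<and> edge F 1 2 = ident C t \<and> tri F 0 1 2 = a"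
proof -
  interpret group "A (vert F (Suc 0))" using cocycleD(1)[OF F] group_A by simp
  have "tri F 0 1 1 = \<one>\<^bsub>A (vert F 1)\<^esub>" "tri F 0 1 2 \<in> carrier (A (vert F 1))"
    using cocycleD(6)[OF F, of 0 1] cocycleD(3)[OF F, of 0 1 2] by auto
  moreover have "(\<forall>i. 1 \<le> i \<and> i \<le> 2 \<longrightarrow> P i) \<longleftrightarrow> P 1 \<and> P 2" for P :: "nat \<Rightarrow> bool"
  proof -
    have "1 \<le> i \<and> i \<le> 2 \<longleftrightarrow> i = 1 \<or> i = 2" for i :: nat by auto
    then show ?thesis by metis
  qed
  moreover have "(\<forall>i k. 1 \<le> i \<and> i < k \<and> k \<le> 2 \<longrightarrow> P i k) \<longleftrightarrow> P 1 2" for P :: "nat \<Rightarrow> nat \<Rightarrow> bool"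
  proof -
    have "1 \<le> i \<and> i < k \<and> k \<le> 2 \<longleftrightarrow> i = 1 \<and> k = 2" for i k :: nat by auto
    then show ?thesis by metis
  qed
  ultimately show ?thesis
    unfolding matrix_of_def bubble_def mk_matrix_eq_iff if_not_P[OF zero_neq_numeral[symmetric]]
    by simp
qed

lemma const_2_bubble:
  assumes "t \<in> Obj C"
  shows "matrix_of 2 (const_labelling t) = bubble t \<one>\<^bsub>A t\<^esub>"
  using matrix_of_2_eq_bubble_iff[OF cocycle_const[OF assms]] by simp

lemma spheres_2:
  assumes t: "t \<in> Obj C"
  shows "spheres \<N> (Vertex t) 2 = bubble t ` kernel (A t) (End C t) (bd t)"
proof (intro equalityI subsetI)
  have three: "j \<le> 2 \<longleftrightarrow> j = 0 \<or> j = 1 \<or> j = 2" for j :: nat by auto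
  note id = ident_Hom[OF t]
  {
    fix y assume y: "y \<in> spheres \<N> (Vertex t) 2"
    then obtain F where F: "cocycle 2 F" "matrix_of 2 F = y"
      using nerve_simplex_matrix_of[of y 2] by (auto simp: spheres_def)
    have e: "edge F 0 1 = ident C t" "edge F 0 2 = ident C t" "edge F 1 2 = ident C t"
      using y faces_2[OF F(1)] F(2) const_1_loop[of t] degen_vertex_nerve[OF t, of 1]
      by (auto simp: spheres_def three)
    have v: "vert F 1 = t"
      using cocycleD(2)[OF F(1), of 0 1] e(1) id by (auto simp: Hom_def)
    have a: "tri F 0 1 2 \<in> carrier (A t)" using cocycleD(3)[OF F(1), of 0 1 2] v by simp
    note H = bd_closed[OF t a]
    have "bd t (tri F 0 1 2) = ident C t"
      using cocycleD(7)[OF F(1), of 0 1 2] e v comp_ident_right[OF H] comp_ident_left[OF H] by simp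
    moreover have "y = bubble t (tri F 0 1 2)"
      using F matrix_of_2_eq_bubble_iff[OF F(1)] e by metis
    ultimately show "y \<in> bubble t ` kernel (A t) (End C t) (bd t)"
      using a by (auto simp: kernel_def End_def)
  next
    fix y assume "y \<in> bubble t ` kernel (A t) (End C t) (bd t)"
    then obtain a where a: "a \<in> carrier (A t)" "bd t a = ident C t" "y = bubble t a"
      by (auto simp: kernel_def End_def)
    obtain F where F: "cocycle 2 F" "edge F 0 1 = ident C t" "edge F 1 2 = ident C t" "tri F 0 1 2 = a"
      "edge F 0 2 = ident C t \<cdot> bd t a \<cdot> ident C t"
      by (rule ex_cocycle_2[OF id id a(1)])
    then have "matrix_of 2 F = y" using matrix_of_2_eq_bubble_iff[OF F(1)] a(3) by simp
    then show "y \<in> spheres \<N> (Vertex t) 2"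
      using matrix_of_closed[OF F(1)] faces_2[OF F(1)] F a(2) comp_ident_left[OF id] const_1_loop[of t]
        degen_vertex_nerve[OF t, of 1]
      by (auto simp: spheres_def three)
  }
qed

lemma faces_3:
  assumes F: "cocycle 3 F"
  shows "nerve_face C A act bd 3 0 (matrix_of 3 F) = bubble t a \<longleftrightarrow>
      edge F 1 2 = ident C t \<and> edge F 2 3 = ident C t \<and> tri F 1 2 3 = a"
    and "nerve_face C A act bd 3 1 (matrix_of 3 F) = bubble t a \<longleftrightarrow>
      edge F 0 2 = ident C t \<and> edge F 2 3 = ident C t \<and> tri F 0 2 3 = a"
    and "nerve_face C A act bd 3 2 (matrix_of 3 F) = bubble t a \<longleftrightarrow>
      edge F 0 1 = ident C t \<and> edge F 1 3 = ident C t \<and> tri F 0 1 3 = a"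
    and "nerve_face C A act bd 3 3 (matrix_of 3 F) = bubble t a \<longleftrightarrow>
      edge F 0 1 = ident C t \<and> edge F 1 2 = ident C t \<and> tri F 0 1 2 = a"
proof -
  have 3: "Suc 2 = 3" by simp
  have face: "nerve_face C A act bd 3 j (matrix_of 3 F) = bubble t a \<longleftrightarrow>
      edge F (skip j 0) (skip j 1) = ident C t \<and> edge F (skip j 1) (skip j 2) = ident C t \<and>
      tri F (skip j 0) (skip j 1) (skip j 2) = a" if "j \<le> 3" for j
    using nerve_face_matrix_of[of 2 F j] matrix_of_2_eq_bubble_iff[OF cocycle_face[of 2 F j]] F that
    unfolding 3 by simp
  have skip: "skip 0 0 = 1" "skip 0 1 = 2" "skip 0 2 = 3" "skip 1 0 = 0" "skip 1 1 = 2" "skip 1 2 = 3"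
    "skip 2 0 = 0" "skip 2 1 = 1" "skip 2 2 = 3" "skip 3 0 = 0" "skip 3 1 = 1" "skip 3 2 = 2"
    by (simp_all add: skip_def)
  show "nerve_face C A act bd 3 0 (matrix_of 3 F) = bubble t a \<longleftrightarrow>
      edge F 1 2 = ident C t \<and> edge F 2 3 = ident C t \<and> tri F 1 2 3 = a"
    and "nerve_face C A act bd 3 1 (matrix_of 3 F) = bubble t a \<longleftrightarrow>
      edge F 0 2 = ident C t \<and> edge F 2 3 = ident C t \<and> tri F 0 2 3 = a"
    and "nerve_face C A act bd 3 2 (matrix_of 3 F) = bubble t a \<longleftrightarrow>
      edge F 0 1 = ident C t \<and> edge F 1 3 = ident C t \<and> tri F 0 1 3 = a"
    and "nerve_face C A act bd 3 3 (matrix_of 3 F) = bubble t a \<longleftrightarrow>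
      edge F 0 1 = ident C t \<and> edge F 1 2 = ident C t \<and> tri F 0 1 2 = a"
    using face[of 0] face[of 1] face[of 2] face[of 3] unfolding skip by simp_all
qed

text \<open>When all edges are identities, the tetrahedron equation says that the two inner triangles and the two outer
  ones have the same product.\<close>

lemma bubble_tetrahedron:
  assumes t: "t \<in> Obj C" and w: "w \<in> nerve_simplices C A 3"
    and a: "a \<in> kernel (A t) (End C t) (bd t)" and b: "b \<in> kernel (A t) (End C t) (bd t)"
    and faces: "nerve_face C A act bd 3 0 w = bubble t \<one>\<^bsub>A t\<^esub>" "nerve_face C A act bd 3 1 w = bubble t a"
      "nerve_face C A act bd 3 3 w = bubble t b"
  shows "nerve_face C A act bd 3 2 w = bubble t (b \<otimes>\<^bsub>A t\<^esub> a)"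
proof -
  obtain F where F: "cocycle 3 F" "matrix_of 3 F = w" using nerve_simplex_matrix_of[OF w] .
  note id = ident_Hom[OF t]
  interpret group "A t" using t group_A by blast
  have e: "edge F 0 1 = ident C t" "edge F 1 2 = ident C t" "edge F 2 3 = ident C t"
    and tr: "tri F 1 2 3 = \<one>\<^bsub>A t\<^esub>" "tri F 0 2 3 = a" "tri F 0 1 2 = b"
    using faces unfolding F(2)[symmetric] faces_3[OF F(1)] by simp_all
  have v: "vert F 1 = t" "vert F 2 = t"
    using cocycleD(2)[OF F(1), of 0 1] cocycleD(2)[OF F(1), of 1 2] e id by (auto simp: Hom_def)
  have c: "tri F 0 1 3 \<in> carrier (A t)" using cocycleD(3)[OF F(1), of 0 1 3] v by simp
  have "edge F 1 3 = ident C t"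
    using cocycleD(7)[OF F(1), of 1 2 3] e tr v bd_one[OF t] comp_ident_left[OF id] by simp
  moreover have "tri F 0 1 3 = b \<otimes>\<^bsub>A t\<^esub> a"
    using cocycleD(8)[OF F(1), of 0 1 2 3] e tr v c b act_ident[OF t] by (simp add: kernel_def)
  ultimately show ?thesis
    unfolding F(2)[symmetric] faces_3[OF F(1)] using e(1) by simp
qed

lemma ex_bubble_tetrahedron:
  assumes t: "t \<in> Obj C"
    and a: "a \<in> kernel (A t) (End C t) (bd t)" and b: "b \<in> kernel (A t) (End C t) (bd t)"
  obtains w where "w \<in> nerve_simplices C A 3"
    "nerve_face C A act bd 3 0 w = bubble t \<one>\<^bsub>A t\<^esub>" "nerve_face C A act bd 3 1 w = bubble t a"
    "nerve_face C A act bd 3 3 w = bubble t b"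
proof -
  note id = ident_Hom[OF t]
  interpret group "A t" using t group_A by blast
  have ab: "a \<in> carrier (A t)" "b \<in> carrier (A t)" "bd t b = ident C t"
    using a b by (auto simp: kernel_def End_def)
  let ?b = "\<lambda>i k. if i = 0 \<and> k = 2 then b else if i = 0 \<and> k = 3 then b \<otimes>\<^bsub>A t\<^esub> a else \<one>\<^bsub>A t\<^esub>"
  obtain F where F: "cocycle 3 F" "\<And>i. i \<le> 3 \<Longrightarrow> vert F i = t" "\<And>i. i < 3 \<Longrightarrow> edge F i (Suc i) = ident C t"
    "\<And>i k. \<lbrakk>i < k; k \<le> 3\<rbrakk> \<Longrightarrow> tri F i (Suc i) k = ?b i k"
    by (rule cocycle_with_spine[of 3 "\<lambda>_. t" "\<lambda>_. ident C t" ?b]) (use t id ab in auto)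
  have e: "edge F 0 1 = ident C t" "edge F 1 2 = ident C t" "edge F 2 3 = ident C t"
    using F(3)[of 0] F(3)[of 1] F(3)[of 2] by (simp_all add: eval_nat_numeral)
  have tr: "tri F 0 1 2 = b" "tri F 0 1 3 = b \<otimes>\<^bsub>A t\<^esub> a" "tri F 1 2 3 = \<one>\<^bsub>A t\<^esub>"
    using F(4)[of 0 2] F(4)[of 0 3] F(4)[of 1 3] by (simp_all add: eval_nat_numeral)
  have e02: "edge F 0 2 = ident C t"
    using cocycleD(7)[OF F(1), of 0 1 2] e tr F(2) ab comp_ident_left[OF id] by simp
  have c: "tri F 0 2 3 \<in> carrier (A t)" using cocycleD(3)[OF F(1), of 0 2 3] F(2) by simp
  have "tri F 0 2 3 = a"
    using cocycleD(8)[OF F(1), of 0 1 2 3] e tr F(2) c ab act_ident[OF t] by (simp add: m_assoc)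
  then show thesis
    using e e02 tr by (intro that[OF matrix_of_closed[OF F(1)]]) (simp_all add: faces_3[OF F(1)] del: One_nat_def)
qed

text \<open>With two trivial faces \<open>bubble_tetrahedron\<close> shows that homotopic 2-spheres are equal, with one that the
  product is that of the kernel, which is commutative by the Peiffer identity.\<close>

theorem pi_2:
  fixes t
  assumes t: "t \<in> Obj C"
  defines "Q \<equiv> (A t)\<lparr>carrier := kernel (A t) (End C t) (bd t)\<rparr>"
  shows "group (homotopy_group 2 \<N> (Vertex t))" "homotopy_group 2 \<N> (Vertex t) \<cong> Q"
proof -
  let ?K = "kernel (A t) (End C t) (bd t)" and ?R = "sphere_rel \<N> (Vertex t) 2"
  let ?H = "homotopy_group 2 \<N> (Vertex t)"
  interpret group_hom "A t" "End C t" "bd t" by (rule group_hom_bd[OF t])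
  have Q: "carrier Q = ?K" "a \<otimes>\<^bsub>Q\<^esub> b = a \<otimes>\<^bsub>A t\<^esub> b" "\<one>\<^bsub>Q\<^esub> = \<one>\<^bsub>A t\<^esub>" for a b
    by (simp_all add: Q_def)
  have gQ: "group Q" unfolding Q_def by (rule G.subgroup_imp_group[OF subgroup_kernel])
  have oneK: "\<one>\<^bsub>A t\<^esub> \<in> ?K" using subgroup.one_closed[OF subgroup_kernel] .
  have K: "a \<in> carrier (A t)" if "a \<in> ?K" for a using that by (simp add: kernel_def)
  have comm: "b \<otimes>\<^bsub>A t\<^esub> a = a \<otimes>\<^bsub>A t\<^esub> b" if "a \<in> ?K" "b \<in> ?K" for a b
    using peiffer[OF t, of a b] act_ident[OF t] that by (simp add: kernel_def End_def)
  have base: "degen_vertex \<N> (Vertex t) 2 = bubble t \<one>\<^bsub>A t\<^esub>"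
    using degen_vertex_nerve[OF t] const_2_bubble[OF t] by simp
  have two: "(\<forall>j<2. P j) \<longleftrightarrow> P 0 \<and> P 1" for P :: "nat \<Rightarrow> bool"
    by (auto simp: less_2_cases_iff)
  have rel: "?R = Id_on (spheres \<N> (Vertex t) 2)"
  proof (intro equalityI subsetI; clarify)
    fix y z assume "(y, z) \<in> ?R"
    then obtain a b w where ab: "a \<in> ?K" "b \<in> ?K" "y = bubble t a" "z = bubble t b"
      and w: "w \<in> nerve_simplices C A 3" "nerve_face C A act bd 3 0 w = bubble t \<one>\<^bsub>A t\<^esub>"
        "nerve_face C A act bd 3 1 w = bubble t \<one>\<^bsub>A t\<^esub>"
        "nerve_face C A act bd 3 2 w = bubble t a" "nerve_face C A act bd 3 3 w = bubble t b"
      unfolding sphere_rel_def base spheres_2[OF t] two by auto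
    have "a = b"
      using bubble_tetrahedron[OF t w(1) oneK ab(2) w(2,3,5)] w(4) K[OF ab(2)] by simp
    then show "(y, z) \<in> Id_on (spheres \<N> (Vertex t) 2)"
      using ab spheres_2[OF t] by auto
  next
    fix y assume y: "y \<in> spheres \<N> (Vertex t) 2"
    then obtain a where a: "a \<in> ?K" "y = bubble t a" using spheres_2[OF t] by auto
    obtain w where w: "w \<in> nerve_simplices C A 3" "nerve_face C A act bd 3 0 w = bubble t \<one>\<^bsub>A t\<^esub>"
      "nerve_face C A act bd 3 1 w = bubble t \<one>\<^bsub>A t\<^esub>" "nerve_face C A act bd 3 3 w = bubble t a"
      using ex_bubble_tetrahedron[OF t oneK a(1)] .
    have "nerve_face C A act bd 3 2 w = bubble t a"
      using bubble_tetrahedron[OF t w(1) oneK a(1) w(2-4)] K[OF a(1)] by simp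
    then show "(y, y) \<in> ?R"
      using y w a unfolding sphere_rel_def base two by auto
  qed
  have cls: "?R `` {bubble t a} = {bubble t a}" if "a \<in> ?K" for a
    using that spheres_2[OF t] by (auto simp: rel)
  have car: "carrier ?H = (\<lambda>a. {bubble t a}) ` carrier Q"
    using cls by (auto simp: homotopy_group_def quotient_def spheres_2[OF t] Q)
  have mult: "{bubble t a} \<otimes>\<^bsub>?H\<^esub> {bubble t b} = {bubble t (a \<otimes>\<^bsub>Q\<^esub> b)}"
    if "a \<in> carrier Q" "b \<in> carrier Q" for a b
  proof -
    have ab: "a \<in> ?K" "b \<in> ?K" using that by (simp_all add: Q)
    have abK: "b \<otimes>\<^bsub>A t\<^esub> a \<in> ?K" using subgroup.m_closed[OF subgroup_kernel ab(2,1)] .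
    let ?M = "mult_fillers \<N> (Vertex t) 2 (bubble t a) (bubble t b)"
    have M: "?M = {w \<in> nerve_simplices C A 3. nerve_face C A act bd 3 0 w = bubble t \<one>\<^bsub>A t\<^esub> \<and>
        nerve_face C A act bd 3 1 w = bubble t a \<and> nerve_face C A act bd 3 3 w = bubble t b}"
      unfolding mult_fillers_def base by auto
    have "{bubble t a} \<otimes>\<^bsub>?H\<^esub> {bubble t b} = (\<Union>w\<in>?M. ?R `` {nerve_face C A act bd 3 2 w})"
      by (simp add: homotopy_group_def)
    also have "\<dots> = (\<Union>w\<in>?M. {bubble t (b \<otimes>\<^bsub>A t\<^esub> a)})"
      using bubble_tetrahedron[OF t _ ab] cls[OF abK] by (intro SUP_cong refl) (auto simp: M)
    also have "\<dots> = {bubble t (b \<otimes>\<^bsub>A t\<^esub> a)}"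
      using ex_bubble_tetrahedron[OF t ab] by (auto simp: M)
    finally show ?thesis using comm[OF ab] by (simp add: Q)
  qed
  have one: "\<one>\<^bsub>?H\<^esub> = {bubble t \<one>\<^bsub>Q\<^esub>}"
    using cls[OF oneK] base by (simp add: homotopy_group_def Q)
  have bij: "bij_betw (\<lambda>a. {bubble t a}) (carrier Q) (carrier ?H)"
    using car by (simp add: bij_betw_def inj_on_def)
  show "group ?H" "?H \<cong> Q"
    using group_transfer[OF gQ bij mult one] by simp_all
qed

text \<open>Three indices leave out one of the at least four vertices, so every label of a sphere occurs in one of its faces.\<close>

lemma spheres_ge_3:
  assumes t: "t \<in> Obj C" and n: "3 \<le> n"
  shows "spheres \<N> (Vertex t) n = {matrix_of n (const_labelling t)}"
proof -
  obtain m where m: "n = Suc m" using n by (cases n) auto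
  note coc = cocycle_const[OF t]
  have "y = matrix_of n (const_labelling t)" if y: "y \<in> spheres \<N> (Vertex t) n" for y
  proof -
    obtain F where F: "cocycle n F" "matrix_of n F = y"
      using y nerve_simplex_matrix_of[of y n] by (auto simp: spheres_def)
    have ag: "agree m (pull (skip p) F) (const_labelling t)" if "p \<le> n" for p
    proof (rule matrix_of_eq_imp_agree[OF _ coc])
      show "cocycle m (pull (skip p) F)" using cocycle_face F(1) that m by simp
      show "matrix_of m (pull (skip p) F) = matrix_of m (const_labelling t)"
        using y that F nerve_face_matrix_of[of m F p] degen_vertex_nerve[OF t, of m]
        by (auto simp: spheres_def m)
    qed
    have avoid: "\<exists>p\<le>n. \<exists>i' j' k'. i' \<le> j' \<and> j' \<le> k' \<and> k' \<le> m \<and> skip p i' = i \<and> skip p j' = j \<and> skip p k' = k"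
      if ijk: "i \<le> j" "j \<le> k" "k \<le> n" for i j k
    proof -
      have "card {i, j, k} \<le> n" using n by (simp add: card_insert_if)
      then obtain p where p: "p \<le> n" "p \<notin> {i, j, k}" using ex_avoiding[of "{i, j, k}" n] by auto
      have "skip p (unskip p v) = v" if "v \<noteq> p" for v using that by (auto simp: skip_def unskip_def)
      moreover have "unskip p k \<le> m" using unskip_le[of k p n] p ijk m by simp
      ultimately show ?thesis
        using p unskip_mono[OF ijk(1)] unskip_mono[OF ijk(2)]
        by (intro exI[of _ p] conjI exI[of _ "unskip p i"] exI[of _ "unskip p j"] exI[of _ "unskip p k"]) simp_all
    qed
    have "agree n F (const_labelling t)"
      unfolding agree_def
    proof (intro conjI allI impI; (elim conjE)?)
      fix i assume "i \<le> n"
      then show "vert F i = vert (const_labelling t) i"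
        using avoid[of i i i] agreeD(1)[OF ag] by auto
    next
      fix i j assume "i \<le> j" "j \<le> n"
      then show "edge F i j = edge (const_labelling t) i j"
        using avoid[of i j j] agreeD(2)[OF ag] by auto
    next
      fix i j k assume "i \<le> j" "j \<le> k" "k \<le> n"
      then show "tri F i j k = tri (const_labelling t) i j k"
        using avoid[of i j k] agreeD(3)[OF ag] by auto
    qed
    then show ?thesis using F(2) matrix_of_agree by metis
  qed
  moreover have "matrix_of n (const_labelling t) \<in> spheres \<N> (Vertex t) n"
    using matrix_of_closed[OF coc] nerve_face_matrix_of[OF coc, of _ m] degen_vertex_nerve[OF t, of m]
    by (auto simp: spheres_def m)
  ultimately show ?thesis by blast
qed

theorem pi_ge_3:
  assumes t: "t \<in> Obj C" and n: "3 \<le> n"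
  shows "trivial_group (homotopy_group n \<N> (Vertex t))"
proof -
  let ?c = "\<lambda>n. matrix_of n (const_labelling t)"
  let ?R = "sphere_rel \<N> (Vertex t) n" and ?H = "homotopy_group n \<N> (Vertex t)"
  note coc = cocycle_const[OF t]
  have top: "?c (Suc n) \<in> nerve_simplices C A (Suc n)"
    by (rule matrix_of_closed[OF coc])
  have top_face: "nerve_face C A act bd (Suc n) j (?c (Suc n)) = ?c n" if "j \<le> Suc n" for j
    using nerve_face_matrix_of[OF coc that] by simp
  have rel: "?R = {(?c n, ?c n)}"
    unfolding sphere_rel_def spheres_ge_3[OF t n] degen_vertex_nerve[OF t]
    using top top_face by (auto intro!: bexI[of _ "?c (Suc n)"])
  have car: "carrier ?H = {{?c n}}" and one: "\<one>\<^bsub>?H\<^esub> = {?c n}"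
    by (auto simp: homotopy_group_def quotient_def spheres_ge_3[OF t n] rel degen_vertex_nerve[OF t])
  have "?c (Suc n) \<in> mult_fillers \<N> (Vertex t) n (?c n) (?c n)"
    using top top_face by (simp add: mult_fillers_def degen_vertex_nerve[OF t])
  moreover have "nerve_face C A act bd (Suc n) n (?c (Suc n)) = ?c n" using top top_face by simp
  ultimately have mult: "{?c n} \<otimes>\<^bsub>?H\<^esub> {?c n} = {?c n}"
    by (auto simp: homotopy_group_def rel)
  have "group ?H"
    by (rule groupI) (auto simp: car one mult)
  then show ?thesis
    by (simp add: trivial_group_def car one)
qed

end

theorem mainTheorem4:
  fixes C :: "('o, 'm) cat"
    and A :: "'o \<Rightarrow> 'a monoid"
    and act :: "'m \<Rightarrow> 'a \<Rightarrow> 'a"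
    and bd :: "'o \<Rightarrow> 'a \<Rightarrow> 'm"
  assumes "crossed_module C A act bd"
  shows "kan_complex (nerve C A act bd) \<and>
    (\<forall>t \<in> Obj C.
       (bd t ` carrier (A t)) \<lhd> End C t \<and>
       group (homotopy_group 1 (nerve C A act bd) (Vertex t)) \<and>
       homotopy_group 1 (nerve C A act bd) (Vertex t) \<cong> End C t Mod (bd t ` carrier (A t)) \<and>
       group (homotopy_group 2 (nerve C A act bd) (Vertex t)) \<and>
       homotopy_group 2 (nerve C A act bd) (Vertex t) \<cong>
         (A t)\<lparr>carrier := kernel (A t) (End C t) (bd t)\<rparr> \<and>
       (\<forall>n\<ge>3. trivial_group (homotopy_group n (nerve C A act bd) (Vertex t))))"
proof -
  interpret crossed_module C A act bd by (rule assms)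
  show ?thesis
    using kan_complex_nerve normal_image_bd pi_1 pi_2 pi_ge_3 by blast
qed

end
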